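(* A minimal-ABC tree (of order $n\ge 10$), regarded as a rooted tree, does not contain more than eleven $B_2$-branches.
   Context: For a tree $G$ and an edge $uv$, let $f(d(u),d(v))=\sqrt{\frac{d(u)+d(v)-2}{d(u)d(v)}}$, where $d(\cdot)$ is the vertex degree; the atom-bond connectivity index is $\mathrm{ABC}(G)=\sum_{uv\in E(G)} f(d(u),d(v))$. A minimal-ABC tree is a tree with minimum ABC index among all trees with the same number of vertices; the paper considers trees of order at least $10$. Trees are regarded as rooted trees (with the usual notions of parent and child). For $k\ge 1$, a $B_k$-branch is a subtree consisting of a vertex $v$ together with all its descendants, where $v$ has exactly $k$ children, each child of $v$ has degree $2$, and each such child has exactly one child, which is a leaf (so a $B_2$-branch is rooted at a vertex of degree $3$ carrying two pendant paths of length two). *)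

theory Defs
  imports Complex_Main
begin

text \<open>A graph is a pair of a vertex set V and a set E of two-element subsets of V.\<close>

definition simple_graph :: "'a set \<Rightarrow> 'a set set \<Rightarrow> bool" where
  "simple_graph V E \<longleftrightarrow> finite V \<and> (\<forall>e\<in>E. e \<subseteq> V \<and> card e = 2)"

definition adjacent :: "'a set set \<Rightarrow> 'a \<Rightarrow> 'a \<Rightarrow> bool" where
  "adjacent E u v \<longleftrightarrow> {u, v} \<in> E"

definition vdegree :: "'a set set \<Rightarrow> 'a \<Rightarrow> nat" where
  "vdegree E v = card {e \<in> E. v \<in> e}"

definition gpath :: "'a set set \<Rightarrow> 'a list \<Rightarrow> bool" where
  "gpath E p \<longleftrightarrow> p \<noteq> [] \<and> distinct p \<and> successively (adjacent E) p"

text \<open>A cycle is listed without repeating its first vertex at the end.\<close>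

definition gcycle :: "'a set set \<Rightarrow> 'a list \<Rightarrow> bool" where
  "gcycle E p \<longleftrightarrow> gpath E p \<and> length p \<ge> 3 \<and> adjacent E (last p) (hd p)"

definition connected_graph :: "'a set \<Rightarrow> 'a set set \<Rightarrow> bool" where
  "connected_graph V E \<longleftrightarrow>
     V \<noteq> {} \<and> (\<forall>u\<in>V. \<forall>v\<in>V. \<exists>p. gpath E p \<and> hd p = u \<and> last p = v)"

definition tree_graph :: "'a set \<Rightarrow> 'a set set \<Rightarrow> bool" where
  "tree_graph V E \<longleftrightarrow> simple_graph V E \<and> connected_graph V E \<and> (\<nexists>p. gcycle E p)"

definition abc_f :: "real \<Rightarrow> real \<Rightarrow> real" where
  "abc_f x y = sqrt ((x + y - 2) / (x * y))"

text \<open>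
  Edges are unordered, so the weight of an edge is written with a sum and a product over its
  two ends; the lemma below recovers the binary function.
\<close>

definition abc_weight :: "'a set set \<Rightarrow> 'a set \<Rightarrow> real" where
  "abc_weight E e =
     sqrt (((\<Sum>v\<in>e. real (vdegree E v)) - 2) / (\<Prod>v\<in>e. real (vdegree E v)))"

lemma abc_weight_edge:
  assumes "u \<noteq> v"
  shows "abc_weight E {u, v} = abc_f (real (vdegree E u)) (real (vdegree E v))"
  using assms by (simp add: abc_weight_def abc_f_def)

definition ABC_index :: "'a set set \<Rightarrow> real" where
  "ABC_index E = (\<Sum>e\<in>E. abc_weight E e)"

text \<open>
  Competitors live in the same vertex type. This is no restriction: every tree of order
  card V is isomorphic to one with vertex set V.
\<close>

definition minimal_ABC_tree :: "'a set \<Rightarrow> 'a set set \<Rightarrow> bool" where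
  "minimal_ABC_tree V E \<longleftrightarrow> tree_graph V E \<and>
     (\<forall>V' E'. tree_graph (V' :: 'a set) E' \<and> card V' = card V \<longrightarrow>
        ABC_index E \<le> ABC_index E')"

text \<open>
  In the tree rooted at r, w is a child of v iff v is the last vertex before w on the path
  from r to w.
\<close>

definition children :: "'a set set \<Rightarrow> 'a \<Rightarrow> 'a \<Rightarrow> 'a set" where
  "children E r v = {w. \<exists>p. gpath E (p @ [v, w]) \<and> hd (p @ [v, w]) = r}"

text \<open>Every vertex is a descendant of itself here.\<close>

definition descendants :: "'a set set \<Rightarrow> 'a \<Rightarrow> 'a \<Rightarrow> 'a set" where
  "descendants E r v = {w. (v, w) \<in> {(x, y). y \<in> children E r x}\<^sup>*}"

definition rooted_subtree :: "'a set set \<Rightarrow> 'a \<Rightarrow> 'a \<Rightarrow> 'a set \<times> 'a set set" where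
  "rooted_subtree E r v =
     (descendants E r v, {e \<in> E. e \<subseteq> descendants E r v})"

definition B_branch_root :: "'a set set \<Rightarrow> 'a \<Rightarrow> nat \<Rightarrow> 'a \<Rightarrow> bool" where
  "B_branch_root E r k v \<longleftrightarrow>
     card (children E r v) = k \<and>
     (\<forall>c \<in> children E r v. vdegree E c = 2 \<and>
        (\<exists>l. children E r c = {l} \<and> vdegree E l = 1))"

text \<open>Only meaningful for positive k; for k = 0 the root condition just says ``no children''.\<close>

definition B_branches :: "'a set \<Rightarrow> 'a set set \<Rightarrow> 'a \<Rightarrow> nat \<Rightarrow> ('a set \<times> 'a set set) set" where
  "B_branches V E r k = {rooted_subtree E r v | v. v \<in> V \<and> B_branch_root E r k v}"

end

theory Submission
  imports Defs "HOL-Library.Multiset"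
begin

text \<open>
  Write the weight of an edge as \<open>1 / sqrt 2\<close> minus its gain. Edges at a vertex of degree two have
  gain zero, so a minimal tree is one of maximal total gain, and superfluous vertices may be parked
  on a pendant path at no cost. The gain is strictly supermodular in the two degrees: exchanging
  branches between two vertices so that the larger degrees meet raises the total.

  Suppose that there are twelve \<open>B\<^sub>2\<close>-branches. Local surgery shows that all vertices of degree one or
  two lie on pendant paths of length two. Root the tree at a vertex q of the largest degree D that
  carries a \<open>B\<^sub>2\<close>-branch. By exchanges every other vertex of degree below D carries only pendant paths
  and \<open>B\<^sub>2\<close>-branches. Taking such a vertex apart, hanging its pieces as \<open>B\<^sub>3\<close>- and \<open>B\<^sub>2\<close>-branches on its
  neighbour, is profitable, with one exception (one \<open>B\<^sub>2\<close>-branch and two paths) that can occur only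
  once. Among vertices of equal degree D the exchanges are neutral, and all remaining
  \<open>B\<^sub>2\<close>-branches can be collected at q, so q carries at least eleven of them. Then replacing seven
  \<open>B\<^sub>2\<close>-branches by five \<open>B\<^sub>3\<close>-branches is profitable.
\<close>

section \<open>Edge gains\<close>

text \<open>The obstacle is that little is known about the rest of the tree. Seven
  \<open>B2\<close>-branches and five \<open>B3\<close>-branches both have 35 vertices, but the last
  exchange lowers the degree of q by two, and the edge from q to a neighbour loses the more, the
  larger the degree of that neighbour is. So it has to be known first that at most one neighbour of
  q has degree above 4, and the earlier exchanges serve this purpose. A vertex that is taken apart
  hangs on a neighbour of unknown degree X, so the surgery has to pay for every X. Supermodularity
  makes degree 3 the worst case for the other neighbours, and an inequality in the single variable X
  remains, proved with rational bounds. The twelfth branch is slack: one may sit at the exceptional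
  vertex, and the remaining eleven are at q. Neutral exchanges make no progress in gain, so the
  extremal tree is chosen to maximise a secondary \<open>score\<close> as well.\<close>

definition gain :: "nat \<Rightarrow> nat \<Rightarrow> real" where
  "gain d e = sqrt (1/2) - abc_f (real d) (real e)"

lemma abc_f_commute: "abc_f x y = abc_f y x"
  by (simp add: abc_f_def algebra_simps)

lemma gain_commute: "gain d e = gain e d"
  by (simp add: gain_def abc_f_commute)

lemma abc_f_le: "c \<ge> 0 \<Longrightarrow> x > 0 \<Longrightarrow> y > 0 \<Longrightarrow> x + y - 2 \<le> c\<^sup>2 * (x * y) \<Longrightarrow> abc_f x y \<le> c"
  unfolding abc_f_def by (rule real_le_lsqrt) (simp_all add: divide_le_eq)

lemma abc_f_ge: "x > 0 \<Longrightarrow> y > 0 \<Longrightarrow> c\<^sup>2 * (x * y) \<le> x + y - 2 \<Longrightarrow> c \<le> abc_f x y"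
  unfolding abc_f_def by (rule real_le_rsqrt) (simp add: le_divide_eq)

lemma abc_f_power2:
  assumes "x \<ge> 1" "y \<ge> 1" shows "(abc_f x y)\<^sup>2 = 1 / x + 1 / y - 2 / (x * y)"
  using assms by (simp add: abc_f_def field_simps)

lemma abc_f_nonneg: "x \<ge> 1 \<Longrightarrow> y \<ge> 1 \<Longrightarrow> abc_f x y \<ge> 0"
  by (simp add: abc_f_def)

lemma gain_2 [simp]: "d > 0 \<Longrightarrow> gain d 2 = 0" "d > 0 \<Longrightarrow> gain 2 d = 0"
  by (simp_all add: gain_def abc_f_def)

text \<open>
  With \<open>p = 1 - 2 / x\<close> and \<open>q = 1 - 2 / y\<close> the weight is \<open>sqrt ((1 - p * q) / 2)\<close>, so that sums
  and products of squared weights are compared by the sign of a product of differences.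
\<close>

lemma abc_f_submodular:
  assumes "1 \<le> x1" "x1 < x2" "1 \<le> y1" "y1 < y2"
  shows "abc_f x1 y1 + abc_f x2 y2 < abc_f x1 y2 + abc_f x2 y1"
proof -
  define p1 p2 q1 q2 where "p1 = 1 - 2 / x1" and "p2 = 1 - 2 / x2" and "q1 = 1 - 2 / y1" and "q2 = 1 - 2 / y2"
  have sq: "abc_f x y = sqrt ((1 - (1 - 2 / x) * (1 - 2 / y)) / 2)" if "1 \<le> x" "1 \<le> y" for x y
    using that by (auto simp: abc_f_def field_simps)
  have lt: "p1 < p2" "q1 < q2"
    using assms by (auto simp: p1_def p2_def q1_def q2_def intro!: divide_strict_left_mono)
  have nn: "(1 - p * q) / 2 \<ge> 0" if "p \<in> {p1, p2}" "q \<in> {q1, q2}" for p q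
  proof -
    have ab: "\<bar>1 - 2 / x\<bar> \<le> 1" if "1 \<le> x" for x :: real
      using that by (simp add: abs_le_iff field_simps)
    have "\<bar>p\<bar> \<le> 1" "\<bar>q\<bar> \<le> 1"
      using that assms ab by (auto simp: p1_def p2_def q1_def q2_def)
    then have "\<bar>p * q\<bar> \<le> 1" by (simp add: abs_mult mult_le_one)
    then show ?thesis by auto
  qed
  define A B C D where "A = (1 - p1 * q1) / 2" and "B = (1 - p2 * q2) / 2"
    and "C = (1 - p1 * q2) / 2" and "D = (1 - p2 * q1) / 2"
  have nnABCD: "A \<ge> 0" "B \<ge> 0" "C \<ge> 0" "D \<ge> 0"
    unfolding A_def B_def C_def D_def by (rule nn; simp)+
  have pr: "(p2 - p1) * (q2 - q1) > 0" using lt by simp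
  have sum: "A + B < C + D"
    using pr by (simp add: A_def B_def C_def D_def field_simps)
  have prod: "A * B \<le> C * D"
    using pr by (simp add: A_def B_def C_def D_def field_simps)
  have "(sqrt A + sqrt B)\<^sup>2 < (sqrt C + sqrt D)\<^sup>2"
  proof -
    have "sqrt A * sqrt B \<le> sqrt C * sqrt D"
      using prod by (simp flip: real_sqrt_mult)
    then show ?thesis using sum nnABCD by (simp add: power2_sum)
  qed
  then have "sqrt A + sqrt B < sqrt C + sqrt D"
    by (rule power_less_imp_less_base) (simp add: nnABCD)
  then show ?thesis
    using assms by (simp add: sq A_def B_def C_def D_def p1_def p2_def q1_def q2_def)
qed

lemma gain_supermodular_strict:
  assumes "1 \<le> d1" "d1 < d2" "1 \<le> e1" "e1 < e2"
  shows "gain d1 e2 + gain d2 e1 < gain d1 e1 + gain d2 e2"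
  using abc_f_submodular[of "real d1" "real d2" "real e1" "real e2"] assms
  by (simp add: gain_def)

lemma gain_supermodular:
  assumes "1 \<le> d1" "d1 \<le> d2" "1 \<le> e1" "e1 \<le> e2"
  shows "gain d1 e2 + gain d2 e1 \<le> gain d1 e1 + gain d2 e2"
  using gain_supermodular_strict[of d1 d2 e1 e2] assms
  by (cases "d1 = d2"; cases "e1 = e2") auto

text \<open>The gain vanishes in column 2, so supermodularity with one degree equal to 2 is
  monotonicity.\<close>

lemma gain_mono: "1 \<le> d1 \<Longrightarrow> d1 \<le> d2 \<Longrightarrow> 2 \<le> e \<Longrightarrow> gain d1 e \<le> gain d2 e"
  using gain_supermodular[of d1 d2 2 e] by simp

lemma gain_strict_mono: "1 \<le> d1 \<Longrightarrow> d1 < d2 \<Longrightarrow> 3 \<le> e \<Longrightarrow> gain d1 e < gain d2 e"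
  using gain_supermodular_strict[of d1 d2 2 e] by simp

lemma gain_nonneg: "2 \<le> d \<Longrightarrow> 2 \<le> e \<Longrightarrow> 0 \<le> gain d e"
  using gain_mono[of 2 d e] by simp

text \<open>
  Adding a path to a \<open>B\<^sub>2\<close>-branch that hangs on a vertex of degree d changes only the edge above its root.
\<close>

definition upgrade_gain :: "nat \<Rightarrow> real" where
  "upgrade_gain d = gain d 4 - gain d 3"

lemma upgrade_gain_mono: "1 \<le> d \<Longrightarrow> d \<le> e \<Longrightarrow> upgrade_gain d \<le> upgrade_gain e"
  using gain_supermodular[of d e 3 4] by (simp add: upgrade_gain_def)

section \<open>Rational bounds for the weights\<close>

lemma sqrt_half_bounds: "sqrt (1/2) \<le> (707107/1000000::real)" "(707106/1000000::real) \<le> sqrt (1/2)"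
  by (rule real_le_lsqrt real_le_rsqrt; simp add: power2_eq_square)+

lemma gain_le: "c \<ge> 0 \<Longrightarrow> d > 0 \<Longrightarrow> e > 0 \<Longrightarrow> c\<^sup>2 * (real d * real e) \<le> real d + real e - 2
   \<Longrightarrow> gain d e \<le> 707107/1000000 - c"
  using abc_f_ge[of "real d" "real e" c] sqrt_half_bounds by (simp add: gain_def)

lemma gain_ge: "c \<ge> 0 \<Longrightarrow> d > 0 \<Longrightarrow> e > 0 \<Longrightarrow> real d + real e - 2 \<le> c\<^sup>2 * (real d * real e)
   \<Longrightarrow> 707106/1000000 - c \<le> gain d e"
  using abc_f_le[of c "real d" "real e"] sqrt_half_bounds by (simp add: gain_def)

lemma gain_3_less:
  assumes "d > 0" shows "gain d 3 \<le> 12976/100000"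
  \<comment> \<open>\<open>57735/100000\<close> lies just below 1 / sqrt 3, the limit of
    \<open>abc_f d 3\<close> for growing \<open>d\<close>.\<close>
  by (rule order.trans[OF gain_le[of "57735/100000"]]) (use assms in \<open>simp_all add: power2_eq_square\<close>)

text \<open>AM-GM, that is, the tangent of the square root at the square of \<open>m\<close>. For
  fixed \<open>x\<close> the squared weight is affine in \<open>1 / y\<close>, hence so is the
  bound.\<close>

lemma abc_f_tangent:
  assumes "x \<ge> 1" "y \<ge> 1" "m > 0"
  shows "abc_f x y \<le> (1 / x + 1 / y - 2 / (x * y) + m\<^sup>2) / (2 * m)"
proof -
  have "2 * (abc_f x y * m) \<le> (abc_f x y)\<^sup>2 + m\<^sup>2"
    using sum_squares_bound[of "abc_f x y" m] by simp
  then show ?thesis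
    using assms by (simp add: abc_f_power2 field_simps)
qed

lemma abc_f_tangent4:
  assumes "y \<ge> 1" "m > 0"
  shows "abc_f y 4 \<le> (1/4 + m\<^sup>2) / (2 * m) + 1 / (4 * m) * (1 / y)"
proof -
  have "(1 / y + 1 / 4 - 2 / (y * 4) + m\<^sup>2) / (2 * m) = (1/4 + m\<^sup>2) / (2 * m) + 1 / (4 * m) * (1 / y)"
    using assms by (simp add: field_simps power2_eq_square)
  then show ?thesis using abc_f_tangent[of y 4 m] assms by simp
qed

lemma abc_f_tangent3:
  assumes "y \<ge> 1" "m > 0"
  shows "abc_f y 3 \<le> (1/3 + m\<^sup>2) / (2 * m) + 1 / (6 * m) * (1 / y)"
proof -
  have "(1 / y + 1 / 3 - 2 / (y * 3) + m\<^sup>2) / (2 * m) = (1/3 + m\<^sup>2) / (2 * m) + 1 / (6 * m) * (1 / y)"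
    using assms by (simp add: field_simps power2_eq_square)
  then show ?thesis using abc_f_tangent[of y 3 m] assms by simp
qed

text \<open>As a function of \<open>1 / X\<close> the weight is concave, so it lies above its chord
  between 0 and \<open>1 / x0\<close>. Here \<open>c\<close> is 1 / sqrt x and \<open>e\<close> the
  slope of this chord, both rounded down.\<close>

lemma abc_f_chord:
  assumes "x \<ge> 1" "x0 > 0" "x0 \<le> X" "X \<ge> 1" "c \<ge> 0" "e \<ge> 0" "c\<^sup>2 * x \<le> 1" "2 * c * e + e\<^sup>2 / x0 \<le> 1 - 2 / x"
  shows "c + e / X \<le> abc_f X x"
proof (rule power2_le_imp_le)
  have X: "X > 0" using assms by simp
  have "(c + e / X)\<^sup>2 = c\<^sup>2 + (2 * c * e + e\<^sup>2 / X) * (1 / X)"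
    using X by (simp add: power2_eq_square field_simps)
  also have "\<dots> \<le> c\<^sup>2 + (2 * c * e + e\<^sup>2 / x0) * (1 / X)"
    using assms X by (intro add_left_mono mult_right_mono) (auto intro!: divide_left_mono)
  also have "\<dots> \<le> 1 / x + (1 - 2 / x) * (1 / X)"
    using assms X by (intro add_mono mult_right_mono) (auto simp: field_simps)
  also have "\<dots> = (abc_f X x)\<^sup>2"
    using assms X by (simp add: abc_f_power2 field_simps)
  finally show "(c + e / X)\<^sup>2 \<le> (abc_f X x)\<^sup>2" .
qed (use assms in \<open>auto intro: abc_f_nonneg\<close>)

text \<open>A difference of roots is the difference of their squares over their sum;
  \<open>phi\<close> bounds both roots, since \<open>abc_f X 3\<close> decreases in
  \<open>X\<close>.\<close>

lemma abc_f_3_diff: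
  assumes "x0 \<ge> 1" "x0 \<le> X" "s \<ge> 0" "phi > 0" "x0 + 1 \<le> phi\<^sup>2 * (x0 * 3)"
  shows "s / (6 * phi * X * (X + s)) \<le> abc_f X 3 - abc_f (X + s) 3"
proof -
  have X: "X > 0" "X \<ge> 1" "X + s \<ge> 1" using assms by simp_all
  have "abc_f X 3 \<le> phi"
  proof (rule abc_f_le)
    have "phi\<^sup>2 * 3 \<ge> 1 + 1 / x0" using assms by (simp add: field_simps)
    moreover have "1 / x0 \<ge> 1 / X" using assms by (simp add: frac_le)
    ultimately have "phi\<^sup>2 * 3 \<ge> 1 + 1 / X" by simp
    then show "X + 3 - 2 \<le> phi\<^sup>2 * (X * 3)" using X by (simp add: field_simps)
  qed (use assms X in auto)
  have sqd: "(abc_f X 3)\<^sup>2 - (abc_f (X + s) 3)\<^sup>2 = s / (3 * X * (X + s))"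
  proof -
    have "(abc_f x 3)\<^sup>2 = 1 / 3 + 1 / x / 3" if "x \<ge> 1" for x
      using that by (simp add: abc_f_power2 field_simps)
    then have "(abc_f X 3)\<^sup>2 - (abc_f (X + s) 3)\<^sup>2 = (1 / X - 1 / (X + s)) / 3"
      using X by (simp add: diff_divide_distrib)
    also have "1 / X - 1 / (X + s) = s / (X * (X + s))" using X by (simp add: field_simps)
    finally show ?thesis by simp
  qed
  then have "(abc_f (X + s) 3)\<^sup>2 \<le> (abc_f X 3)\<^sup>2"
    using X assms by (simp add: field_simps)
  then have le: "abc_f (X + s) 3 \<le> abc_f X 3"
    by (rule power2_le_imp_le) (use X in \<open>simp add: abc_f_nonneg\<close>)
  have "s / (3 * X * (X + s)) = (abc_f X 3 - abc_f (X + s) 3) * (abc_f X 3 + abc_f (X + s) 3)"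
    using sqd by (simp add: power2_eq_square algebra_simps)
  also have "\<dots> \<le> (abc_f X 3 - abc_f (X + s) 3) * (2 * phi)"
    using le \<open>abc_f X 3 \<le> phi\<close> by (intro mult_left_mono) auto
  finally have le2: "s / (3 * X * (X + s)) \<le> (abc_f X 3 - abc_f (X + s) 3) * (2 * phi)" .
  have "0 < 2 * phi" using assms by simp
  from mult_imp_div_pos_le[OF this le2]
  have "s / (3 * X * (X + s)) / (2 * phi) \<le> abc_f X 3 - abc_f (X + s) 3" .
  then show ?thesis by (simp add: ac_simps)
qed

text \<open>
  The square roots are estimated by a chord (from below) and by tangents (from above), all with rational
  coefficients; after multiplication by \<open>X * (X + h)\<close> a quadratic polynomial in \<open>X - x0\<close> with nonnegative
  coefficients remains.
\<close>

lemma dismantle_inequality: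
  fixes X h c0 A C m3 m4 c e phi kap x0 :: real and x k out a3 a2 :: nat
  defines "h \<equiv> real a3 + real a2 - 1"
  defines "c0 \<equiv> kap - a3 * (1/4 + m4\<^sup>2) / (2 * m4) - a2 * (1/3 + m3\<^sup>2) / (2 * m3) + c"
    and "A \<equiv> - (a3 / (4 * m4)) - a2 / (6 * m3)"
    and "C \<equiv> 1 / (6 * phi)"
  assumes "x0 \<le> X" "x0 \<ge> 1" "x \<ge> 1" "a3 + a2 \<ge> 1"
    and pos: "m3 > 0" "m4 > 0" "c \<ge> 0" "e \<ge> 0" "phi > 0"
    and ch: "c\<^sup>2 * x \<le> 1" "2 * c * e + e\<^sup>2 / x0 \<le> 1 - 2 / x"
    and phi: "x0 + 1 \<le> phi\<^sup>2 * (x0 * 3)"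
    and kap: "kap \<le> h * sqrt (1/2) - k * gain x 3 + out * upgrade_gain x"
    and q2: "0 \<le> c0" and q1: "0 \<le> c0 * (2 * x0 + h) + A + e + C * h"
    and q0: "0 < c0 * (x0 * (x0 + h)) + A * x0 + e * (x0 + h) + C * h * (x0 - 1)"
  shows "sqrt (1/2) - abc_f X x + k * gain x 3
    < a3 * (sqrt (1/2) - abc_f (X + h) 4) + a2 * (sqrt (1/2) - abc_f (X + h) 3)
      + out * upgrade_gain x + (X - 1) * (abc_f X 3 - abc_f (X + h) 3)"
proof -
  have h0: "h \<ge> 0" using \<open>a3 + a2 \<ge> 1\<close> by (simp add: h_def)
  have X: "X \<ge> 1" "X > 0" "X + h \<ge> 1" "X + h > 0" using assms h0 by simp_all
  have f4: "abc_f (X + h) 4 \<le> (1/4 + m4\<^sup>2) / (2 * m4) + 1 / (4 * m4) * (1 / (X + h))"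
    using X pos by (intro abc_f_tangent4) auto
  have f3: "abc_f (X + h) 3 \<le> (1/3 + m3\<^sup>2) / (2 * m3) + 1 / (6 * m3) * (1 / (X + h))"
    using X pos by (intro abc_f_tangent3) auto
  have fx: "c + e / X \<le> abc_f X x"
    by (rule abc_f_chord[of _ x0]) (use assms in auto)
  have inc: "(X - 1) * (C * h / (X * (X + h))) \<le> (X - 1) * (abc_f X 3 - abc_f (X + h) 3)"
    using abc_f_3_diff[of x0 X h phi] assms h0 X
    by (intro mult_left_mono) (auto simp: C_def ac_simps)
  have "real a3 * abc_f (X + h) 4 \<le> a3 * ((1/4 + m4\<^sup>2) / (2 * m4) + 1 / (4 * m4) * (1 / (X + h)))"
    using f4 by (intro mult_left_mono) auto
  moreover have "real a2 * abc_f (X + h) 3 \<le> a2 * ((1/3 + m3\<^sup>2) / (2 * m3) + 1 / (6 * m3) * (1 / (X + h)))"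
    using f3 by (intro mult_left_mono) auto
  \<comment> \<open>\<open>c0\<close> gathers the constants, \<open>A\<close> comes from the
    tangents, \<open>e\<close> from the chord and \<open>C\<close> from the old edges of the
    neighbour.\<close>
  moreover have "0 < c0 + A / (X + h) + e / X + (X - 1) * (C * h / (X * (X + h)))"
  proof -
    define z where "z = X - x0"
    have z: "z \<ge> 0" "X = x0 + z" using assms by (simp_all add: z_def)
    have "0 \<le> (c0 * (2 * x0 + h) + A + e + C * h) * z" "0 \<le> c0 * z\<^sup>2"
      using q1 q2 z by simp_all
    with q0 have "0 < (c0 * (x0 * (x0 + h)) + A * x0 + e * (x0 + h) + C * h * (x0 - 1))
        + (c0 * (2 * x0 + h) + A + e + C * h) * z + c0 * z\<^sup>2"
      by linarith
    also have "\<dots> = c0 * (X * (X + h)) + A * X + e * (X + h) + C * h * (X - 1)"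
      by (simp add: z(2) algebra_simps power2_eq_square)
    finally have "0 < (c0 * (X * (X + h)) + A * X + e * (X + h) + C * h * (X - 1)) / (X * (X + h))"
      using X by simp
    also have "\<dots> = c0 + A / (X + h) + e / X + (X - 1) * (C * h / (X * (X + h)))"
      using X by (simp add: add_divide_distrib)
    finally show ?thesis .
  qed
  ultimately show ?thesis
    using fx inc kap
    by (simp add: c0_def A_def h_def algebra_simps diff_divide_distrib add_divide_distrib)
qed

text \<open>
  A vertex of degree x with k \<open>B\<^sub>2\<close>-branches and otherwise only paths is taken apart. Its neighbour of degree X
  receives \<open>a3\<close> \<open>B\<^sub>3\<close>-branches and \<open>a2\<close> \<open>B\<^sub>2\<close>-branches, and \<open>out\<close> vertices of degree at least x elsewhere get a
  \<open>B\<^sub>2\<close>-branch upgraded. The profit is smallest if the other neighbours of the neighbour have degree 3.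
\<close>

definition dismantle_profit :: "nat \<Rightarrow> nat \<Rightarrow> nat \<Rightarrow> nat \<Rightarrow> nat \<Rightarrow> nat \<Rightarrow> real" where
  "dismantle_profit x k out a3 a2 X =
     a3 * gain (X + a3 + a2 - 1) 4 + a2 * gain (X + a3 + a2 - 1) 3 + out * upgrade_gain x
       + (real X - 1) * (gain (X + a3 + a2 - 1) 3 - gain X 3) - gain X x - k * gain x 3"

lemma dismantle_profit_pos:
  fixes h c0 A C m3 m4 c e phi l3 u4 x0 :: real and x k out a3 a2 :: nat
  defines "h \<equiv> real a3 + real a2 - 1"
  defines "c0 \<equiv> (h - k) * (707107/1000000) + (k + out) * l3 - out * u4
     - a3 * (1/4 + m4\<^sup>2) / (2 * m4) - a2 * (1/3 + m3\<^sup>2) / (2 * m3) + c"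
    and "A \<equiv> - (a3 / (4 * m4)) - a2 / (6 * m3)"
    and "C \<equiv> 1 / (6 * phi)"
  assumes "x0 \<le> X" "x0 \<ge> 1" "x \<ge> 1" "a3 + a2 \<ge> 1" "a3 + a2 \<le> k + 1"
    and pos: "m3 > 0" "m4 > 0" "c \<ge> 0" "e \<ge> 0" "phi > 0" "u4 \<ge> 0"
    and ch: "c\<^sup>2 * x \<le> 1" "2 * c * e + e\<^sup>2 / x0 \<le> 1 - 2 / x"
    and phi: "x0 + 1 \<le> phi\<^sup>2 * (x0 * 3)"
    and l3: "l3\<^sup>2 * (real x * 3) \<le> real x + 1" and u4: "real x + 2 \<le> u4\<^sup>2 * (real x * 4)"
    and q2: "0 \<le> c0" and q1: "0 \<le> c0 * (2 * x0 + h) + A + e + C * h"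
    and q0: "0 < c0 * (x0 * (x0 + h)) + A * x0 + e * (x0 + h) + C * h * (x0 - 1)"
  shows "0 < dismantle_profit x k out a3 a2 X"
proof -
  have "l3 \<le> abc_f x 3" "abc_f x 4 \<le> u4"
    using l3 u4 pos \<open>x \<ge> 1\<close> by (auto intro!: abc_f_ge abc_f_le)
  then have "(k + out) * l3 \<le> (k + out) * abc_f x 3" "out * abc_f x 4 \<le> out * u4"
    by (auto intro!: mult_left_mono)
  \<comment> \<open>The factor \<open>h - k\<close> is not positive, so it is the upper bound of
    sqrt (1/2) that has to be inserted.\<close>
  moreover have "(h - k) * (707107/1000000) \<le> (h - k) * sqrt (1/2)"
    using sqrt_half_bounds \<open>a3 + a2 \<le> k + 1\<close> by (intro mult_left_mono_neg) (auto simp: h_def)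
  ultimately have kap: "(h - k) * (707107/1000000) + (k + out) * l3 - out * u4
      \<le> h * sqrt (1/2) - k * gain x 3 + out * upgrade_gain x"
    by (simp add: gain_def upgrade_gain_def algebra_simps)
  have X: "X \<ge> 1" using assms by simp
  have "real (X + a3 + a2 - 1) = X + h"
    using X by (simp add: h_def)
  then show ?thesis
    using dismantle_inequality[OF \<open>x0 \<le> X\<close> \<open>x0 \<ge> 1\<close> \<open>x \<ge> 1\<close> \<open>a3 + a2 \<ge> 1\<close> pos(1-5) ch phi,
      folded h_def, OF kap, folded A_def C_def, folded c0_def, OF q2 q1 q0]
    by (simp add: dismantle_profit_def gain_def)
qed

text \<open>The first condition on the witnesses is the vertex budget: the branch taken apart has
  \<open>5 * k + 2 * t + 1\<close> vertices, a \<open>B3\<close> needs 7, a \<open>B2\<close> needs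
  5 and an upgrade 2. The second one limits the upgrades: of eleven \<open>B2\<close>-branches with
  parents of degree at least \<open>x\<close>, \<open>k\<close> lie in the branch itself. The
  excluded pair \<open>x = 4\<close>, \<open>k = 1\<close> is the exceptional branch.\<close>

lemma dismantle_exists:
  assumes "4 \<le> x" "x = k + t + 1" "k \<ge> 1" "5 \<le> X" "x \<le> X" "t = 0 \<or> x < X"
    "t = 0 \<longrightarrow> x \<le> 11" "t > 0 \<longrightarrow> x \<le> 7" "\<not> (x = 4 \<and> k = 1)"
  shows "\<exists>out a3 a2. 7 * a3 + 5 * a2 + 2 * out \<le> 5 * k + 2 * t + 1 \<and> out + k \<le> 11 \<and> a3 + a2 \<ge> 1 \<and>
    0 < dismantle_profit x k out a3 a2 X"
proof -
  \<comment> \<open>In each row \<open>m3\<close> and \<open>m4\<close> fix the points where the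
    tangents touch, \<open>c\<close> and \<open>e\<close> describe the chord, \<open>l3\<close> is
    \<open>abc_f x 3\<close> rounded down, and \<open>phi\<close> and \<open>u4\<close> are
    \<open>abc_f x0 3\<close> and \<open>abc_f x 4\<close> rounded up.\<close>
  have c43: "0 < dismantle_profit 4 3 1 2 0 X" if "5 \<le> X" for X
    by (rule dismantle_profit_pos[where ?x0.0 = 5 and ?m4.0 = "5478/10000" and ?m3.0 = "6055/10000" and c = "50000/100000" and e = "458/1000"
      and phi = "633/1000" and ?l3.0 = "64549/100000" and ?u4.0 = "61238/100000"]) (use that in \<open>simp_all add: power2_eq_square\<close>)
  have c54: "0 < dismantle_profit 5 4 0 3 0 X" if "5 \<le> X" for X
    by (rule dismantle_profit_pos[where ?x0.0 = 5 and ?m4.0 = "5386/10000" and ?m3.0 = "6000/10000" and c = "44721/100000" and e = "592/1000"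
      and phi = "633/1000" and ?l3.0 = "63245/100000" and ?u4.0 = "59161/100000"]) (use that in \<open>simp_all add: power2_eq_square\<close>)
  have c65: "0 < dismantle_profit 6 5 0 3 1 X" if "6 \<le> X" for X
    by (rule dismantle_profit_pos[where ?x0.0 = 6 and ?m4.0 = "5339/10000" and ?m3.0 = "5972/10000" and c = "40824/100000" and e = "712/1000"
      and phi = "624/1000" and ?l3.0 = "62360/100000" and ?u4.0 = "57736/100000"]) (use that in \<open>simp_all add: power2_eq_square\<close>)
  have c76: "0 < dismantle_profit 7 6 0 3 2 X" if "7 \<le> X" for X
    by (rule dismantle_profit_pos[where ?x0.0 = 7 and ?m4.0 = "5292/10000" and ?m3.0 = "5944/10000" and c = "37796/100000" and e = "818/1000"
      and phi = "618/1000" and ?l3.0 = "61721/100000" and ?u4.0 = "56695/100000"]) (use that in \<open>simp_all add: power2_eq_square\<close>)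
  have c87: "0 < dismantle_profit 8 7 4 4 0 X" if "8 \<le> X" for X
    by (rule dismantle_profit_pos[where ?x0.0 = 8 and ?m4.0 = "5245/10000" and ?m3.0 = "5916/10000" and c = "35355/100000" and e = "913/1000"
      and phi = "613/1000" and ?l3.0 = "61237/100000" and ?u4.0 = "55902/100000"]) (use that in \<open>simp_all add: power2_eq_square\<close>)
  have c98: "0 < dismantle_profit 9 8 3 5 0 X" if "9 \<le> X" for X
    by (rule dismantle_profit_pos[where ?x0.0 = 9 and ?m4.0 = "5245/10000" and ?m3.0 = "5916/10000" and c = "33333/100000" and e = "1000/1000"
      and phi = "609/1000" and ?l3.0 = "60858/100000" and ?u4.0 = "55278/100000"]) (use that in \<open>simp_all add: power2_eq_square\<close>)
  have c109: "0 < dismantle_profit 10 9 2 6 0 X" if "10 \<le> X" for X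
    by (rule dismantle_profit_pos[where ?x0.0 = 10 and ?m4.0 = "5197/10000" and ?m3.0 = "5888/10000" and c = "31622/100000" and e = "1080/1000"
      and phi = "606/1000" and ?l3.0 = "60553/100000" and ?u4.0 = "54773/100000"]) (use that in \<open>simp_all add: power2_eq_square\<close>)
  have c1110: "0 < dismantle_profit 11 10 1 7 0 X" if "11 \<le> X" for X
    by (rule dismantle_profit_pos[where ?x0.0 = 11 and ?m4.0 = "5197/10000" and ?m3.0 = "5888/10000" and c = "30151/100000" and e = "1155/1000"
      and phi = "604/1000" and ?l3.0 = "60302/100000" and ?u4.0 = "54356/100000"]) (use that in \<open>simp_all add: power2_eq_square\<close>)
  have c42: "0 < dismantle_profit 4 2 0 1 1 X" if "5 \<le> X" for X
    by (rule dismantle_profit_pos[where ?x0.0 = 5 and ?m4.0 = "5478/10000" and ?m3.0 = "6055/10000" and c = "50000/100000" and e = "458/1000"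
      and phi = "633/1000" and ?l3.0 = "64549/100000" and ?u4.0 = "61238/100000"]) (use that in \<open>simp_all add: power2_eq_square\<close>)
  have c51: "0 < dismantle_profit 5 1 0 1 1 X" if "6 \<le> X" for X
    by (rule dismantle_profit_pos[where ?x0.0 = 6 and ?m4.0 = "5000/10000" and ?m3.0 = "5774/10000" and c = "44721/100000" and e = "603/1000"
      and phi = "624/1000" and ?l3.0 = "63245/100000" and ?u4.0 = "59161/100000"]) (use that in \<open>simp_all add: power2_eq_square\<close>)
  have c52: "0 < dismantle_profit 5 2 0 2 0 X" if "12 \<le> X" for X
    by (rule dismantle_profit_pos[where ?x0.0 = 12 and ?m4.0 = "5197/10000" and ?m3.0 = "5888/10000" and c = "44721/100000" and e = "633/1000"
      and phi = "601/1000" and ?l3.0 = "63245/100000" and ?u4.0 = "59161/100000"]) (use that in \<open>simp_all add: power2_eq_square\<close>)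
  have c53: "0 < dismantle_profit 5 3 2 2 0 X" if "6 \<le> X" for X
    by (rule dismantle_profit_pos[where ?x0.0 = 6 and ?m4.0 = "5386/10000" and ?m3.0 = "6000/10000" and c = "44721/100000" and e = "603/1000"
      and phi = "624/1000" and ?l3.0 = "63245/100000" and ?u4.0 = "59161/100000"]) (use that in \<open>simp_all add: power2_eq_square\<close>)
  have c61: "0 < dismantle_profit 6 1 0 2 0 X" if "7 \<le> X" for X
    by (rule dismantle_profit_pos[where ?x0.0 = 7 and ?m4.0 = "5050/10000" and ?m3.0 = "5802/10000" and c = "40824/100000" and e = "724/1000"
      and phi = "618/1000" and ?l3.0 = "62360/100000" and ?u4.0 = "57736/100000"]) (use that in \<open>simp_all add: power2_eq_square\<close>)
  have c62: "0 < dismantle_profit 6 2 0 1 2 X" if "7 \<le> X" for X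
    by (rule dismantle_profit_pos[where ?x0.0 = 7 and ?m4.0 = "5000/10000" and ?m3.0 = "5774/10000" and c = "40824/100000" and e = "724/1000"
      and phi = "618/1000" and ?l3.0 = "62360/100000" and ?u4.0 = "57736/100000"]) (use that in \<open>simp_all add: power2_eq_square\<close>)
  have c63: "0 < dismantle_profit 6 3 3 2 0 X" if "7 \<le> X" for X
    by (rule dismantle_profit_pos[where ?x0.0 = 7 and ?m4.0 = "5050/10000" and ?m3.0 = "5802/10000" and c = "40824/100000" and e = "724/1000"
      and phi = "618/1000" and ?l3.0 = "62360/100000" and ?u4.0 = "57736/100000"]) (use that in \<open>simp_all add: power2_eq_square\<close>)
  have c64: "0 < dismantle_profit 6 4 1 3 0 X" if "7 \<le> X" for X
    by (rule dismantle_profit_pos[where ?x0.0 = 7 and ?m4.0 = "5292/10000" and ?m3.0 = "5944/10000" and c = "40824/100000" and e = "724/1000"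
      and phi = "618/1000" and ?l3.0 = "62360/100000" and ?u4.0 = "57736/100000"]) (use that in \<open>simp_all add: power2_eq_square\<close>)
  have c71: "0 < dismantle_profit 7 1 1 2 0 X" if "8 \<le> X" for X
    by (rule dismantle_profit_pos[where ?x0.0 = 8 and ?m4.0 = "5000/10000" and ?m3.0 = "5774/10000" and c = "37796/100000" and e = "830/1000"
      and phi = "613/1000" and ?l3.0 = "61721/100000" and ?u4.0 = "56695/100000"]) (use that in \<open>simp_all add: power2_eq_square\<close>)
  have c72: "0 < dismantle_profit 7 2 0 2 1 X" if "8 \<le> X" for X
    by (rule dismantle_profit_pos[where ?x0.0 = 8 and ?m4.0 = "5000/10000" and ?m3.0 = "5774/10000" and c = "37796/100000" and e = "830/1000"
      and phi = "613/1000" and ?l3.0 = "61721/100000" and ?u4.0 = "56695/100000"]) (use that in \<open>simp_all add: power2_eq_square\<close>)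
  have c73: "0 < dismantle_profit 7 3 0 3 0 X" if "8 \<le> X" for X
    by (rule dismantle_profit_pos[where ?x0.0 = 8 and ?m4.0 = "5292/10000" and ?m3.0 = "5944/10000" and c = "37796/100000" and e = "830/1000"
      and phi = "613/1000" and ?l3.0 = "61721/100000" and ?u4.0 = "56695/100000"]) (use that in \<open>simp_all add: power2_eq_square\<close>)
  have c74: "0 < dismantle_profit 7 4 2 3 0 X" if "8 \<le> X" for X
    by (rule dismantle_profit_pos[where ?x0.0 = 8 and ?m4.0 = "5292/10000" and ?m3.0 = "5944/10000" and c = "37796/100000" and e = "830/1000"
      and phi = "613/1000" and ?l3.0 = "61721/100000" and ?u4.0 = "56695/100000"]) (use that in \<open>simp_all add: power2_eq_square\<close>)
  have c75: "0 < dismantle_profit 7 5 0 4 0 X" if "8 \<le> X" for X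
    by (rule dismantle_profit_pos[where ?x0.0 = 8 and ?m4.0 = "5245/10000" and ?m3.0 = "5916/10000" and c = "37796/100000" and e = "830/1000"
      and phi = "613/1000" and ?l3.0 = "61721/100000" and ?u4.0 = "56695/100000"]) (use that in \<open>simp_all add: power2_eq_square\<close>)
  \<comment> \<open>The uniform estimate of this row starts at \<open>X = 12\<close>; the six
    smaller values are evaluated one at a time.\<close>
  have c52': "0 < dismantle_profit 5 2 0 2 0 X" if X: "6 \<le> X" for X
  proof (cases "12 \<le> X")
    case False
    have g53: "gain 5 3 \<le> 707107/1000000 - 63245/100000" by (rule gain_le) (simp_all add: power2_eq_square)
    from False X have "X = 6 \<or> X = 7 \<or> X = 8 \<or> X = 9 \<or> X = 10 \<or> X = 11" by auto
    then show ?thesis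
    proof (elim disjE)
      assume X: "X = 6"
      have "707106/1000000 - 566947/1000000 \<le> gain 7 4" "707106/1000000 - 617214/1000000 \<le> gain 7 3"
        "gain 6 3 \<le> 707107/1000000 - 623609/1000000" "gain 6 5 \<le> 707107/1000000 - 547722/1000000"
        by (rule gain_le gain_ge; simp add: power2_eq_square)+
      then show ?thesis using g53 by (simp add: dismantle_profit_def X)
    next
      assume X: "X = 7"
      have "707106/1000000 - 559017/1000000 \<le> gain 8 4" "707106/1000000 - 612373/1000000 \<le> gain 8 3"
        "gain 7 3 \<le> 707107/1000000 - 617213/1000000" "gain 7 5 \<le> 707107/1000000 - 534522/1000000"
        by (rule gain_le gain_ge; simp add: power2_eq_square)+
      then show ?thesis using g53 by (simp add: dismantle_profit_def X)
    next
      assume X: "X = 8"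
      have "707106/1000000 - 552771/1000000 \<le> gain 9 4" "707106/1000000 - 608581/1000000 \<le> gain 9 3"
        "gain 8 3 \<le> 707107/1000000 - 612372/1000000" "gain 8 5 \<le> 707107/1000000 - 524404/1000000"
        by (rule gain_le gain_ge; simp add: power2_eq_square)+
      then show ?thesis using g53 by (simp add: dismantle_profit_def X)
    next
      assume X: "X = 9"
      have "707106/1000000 - 547723/1000000 \<le> gain 10 4" "707106/1000000 - 605531/1000000 \<le> gain 10 3"
        "gain 9 3 \<le> 707107/1000000 - 608580/1000000" "gain 9 5 \<le> 707107/1000000 - 516397/1000000"
        by (rule gain_le gain_ge; simp add: power2_eq_square)+
      then show ?thesis using g53 by (simp add: dismantle_profit_def X)
    next
      assume X: "X = 10"
      have "707106/1000000 - 543558/1000000 \<le> gain 11 4" "707106/1000000 - 603023/1000000 \<le> gain 11 3"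
        "gain 10 3 \<le> 707107/1000000 - 605530/1000000" "gain 10 5 \<le> 707107/1000000 - 509901/1000000"
        by (rule gain_le gain_ge; simp add: power2_eq_square)+
      then show ?thesis using g53 by (simp add: dismantle_profit_def X)
    next
      assume X: "X = 11"
      have "707106/1000000 - 540062/1000000 \<le> gain 12 4" "707106/1000000 - 600926/1000000 \<le> gain 12 3"
        "gain 11 3 \<le> 707107/1000000 - 603022/1000000" "gain 11 5 \<le> 707107/1000000 - 504524/1000000"
        by (rule gain_le gain_ge; simp add: power2_eq_square)+
      then show ?thesis using g53 by (simp add: dismantle_profit_def X)
    qed
  qed (rule c52)
  \<comment> \<open>Instantiated below in the order \<open>a3\<close>, \<open>a2\<close>,
    \<open>out\<close>. Each choice spends all vertices of the branch except at most one.\<close>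
  have wit: ?thesis if "7 * a3 + 5 * a2 + 2 * out \<le> 5 * k + 2 * t + 1" "out + k \<le> 11" "a3 + a2 \<ge> 1"
    "0 < dismantle_profit x k out a3 a2 X" for out a3 a2
    using that by blast
  show ?thesis
  proof (cases "t = 0")
    case True
    then have xb: "4 \<le> x" "x \<le> 11" and xk: "x = k + 1" using assms(1,2,7) by simp_all
    from xb have "x = 4 \<or> x = 5 \<or> x = 6 \<or> x = 7 \<or> x = 8 \<or> x = 9 \<or> x = 10 \<or> x = 11"
      by presburger
    then show ?thesis
    proof (elim disjE)
      assume "x = 4"
      with xk have k: "x = 4" "k = 3" by simp_all
      show ?thesis by (rule wit[of 2 0 1]) (use assms(4,5) True k c43[of X] in simp_all)
    next
      assume "x = 5"
      with xk have k: "x = 5" "k = 4" by simp_all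
      show ?thesis by (rule wit[of 3 0 0]) (use assms(4,5) True k c54[of X] in simp_all)
    next
      assume "x = 6"
      with xk have k: "x = 6" "k = 5" by simp_all
      show ?thesis by (rule wit[of 3 1 0]) (use assms(4,5) True k c65[of X] in simp_all)
    next
      assume "x = 7"
      with xk have k: "x = 7" "k = 6" by simp_all
      show ?thesis by (rule wit[of 3 2 0]) (use assms(4,5) True k c76[of X] in simp_all)
    next
      assume "x = 8"
      with xk have k: "x = 8" "k = 7" by simp_all
      show ?thesis by (rule wit[of 4 0 4]) (use assms(4,5) True k c87[of X] in simp_all)
    next
      assume "x = 9"
      with xk have k: "x = 9" "k = 8" by simp_all
      show ?thesis by (rule wit[of 5 0 3]) (use assms(4,5) True k c98[of X] in simp_all)
    next
      assume "x = 10"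
      with xk have k: "x = 10" "k = 9" by simp_all
      show ?thesis by (rule wit[of 6 0 2]) (use assms(4,5) True k c109[of X] in simp_all)
    next
      assume "x = 11"
      with xk have k: "x = 11" "k = 10" by simp_all
      show ?thesis by (rule wit[of 7 0 1]) (use assms(4,5) True k c1110[of X] in simp_all)
    qed
  next
    case False
    then have xb: "4 \<le> x" "x \<le> 7" and lt: "x < X" and kx: "1 \<le> k" "k + 2 \<le> x" and xk: "x = k + t + 1"
      using assms(1-3,6,8) by simp_all
    from xb have "x = 4 \<or> x = 5 \<or> x = 6 \<or> x = 7" by presburger
    then show ?thesis
    proof (elim disjE)
      assume x: "x = 4"
      then have "2 \<le> k" "k \<le> 2" using kx assms(9) by linarith+
      then have k: "k = 2" by presburger
      show ?thesis by (rule wit[of 1 1 0]) (use lt xk x k c42[of X] in simp_all)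
    next
      assume x: "x = 5"
      then have "1 \<le> k" "k \<le> 3" using kx assms(9) by auto
      then have "k = 1 \<or> k = 2 \<or> k = 3" by presburger
      then show ?thesis
      proof (elim disjE)
        assume k: "k = 1"
        show ?thesis by (rule wit[of 1 1 0]) (use lt xk x k c51[of X] in simp_all)
      next
        assume k: "k = 2"
        show ?thesis by (rule wit[of 2 0 0]) (use lt xk x k c52'[of X] in simp_all)
      next
        assume k: "k = 3"
        show ?thesis by (rule wit[of 2 0 2]) (use lt xk x k c53[of X] in simp_all)
      qed
    next
      assume x: "x = 6"
      then have "1 \<le> k" "k \<le> 4" using kx assms(9) by auto
      then have "k = 1 \<or> k = 2 \<or> k = 3 \<or> k = 4" by presburger
      then show ?thesis
      proof (elim disjE)
        assume k: "k = 1"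
        show ?thesis by (rule wit[of 2 0 0]) (use lt xk x k c61[of X] in simp_all)
      next
        assume k: "k = 2"
        show ?thesis by (rule wit[of 1 2 0]) (use lt xk x k c62[of X] in simp_all)
      next
        assume k: "k = 3"
        show ?thesis by (rule wit[of 2 0 3]) (use lt xk x k c63[of X] in simp_all)
      next
        assume k: "k = 4"
        show ?thesis by (rule wit[of 3 0 1]) (use lt xk x k c64[of X] in simp_all)
      qed
    next
      assume x: "x = 7"
      then have "1 \<le> k" "k \<le> 5" using kx assms(9) by auto
      then have "k = 1 \<or> k = 2 \<or> k = 3 \<or> k = 4 \<or> k = 5" by presburger
      then show ?thesis
      proof (elim disjE)
        assume k: "k = 1"
        show ?thesis by (rule wit[of 2 0 1]) (use lt xk x k c71[of X] in simp_all)
      next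
        assume k: "k = 2"
        show ?thesis by (rule wit[of 2 1 0]) (use lt xk x k c72[of X] in simp_all)
      next
        assume k: "k = 3"
        show ?thesis by (rule wit[of 3 0 0]) (use lt xk x k c73[of X] in simp_all)
      next
        assume k: "k = 4"
        show ?thesis by (rule wit[of 3 0 2]) (use lt xk x k c74[of X] in simp_all)
      next
        assume k: "k = 5"
        show ?thesis by (rule wit[of 4 0 0]) (use lt xk x k c75[of X] in simp_all)
      qed
    qed
  qed
qed

section \<open>Loss of gain when a degree drops\<close>

lemma gain_drop_eq:
  assumes "2 \<le> e" "s < d"
  shows "(gain d e - gain (d - s) e) * (abc_f (real (d - s)) e + abc_f d e)
    = (1 - 2 / e) * (s / (real d * real (d - s)))"
proof -
  have ge: "real (d - s) \<ge> 1" "real d \<ge> 1" "real e \<ge> 1" using assms by auto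
  have "(gain d e - gain (d - s) e) * (abc_f (real (d - s)) e + abc_f d e)
    = (abc_f (real (d - s)) e)\<^sup>2 - (abc_f d e)\<^sup>2"
    by (simp add: gain_def power2_eq_square algebra_simps)
  also have "\<dots> = (1 - 2 / e) * (1 / real (d - s) - 1 / real d)"
    unfolding abc_f_power2[OF ge(1,3)] abc_f_power2[OF ge(2,3)] by (simp add: algebra_simps)
  also have "1 / real (d - s) - 1 / real d = s / (real d * real (d - s))"
    using assms by (simp add: of_nat_diff field_simps)
  finally show ?thesis .
qed

lemma gain_drop_le:
  assumes "2 \<le> e" "s < d" and m: "0 < m" "m \<le> abc_f (real (d - s)) e + abc_f d e" and "1 - 2 / e \<le> c"
  shows "gain d e - gain (d - s) e \<le> c * s / (m * (real d * real (d - s)))"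
proof -
  have nn: "0 \<le> gain d e - gain (d - s) e"
    using gain_mono[of "d - s" d e] assms by simp
  have "(gain d e - gain (d - s) e) * m \<le> (1 - 2 / e) * (s / (real d * real (d - s)))"
    unfolding gain_drop_eq[OF assms(1,2), symmetric] using nn m by (intro mult_left_mono) auto
  also have "\<dots> \<le> c * (s / (real d * real (d - s)))"
    using assms by (intro mult_right_mono) auto
  finally have "gain d e - gain (d - s) e \<le> c * (s / (real d * real (d - s))) / m"
    using m(1) by (rule mult_imp_le_div_pos[rotated])
  then show ?thesis by (simp add: ac_simps)
qed

text \<open>A bound uniform in \<open>e\<close>: a weight with one degree at most \<open>d\<close>
  and the other at least 2 is at least 1 / sqrt d, so the two weights in the denominator add up to
  at least 2 / sqrt d.\<close>

lemma gain_drop: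
  assumes "2 \<le> e" "s < d" "2 \<le> d"
  shows "gain d e - gain (d - s) e \<le> s * sqrt d / (2 * (real d * real (d - s)))"
proof -
  have *: "1 / sqrt d \<le> abc_f x e" if "1 \<le> x" "x \<le> d" for x :: real
  proof -
    have "(1 / sqrt d)\<^sup>2 \<le> (abc_f x e)\<^sup>2"
    proof -
      have "(abc_f x e)\<^sup>2 = 1 / x * (1 - 2 / e) + 1 / e"
        using that assms by (simp add: abc_f_power2 field_simps)
      moreover have "1 / real d * (1 - 2 / e) \<le> 1 / x * (1 - 2 / e)"
        using that assms by (intro mult_right_mono) (auto simp: frac_le)
      moreover have "1 / real d * (2 / e) \<le> 1 / e"
        using assms by (simp add: field_simps)
      ultimately show ?thesis
        by (simp add: power_divide algebra_simps)
    qed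
    then show ?thesis
      by (rule power2_le_imp_le) (use that assms in \<open>auto intro: abc_f_nonneg\<close>)
  qed
  have "2 / sqrt d \<le> abc_f (real (d - s)) e + abc_f d e"
    using *[of d] *[of "real (d - s)"] assms by auto
  then have "gain d e - gain (d - s) e \<le> 1 * real s / (2 / sqrt d * (real d * real (d - s)))"
    using assms by (intro gain_drop_le) auto
  then show ?thesis by simp
qed

lemma gain_drop_3:
  assumes "s < d"
  shows "gain d 3 - gain (d - s) 3 \<le> 2887/10000 * s / (real d * real (d - s))"
proof -
  have *: "57735/100000 \<le> abc_f x 3" if "x \<ge> 1" for x
    by (rule abc_f_ge) (use that in \<open>auto simp: power2_eq_square\<close>)
  have "2 * (57735/100000) \<le> abc_f (real (d - s)) 3 + abc_f d 3"
    using *[of "real (d - s)"] *[of d] assms by linarith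
  then have "gain d 3 - gain (d - s) 3 \<le> 1/3 * s / (2 * (57735/100000) * (real d * real (d - s)))"
    using gain_drop_le[of 3 s d "2 * (57735/100000)" "1/3"] assms by simp
  also have "\<dots> = (1/3) / (2 * (57735/100000)) * (s / (real d * real (d - s)))" by simp
  \<comment> \<open>The exact constant would be sqrt 3 / 6, about 0.28868.\<close>
  also have "\<dots> \<le> 2887/10000 * (s / (real d * real (d - s)))"
    by (intro mult_right_mono) auto
  finally show ?thesis by simp
qed

text \<open>By supermodularity degree 4 is the worst case among the degrees up to 4.\<close>

lemma gain_drop_4:
  assumes "s < d" "2 \<le> e" "e \<le> 4"
  shows "gain d e - gain (d - s) e \<le> s / (2 * (real d * real (d - s)))"
proof -
  have *: "1/2 \<le> abc_f x 4" if "x \<ge> 1" for x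
    by (rule abc_f_ge) (use that in \<open>auto simp: power2_eq_square\<close>)
  have "1 \<le> abc_f (real (d - s)) 4 + abc_f d 4"
    using *[of "real (d - s)"] *[of d] assms by linarith
  then have "gain d 4 - gain (d - s) 4 \<le> 1/2 * s / (1 * (real d * real (d - s)))"
    using gain_drop_le[of 4 s d 1 "1/2"] assms by simp
  moreover have "gain d e - gain (d - s) e \<le> gain d 4 - gain (d - s) 4"
  proof -
    have "1 \<le> d - s" using assms by linarith
    from gain_supermodular[OF this, of d e 4] show ?thesis using assms by simp
  qed
  ultimately show ?thesis by simp
qed

lemma sqrt_tangent: "m > 0 \<Longrightarrow> x \<ge> 0 \<Longrightarrow> sqrt x \<le> (x + m\<^sup>2) / (2 * m)"
  using sum_squares_bound[of "sqrt x" m] by (simp add: field_simps)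

text \<open>The balance of the final exchange at a vertex whose degree falls from \<open>d\<close>
  to \<open>d - 2\<close>. Its neighbours are seven \<open>B2\<close>-branches that go, four that
  stay, \<open>d - 12\<close> neighbours of degree at most 4 whose loss is bounded by
  \<open>gain_drop_4\<close>, and one of arbitrary degree \<open>e\<close>.\<close>

lemma seven_to_five:
  assumes d: "12 \<le> d" and e: "2 \<le> e"
  shows "7 * gain d 3 + 4 * (gain d 3 - gain (d - 2) 3) + (real d - 12) * (2 / (2 * (real d * real (d - 2))))
    + (gain d e - gain (d - 2) e) < 5 * gain (d - 2) 4"
proof -
  define x where "x = real d"
  have x: "x \<ge> 12" "real (d - 2) = x - 2" using d by (simp_all add: x_def)
  have f3: "57735/100000 + 2828/10000 / x \<le> abc_f x 3"
    by (rule abc_f_chord[of _ 12]) (use x in \<open>auto simp: power2_eq_square\<close>)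
  have f4: "abc_f (x - 2) 4 \<le> (1/4 + (5385/10000)\<^sup>2) / (2 * (5385/10000)) + 1 / (4 * (5385/10000)) * (1 / (x - 2))"
    by (rule abc_f_tangent4) (use x in auto)
  have g3: "gain d 3 \<le> 707107/1000000 - (57735/100000 + 2828/10000 / x)"
    using f3 sqrt_half_bounds by (simp add: gain_def x_def)
  have g4: "707106/1000000 - ((1/4 + (5385/10000)\<^sup>2) / (2 * (5385/10000)) + 1 / (4 * (5385/10000)) * (1 / (x - 2)))
    \<le> gain (d - 2) 4"
    using f4 sqrt_half_bounds x(2) by (simp add: gain_def)
  have d3: "gain d 3 - gain (d - 2) 3 \<le> 2887/10000 * 2 / (x * (x - 2))"
    using gain_drop_3[of 2 d] d x by (simp add: x_def)
  have de: "gain d e - gain (d - 2) e \<le> (x + 49/4) / 7 / (x * (x - 2))"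
  proof -
    have "gain d e - gain (d - 2) e \<le> sqrt x / (x * (x - 2))"
      using gain_drop[of e 2 d] d e x by (simp add: x_def)
    \<comment> \<open>\<open>7/2\<close> is close to sqrt 12, the root at the smallest admissible
      degree.\<close>
    also have "\<dots> \<le> ((x + (7/2)\<^sup>2) / (2 * (7/2))) / (x * (x - 2))"
      using x by (intro divide_right_mono sqrt_tangent) auto
    finally show ?thesis by (simp add: power2_eq_square)
  qed
  define z where "z = x - 12"
  have z: "z \<ge> 0" "x = 12 + z" using x by (simp_all add: z_def)
  have pos: "x * (x - 2) > 0" using x by simp
  \<comment> \<open>\<open>K\<close> is the estimated profit in the limit of large \<open>d\<close>;
    all other terms vanish there.\<close>
  define K :: real where "K = 5 * (707106/1000000 - (1/4 + (5385/10000)\<^sup>2) / (2 * (5385/10000))) - 7 * (707107/1000000 - 57735/100000)"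
  have K: "K \<ge> 12/100" by (simp add: K_def power2_eq_square)
  have "0 < K * (x * (x - 2)) + 7 * (2828/10000) * (x - 2) - 5 / (4 * (5385/10000)) * x
     - 8 * (2887/10000) - (x - 12) - (x + 49/4) / 7"
  proof -
    have "12/100 * (22 * z + 120) \<le> 12/100 * (x * (x - 2))"
      using z(1) by (simp add: z(2) algebra_simps)
    also have "\<dots> \<le> K * (x * (x - 2))" using K pos by (intro mult_right_mono) auto
    finally show ?thesis using z by (simp add: field_simps)
  qed
  then have "0 < (K * (x * (x - 2)) + 7 * (2828/10000) * (x - 2) - 5 / (4 * (5385/10000)) * x
     - 8 * (2887/10000) - (x - 12) - (x + 49/4) / 7) / (x * (x - 2))"
    using pos by simp
  also have "\<dots> = K + 7 * (2828/10000) / x - 5 / (4 * (5385/10000)) * (1 / (x - 2))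
     - 8 * (2887/10000) / (x * (x - 2)) - (x - 12) / (x * (x - 2)) - (x + 49/4) / 7 / (x * (x - 2))"
  proof -
    have "c * (x - 2) / (x * (x - 2)) = c / x" "c * x / (x * (x - 2)) = c * (1 / (x - 2))"
      "c * (x * (x - 2)) / (x * (x - 2)) = c" for c
      using x by simp_all
    then show ?thesis by (simp only: diff_divide_distrib add_divide_distrib)
  qed
  finally have fin: "0 < K + 7 * (2828/10000) / x - 5 / (4 * (5385/10000)) * (1 / (x - 2))
     - 8 * (2887/10000) / (x * (x - 2)) - (x - 12) / (x * (x - 2)) - (x + 49/4) / 7 / (x * (x - 2))" .
  define M :: real where "M = (1/4 + (5385/10000)\<^sup>2) / (2 * (5385/10000))"
  define i1 i2 i3 where "i1 = 1 / x" and "i2 = 1 / (4 * (5385/10000)) * (1 / (x - 2))" and "i3 = 1 / (x * (x - 2))"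
  define u v where "u = (x - 12) * i3" and "v = (x + 49/4) / 7 * i3"
  have "0 < K + 7 * (2828/10000) * i1 - 5 * i2
     - 8 * (2887/10000) * i3 - u - v"
    using fin by (simp add: u_def v_def i1_def i2_def i3_def)
  moreover have "gain d 3 \<le> 707107/1000000 - 57735/100000 - 2828/10000 * i1" using g3 by (simp add: i1_def)
  moreover have "707106/1000000 - M - i2 \<le> gain (d - 2) 4"
    using g4 by (simp add: i2_def M_def)
  moreover have "gain d 3 - gain (d - 2) 3 \<le> 2887/10000 * 2 * i3" using d3 by (simp add: i3_def)
  moreover have "gain d e - gain (d - 2) e \<le> v" using de by (simp add: i3_def v_def)
  moreover have u: "(real d - 12) * (2 / (2 * (real d * real (d - 2)))) = u"
    using x by (simp add: i3_def x_def u_def)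
  ultimately show ?thesis unfolding u K_def M_def[symmetric] by (simp add: algebra_simps)
qed

text \<open>A path leaves a vertex of degree \<open>x\<close>, and its two vertices upgrade a
  \<open>B2\<close>-branch at a parent of degree at least 9. The left side is the loss at the
  \<open>k\<close> \<open>B2\<close>-branches of the vertex and at its edge to the neighbour of
  degree \<open>X\<close>.\<close>

lemma path_move_profit:
  assumes "8 \<le> x" "k \<le> x - 2" "2 \<le> X"
  shows "k * (gain x 3 - gain (x - 1) 3) + (gain X x - gain X (x - 1)) < upgrade_gain 9"
proof -
  have up: "5580/100000 \<le> upgrade_gain 9"
  proof -
    have "60858/100000 \<le> abc_f 9 3" "abc_f 9 4 \<le> 55278/100000"
      by (rule abc_f_ge abc_f_le; simp add: power2_eq_square)+
    then show ?thesis by (simp add: upgrade_gain_def gain_def)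
  qed
  have nn: "gain x 3 - gain (x - 1) 3 \<ge> 0"
    using gain_mono[of "x - 1" x 3] assms by simp
  have k: "k * (gain x 3 - gain (x - 1) 3) \<le> (real x - 2) * (gain x 3 - gain (x - 1) 3)"
    using assms by (intro mult_right_mono nn) auto
  have X: "gain X x - gain X (x - 1) \<le> sqrt x / (2 * (real x * (real x - 1)))"
    using gain_drop[of X 1 x] assms by (simp add: gain_commute[of X] of_nat_diff)
  show ?thesis
  \<comment> \<open>At \<open>x = 8\<close> the bound of \<open>gain_drop_3\<close> is too coarse,
    so the weights are evaluated.\<close>
  proof (cases "x = 8")
    case True
    have "gain 8 3 - gain 7 3 \<le> 485/100000"
    proof -
      have "61237/100000 \<le> abc_f 8 3" "abc_f 7 3 \<le> 61722/100000"
        by (rule abc_f_ge abc_f_le; simp add: power2_eq_square)+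
      then show ?thesis by (simp add: gain_def)
    qed
    moreover have "sqrt 8 \<le> (283/100::real)"
      by (rule real_le_lsqrt) (auto simp: power2_eq_square)
    ultimately show ?thesis using k X up True by simp
  next
    case False
    define y where "y = real x"
    have y: "y \<ge> 9" using False assms by (simp add: y_def)
    have "gain x 3 - gain (x - 1) 3 \<le> 2887/10000 / (y * (y - 1))"
      using gain_drop_3[of 1 x] assms by (simp add: y_def of_nat_diff)
    then have "(y - 2) * (gain x 3 - gain (x - 1) 3) \<le> (y - 2) * (2887/10000 / (y * (y - 1)))"
      using y by (intro mult_left_mono) auto
    moreover have "sqrt y / (2 * (y * (y - 1))) \<le> ((y + 3\<^sup>2) / (2 * 3)) / (2 * (y * (y - 1)))"
      using y by (intro divide_right_mono sqrt_tangent) auto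
    moreover have "(y - 2) * (2887/10000 / (y * (y - 1))) + ((y + 3\<^sup>2) / (2 * 3)) / (2 * (y * (y - 1))) < 5580/100000"
    proof -
      define z where "z = y - 9"
      have z: "z \<ge> 0" "y = 9 + z" using y by (simp_all add: z_def)
      have pos: "y * (y - 1) > 0" using y by simp
      have "17 * z + 72 \<le> y * (y - 1)"
        using z(1) by (simp add: z(2) algebra_simps)
      then have "5580/100000 * (17 * z + 72) \<le> 5580/100000 * (y * (y - 1))"
        by (intro mult_left_mono) auto
      moreover have "(y - 2) * (2887/10000) + (y + 9) / 12 < 5580/100000 * (17 * z + 72)"
        using z by (simp add: field_simps)
      ultimately have "(y - 2) * (2887/10000) + (y + 9) / 12 < 5580/100000 * (y * (y - 1))"
        by (rule order.strict_trans2[rotated])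
      then have "((y - 2) * (2887/10000) + (y + 9) / 12) / (y * (y - 1)) < 5580/100000"
        using pos by (simp only: pos_divide_less_eq)
      then show ?thesis by (simp add: add_divide_distrib)
    qed
    ultimately show ?thesis using k X up unfolding y_def by linarith
  qed
qed

text \<open>One comparison for each special surgery, in this order: growing a leaf; five
  \<open>B3\<close> for twelve \<open>B2\<close>-branches; cutting at a parent of degree 3; taking a
  branch apart for root degree 5 and 6; merging a path with a \<open>B2\<close> for root degree 7
  and 8; taking a path from a vertex that carries only paths.\<close>

lemma numeric_inequalities:
  shows leaf_profit: "\<And>d. 3 \<le> d \<Longrightarrow> gain d 1 + 12976/100000 < upgrade_gain 3"
    and "12 * gain 4 3 < 5 * gain 8 4"
    and "gain 3 3 < upgrade_gain 5"
    and "gain 5 5 + 4 * gain 5 3 < 3 * gain 7 4 + (gain 7 5 - gain 5 5)"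
    and "gain 6 6 + 5 * gain 6 3 < 4 * gain 8 4 + (gain 8 6 - gain 6 6)"
    and "5 * (gain 7 3 - gain 6 3) + (gain 7 7 - gain 7 6) < upgrade_gain 7"
    and "6 * (gain 8 3 - gain 7 3) + (gain 8 8 - gain 8 7) < upgrade_gain 8"
    and "\<And>t D. 4 \<le> t \<Longrightarrow> 11 \<le> D \<Longrightarrow> gain D (t + 1) - gain D t < upgrade_gain D"
proof -
  have f: "666666/1000000 \<le> abc_f 3 3" "abc_f 3 3 \<le> 666667/1000000" "abc_f 3 4 \<le> 645498/1000000"
    "645497/1000000 \<le> abc_f 4 3" "abc_f 8 4 \<le> 559018/1000000"
    "632455/1000000 \<le> abc_f 5 3" "abc_f 5 3 \<le> 632456/1000000" "abc_f 5 4 \<le> 591608/1000000"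
    "565685/1000000 \<le> abc_f 5 5" "abc_f 5 5 \<le> 565686/1000000" "abc_f 7 4 \<le> 566947/1000000" "abc_f 7 5 \<le> 534523/1000000"
    "527046/1000000 \<le> abc_f 6 6" "abc_f 6 6 \<le> 527047/1000000" "623609/1000000 \<le> abc_f 6 3" "abc_f 6 3 \<le> 623610/1000000"
    "abc_f 8 6 \<le> 500001/1000000" "617213/1000000 \<le> abc_f 7 3" "abc_f 7 3 \<le> 617214/1000000"
    "494871/1000000 \<le> abc_f 7 7" "abc_f 7 6 \<le> 511767/1000000" "612372/1000000 \<le> abc_f 8 3"
    "467707/1000000 \<le> abc_f 8 8" "abc_f 8 7 \<le> 481813/1000000"
    "603022/1000000 \<le> abc_f 11 3" "abc_f 11 4 \<le> 543558/1000000"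
    by (rule abc_f_ge abc_f_le; simp add: power2_eq_square)+
  note r = sqrt_half_bounds
  note d = gain_def upgrade_gain_def
  show "gain d 1 + 12976/100000 < upgrade_gain 3" if "3 \<le> d" for d
  proof -
    have "81649/100000 \<le> abc_f (real d) (real 1)"
      by (rule abc_f_ge) (use that in \<open>auto simp: power2_eq_square\<close>)
    then show ?thesis unfolding d using f(1,3) r by simp
  qed
  show "12 * gain 4 3 < 5 * gain 8 4"
    using f(4,5) r by (simp add: d)
  show "gain 3 3 < upgrade_gain 5"
    using f(1,6,8) r by (simp add: d)
  show "gain 5 5 + 4 * gain 5 3 < 3 * gain 7 4 + (gain 7 5 - gain 5 5)"
    using f(6,9,11,12) r by (simp add: d)
  show "gain 6 6 + 5 * gain 6 3 < 4 * gain 8 4 + (gain 8 6 - gain 6 6)"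
    using f(5,13,15,17) r by (simp add: d)
  show "5 * (gain 7 3 - gain 6 3) + (gain 7 7 - gain 7 6) < upgrade_gain 7"
    using f(11,16,18,20,21) r by (simp add: d)
  show "6 * (gain 8 3 - gain 7 3) + (gain 8 8 - gain 8 7) < upgrade_gain 8"
    using f(5,19,22,23,24) r by (simp add: d)
  show "gain D (t + 1) - gain D t < upgrade_gain D" if t: "4 \<le> t" and D: "11 \<le> D" for t D
  proof -
    have "gain D (t + 1) - gain D t \<le> sqrt (real (t + 1)) / (2 * (real (t + 1) * real t))"
      using gain_drop[of D 1 "t + 1"] D t by (simp add: gain_commute[of D])
    also have "\<dots> = 1 / (sqrt (real (t + 1)) * (2 * real t))"
    proof -
      have "sqrt a / (2 * (a * b)) = 1 / (sqrt a * (2 * b))" if "a > 0" for a b :: real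
      proof -
        have "r / (r * r * c) = 1 / (r * c)" if "r \<noteq> 0" for r c :: real
          using that by simp
        from this[of "sqrt a" "2 * b"] show ?thesis using that by (simp add: ac_simps)
      qed
      then show ?thesis by simp
    qed
    also have "\<dots> \<le> 1 / (2236/1000 * (2 * 4))"
    proof (intro divide_left_mono mult_mono)
      show "2236/1000 \<le> sqrt (real (t + 1))"
        by (rule real_le_rsqrt) (use t in \<open>simp add: power2_eq_square\<close>)
    qed (use t in auto)
    also have "\<dots> < upgrade_gain 11" using f(25,26) by (simp add: d)
    also have "\<dots> \<le> upgrade_gain D" using D by (intro upgrade_gain_mono) auto
    finally show ?thesis .
  qed
qed

section \<open>Trees as nested multisets\<close>

text \<open>
  A multiset of trees is also read as the unrooted tree whose root has these branches.
\<close>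

datatype mtree = N (kids: "mtree multiset")

primrec nv :: "mtree \<Rightarrow> nat" where
  "nv (N ts) = Suc (\<Sum>t\<in>#ts. nv t)"

text \<open>
  The gain of all edges of a branch, including the one to its parent, which has degree d.
\<close>

primrec br :: "mtree \<Rightarrow> nat \<Rightarrow> real" where
  "br (N ts) = (\<lambda>d. gain d (size ts + 1) + (\<Sum>t\<in>#ts. br t (size ts + 1)))"

text \<open>The added one is the edge to the parent, so this is not the degree of the root of a
  whole tree.\<close>

definition dg :: "mtree \<Rightarrow> nat" where "dg t = size (kids t) + 1"

definition Lf :: mtree where "Lf = N {#}"
definition P2 :: mtree where "P2 = N {#Lf#}"
definition B2 :: mtree where "B2 = N {#P2, P2#}"
definition B3 :: mtree where "B3 = N {#P2, P2, P2#}"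

text \<open>
  The degrees of the parents of all \<open>B\<^sub>2\<close>-branches.
\<close>

primrec pd :: "mtree \<Rightarrow> nat \<Rightarrow> nat multiset" where
  "pd (N ts) = (\<lambda>d. (if N ts = B2 then {#d#} else {#}) + (\<Sum>t\<in>#ts. pd t (size ts + 1)))"

definition nvF :: "mtree multiset \<Rightarrow> nat" where "nvF ts = (\<Sum>t\<in>#ts. nv t)"
definition brF :: "nat \<Rightarrow> mtree multiset \<Rightarrow> real" where "brF d ts = (\<Sum>t\<in>#ts. br t d)"
definition pdF :: "nat \<Rightarrow> mtree multiset \<Rightarrow> nat multiset" where "pdF d ts = (\<Sum>t\<in>#ts. pd t d)"

lemma F_simps [simp]:
  "nvF {#} = 0" "nvF (add_mset t ts) = nv t + nvF ts" "nvF (ts + us) = nvF ts + nvF us"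
  "brF d {#} = 0" "brF d (add_mset t ts) = br t d + brF d ts" "brF d (ts + us) = brF d ts + brF d us"
  "pdF d {#} = {#}" "pdF d (add_mset t ts) = pd t d + pdF d ts" "pdF d (ts + us) = pdF d ts + pdF d us"
  by (simp_all add: nvF_def brF_def pdF_def)

lemma F_replicate [simp]:
  "nvF (replicate_mset n t) = n * nv t" "brF d (replicate_mset n t) = n * br t d"
  "size (pdF d (replicate_mset n t)) = n * size (pd t d)"
  by (induction n) (auto simp: algebra_simps)

lemma nv_N: "nv (N ts) = Suc (nvF ts)" and br_N: "br (N ts) d = gain d (size ts + 1) + brF (size ts + 1) ts"
  and pd_N: "pd (N ts) d = (if N ts = B2 then {#d#} else {#}) + pdF (size ts + 1) ts"
  and dg_N [simp]: "dg (N ts) = size ts + 1"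
  by (simp_all add: nvF_def brF_def pdF_def dg_def)

declare nv.simps [simp del] br.simps [simp del] pd.simps [simp del]

lemma nv_pos: "nv t > 0" by (cases t) (simp add: nv_N)

lemma dg_special [simp]: "dg Lf = 1" "dg P2 = 2" "dg B2 = 3" "dg B3 = 4"
  by (simp_all add: Lf_def P2_def B2_def B3_def)

lemma special_neq [simp]:
  "Lf \<noteq> P2" "Lf \<noteq> B2" "P2 \<noteq> B2" "B3 \<noteq> B2" "P2 \<noteq> Lf" "B2 \<noteq> Lf" "B2 \<noteq> P2" "B2 \<noteq> B3" "B3 \<noteq> Lf" "B3 \<noteq> P2"
  by (auto simp: Lf_def P2_def B2_def B3_def)

lemma nv_special [simp]: "nv Lf = 1" "nv P2 = 2" "nv B2 = 5" "nv B3 = 7"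
  by (simp_all add: nv_N Lf_def P2_def B2_def B3_def)

lemma br_special [simp]:
  assumes "d > 0"
  shows "br P2 d = 0" "br B2 d = gain d 3" "br B3 d = gain d 4"
proof -
  have P: "br P2 d = 0" if "d > 0" for d
    using that gain_2(1)[of d] gain_2(2)[of 1]
    by (simp add: P2_def br_N Lf_def numeral_2_eq_2 del: gain_2)
  show "br P2 d = 0" "br B2 d = gain d 3" "br B3 d = gain d 4"
    using assms P by (simp_all add: B2_def B3_def br_N eval_nat_numeral)
qed

lemma br_Lf [simp]: "br Lf d = gain d 1" by (simp add: Lf_def br_N)

lemma pd_special [simp]: "pd Lf d = {#}" "pd P2 d = {#}" "pd B2 d = {#d#}" "pd B3 d = {#}"
proof -
  have L: "pd Lf d = {#}" for d by (simp add: Lf_def pd_N B2_def)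
  then have P: "pd P2 d = {#}" for d
    using special_neq(3) by (simp add: P2_def pd_N)
  show "pd Lf d = {#}" "pd P2 d = {#}" "pd B2 d = {#d#}" by (simp_all add: L P B2_def pd_N)
  show "pd B3 d = {#}" using P special_neq(4) by (simp add: B3_def pd_N)
qed

lemma dg_1D: "dg t = 1 \<Longrightarrow> t = Lf" by (cases t) (simp add: Lf_def)

lemma br_diff: "br t d' - br t d = gain d' (dg t) - gain d (dg t)"
  by (cases t) (simp add: br_N)

lemma pd_cong: "t \<noteq> B2 \<Longrightarrow> pd t d = pd t d'"
  by (cases t) (simp add: pd_N)

lemma size_pd: "size (pd t d) = size (pd t d')"
  by (cases "t = B2") (simp_all add: pd_cong[of t d d'])

lemma size_pdF: "size (pdF d ts) = size (pdF d' ts)"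
  by (induction ts) (simp_all add: size_pd[of _ d d'])

text \<open>Leaves are excluded because the gain of a pendant edge decreases in the degree of its
  other end.\<close>

lemma br_mono: "1 \<le> d \<Longrightarrow> d \<le> d' \<Longrightarrow> t \<noteq> Lf \<Longrightarrow> br t d \<le> br t d'"
proof -
  assume "1 \<le> d" "d \<le> d'" "t \<noteq> Lf"
  then have "dg t \<noteq> 1" using dg_1D by blast
  then have "2 \<le> dg t" by (simp add: dg_def Suc_le_eq nonempty_has_size)
  then show ?thesis using br_diff[of t d' d] gain_mono[of d d' "dg t"] \<open>1 \<le> d\<close> \<open>d \<le> d'\<close> by simp
qed

lemma brF_mono: "1 \<le> d \<Longrightarrow> d \<le> d' \<Longrightarrow> Lf \<notin># ts \<Longrightarrow> brF d ts \<le> brF d' ts"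
  by (induction ts) (auto intro!: add_mono br_mono)

section \<open>Contexts and local replacements\<close>

text \<open>
  A context lists, from the top down, the siblings of the vertices on the way to the hole; \<open>hdeg\<close> is the degree
  of the parent of the hole.
\<close>

fun plug :: "mtree multiset list \<Rightarrow> mtree \<Rightarrow> mtree" where
  "plug [] s = s"
| "plug (ts # C) s = N (add_mset (plug C s) ts)"

fun hdeg :: "nat \<Rightarrow> mtree multiset list \<Rightarrow> nat" where
  "hdeg d [] = d"
| "hdeg d (ts # C) = hdeg (size ts + 2) C"

fun cpd :: "mtree multiset list \<Rightarrow> nat multiset" where
  "cpd [] = {#}"
| "cpd (ts # C) = pdF (size ts + 2) ts + cpd C"

lemma plug_append [simp]: "plug (C @ C') s = plug C (plug C' s)"
  by (induction C) auto

lemma hdeg_append_single [simp]: "hdeg d (C @ [ts]) = size ts + 2"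
  by (induction C arbitrary: d) auto

lemma hdeg_append: "hdeg d (C @ C') = hdeg (hdeg d C) C'"
  by (induction C arbitrary: d) auto

lemma hdeg_ne: "C \<noteq> [] \<Longrightarrow> hdeg d C \<ge> 2"
  by (induction C rule: rev_induct) auto

lemma hdeg_pos: "d > 0 \<Longrightarrow> hdeg d C > 0"
  by (cases "C = []") (use hdeg_ne[of C d] in auto)

lemma nv_plug: "nv (plug C s') + nv s = nv (plug C s) + nv s'"
  by (induction C) (auto simp: nv_N)

lemma br_plug: "br (plug C s') d = br (plug C s) d - br s (hdeg d C) + br s' (hdeg d C)"
  by (induction C arbitrary: d) (auto simp: br_N)

lemma dg_plug: "C \<noteq> [] \<Longrightarrow> dg (plug C s') = dg (plug C s)"
  by (cases C) auto

lemma plug_eq_P2D: "plug C s = P2 \<Longrightarrow> s = P2 \<or> s = Lf"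
  by (cases C) (auto simp: P2_def Lf_def add_mset_eq_single split: if_splits elim: plug.elims)

lemma plug_eq_LfD: "plug C s = Lf \<Longrightarrow> C = [] \<and> s = Lf"
  by (cases C) (auto simp: Lf_def)

lemma plug_eq_B2D: "plug C s = B2 \<Longrightarrow> s = B2 \<or> s = P2 \<or> s = Lf"
proof (cases C)
  case (Cons ts C')
  assume "plug C s = B2"
  with Cons have "plug C' s \<in># {#P2, P2#}" by (metis B2_def mtree.sel plug.simps(2) union_single_eq_member)
  then have "plug C' s = P2" by simp
  then show ?thesis using plug_eq_P2D by blast
qed auto

text \<open>Only an inclusion, because filling the hole can turn a vertex on the way to it into the
  root of a \<open>B2\<close>-branch.\<close>

lemma pd_plug_ge: "cpd C + pd s (hdeg d C) \<subseteq># pd (plug C s) d"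
proof (induction C arbitrary: d)
  case (Cons ts C)
  have "cpd C + pd s (hdeg (size ts + 2) C) \<subseteq># pd (plug C s) (size ts + 2)"
    by (rule Cons.IH)
  then have "cpd (ts # C) + pd s (hdeg d (ts # C)) \<subseteq># pd (plug C s) (size ts + 2) + pdF (size ts + 2) ts"
    by (simp add: union_commute subset_mset.add_mono)
  also have "\<dots> \<subseteq># pd (plug (ts # C) s) d"
    by (simp add: pd_N)
  finally show ?case .
qed simp

text \<open>If a vertex on the way to the hole is a \<open>B2\<close>, the hole holds one of its two
  paths, with a parent of degree 3, or the leaf of one, with a parent of degree 2. The assumption
  rules out both.\<close>

lemma pd_plug:
  assumes "4 \<le> hdeg d C \<or> (s \<noteq> P2 \<and> s \<noteq> Lf)"
  shows "pd (plug C s) d = cpd C + pd s (hdeg d C)"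
  using assms
proof (induction C arbitrary: d)
  case (Cons ts C)
  have "plug (ts # C) s \<noteq> B2"
  proof
    assume B: "plug (ts # C) s = B2"
    show False
    proof (cases C)
      case Nil
      have "size ts + 1 = 2" using arg_cong[OF B, of "\<lambda>t. size (kids t)"] by (simp add: B2_def Nil)
      have "s \<in># {#P2, P2#}" using B Nil by (metis B2_def mtree.sel plug.simps union_single_eq_member)
      then have "s = P2" by simp
      then show False using Cons.prems \<open>size ts + 1 = 2\<close> Nil by auto
    next
      case (Cons cs C')
      have "plug C s \<in># {#P2, P2#}" using B by (metis B2_def mtree.sel plug.simps(2) union_single_eq_member)
      then have P: "plug C s = P2" by simp
      then have "s = P2 \<or> s = Lf" by (rule plug_eq_P2D)
      moreover have "cs = {#} \<and> plug C' s = Lf"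
        using P by (auto simp: Cons P2_def add_mset_eq_single)
      then have "C' = []" "cs = {#}" using plug_eq_LfD by auto
      then have "hdeg d (ts # C) = 2" by (simp add: Cons)
      ultimately show False using Cons.prems by auto
    qed
  qed
  with Cons show ?case by (simp add: pd_N)
qed simp

lemma pd_location: "e \<in># pd t d \<Longrightarrow> \<exists>C. t = plug C B2 \<and> hdeg d C = e"
proof (induction t arbitrary: d)
  case (N ts)
  show ?case
  proof (cases "N ts = B2")
    case True
    then have "e = d" using N.prems by simp
    then show ?thesis using True by (intro exI[of _ "[]"]) auto
  next
    case False
    then obtain t where t: "t \<in># ts" "e \<in># pd t (size ts + 1)"
      using N.prems by (auto simp: pd_N pdF_def)
    from N.IH[OF this] obtain C where C: "t = plug C B2" "hdeg (size ts + 1) C = e" by auto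
    obtain rest where "ts = add_mset t rest" using t(1) by (metis insert_DiffM)
    then show ?thesis using C by (intro exI[of _ "rest # C"]) simp
  qed
qed

lemma pdF_location:
  assumes "e \<in># pdF d ts"
  obtains C rest where "ts = add_mset (plug C B2) rest" "hdeg d C = e"
proof -
  obtain t where t: "t \<in># ts" "e \<in># pd t d" using assms by (auto simp: pdF_def)
  from pd_location[OF t(2)] obtain C where C: "t = plug C B2" "hdeg d C = e" by auto
  obtain rest where "ts = add_mset t rest" using t(1) by (metis insert_DiffM)
  then show ?thesis using C that by simp
qed

lemma upgradeF:
  assumes "e \<in># pdF d ts" "d > 0"
  obtains ts' where "size ts' = size ts" "nvF ts' = nvF ts + 2" "brF d ts' = brF d ts + upgrade_gain e"
    "pdF d ts' = pdF d ts - {#e#}" "Lf \<notin># ts \<longrightarrow> Lf \<notin># ts'"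
proof -
  obtain C rest where C: "ts = add_mset (plug C B2) rest" "hdeg d C = e"
    using pdF_location[OF assms(1)] by metis
  have e: "e > 0" using C hdeg_pos[OF assms(2)] by auto
  show ?thesis
  proof (rule that[of "add_mset (plug C B3) rest"])
    show "nvF (add_mset (plug C B3) rest) = nvF ts + 2" using nv_plug[of C B3 B2] C by simp
    show "brF d (add_mset (plug C B3) rest) = brF d ts + upgrade_gain e"
      using br_plug[of C B3 d B2] C e by (simp add: upgrade_gain_def)
    show "pdF d (add_mset (plug C B3) rest) = pdF d ts - {#e#}"
      using C by (simp add: pd_plug)
    show "Lf \<notin># ts \<longrightarrow> Lf \<notin># add_mset (plug C B3) rest"
      using C plug_eq_LfD[of C B3] by auto
  qed (simp add: C)
qed

text \<open>Only an inclusion for the parents: a vertex that is left with exactly two paths may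
  become a new \<open>B2\<close>.\<close>

lemma downgradeF:
  assumes "e \<in># pdF d ts" "d > 0"
  obtains ts' where "size ts' = size ts" "nvF ts' + 3 = nvF ts" "brF d ts' = brF d ts - gain e 3"
    "pdF d ts - {#e#} \<subseteq># pdF d ts'" "Lf \<notin># ts \<longrightarrow> Lf \<notin># ts'"
proof -
  obtain C rest where C: "ts = add_mset (plug C B2) rest" "hdeg d C = e"
    using pdF_location[OF assms(1)] by metis
  have e: "e > 0" using C hdeg_pos[OF assms(2)] by auto
  show ?thesis
  proof (rule that[of "add_mset (plug C P2) rest"])
    show "nvF (add_mset (plug C P2) rest) + 3 = nvF ts" using nv_plug[of C P2 B2] C by simp
    show "brF d (add_mset (plug C P2) rest) = brF d ts - gain e 3"
      using br_plug[of C P2 d B2] C e by simp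
    show "pdF d ts - {#e#} \<subseteq># pdF d (add_mset (plug C P2) rest)"
      using C pd_plug_ge[of C P2 d] by (simp add: pd_plug)
    show "Lf \<notin># ts \<longrightarrow> Lf \<notin># add_mset (plug C P2) rest"
      using C plug_eq_LfD[of C P2] by auto
  qed (simp add: C)
qed

lemma upgradesF:
  assumes "M \<subseteq># pdF d ts" "d > 0" "\<forall>e\<in>#M. x \<le> e" "1 \<le> x"
  shows "\<exists>ts'. size ts' = size ts \<and> nvF ts' = nvF ts + 2 * size M
    \<and> brF d ts + size M * upgrade_gain x \<le> brF d ts' \<and> (Lf \<notin># ts \<longrightarrow> Lf \<notin># ts')"
  using assms(1,3)
proof (induction M arbitrary: ts)
  case empty
  then show ?case by (intro exI[of _ ts]) simp
next
  case (add e M)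
  have "e \<in># pdF d ts" using add.prems(1) by (simp add: insert_subset_eq_iff)
  then obtain us where us: "size us = size ts" "nvF us = nvF ts + 2" "brF d us = brF d ts + upgrade_gain e"
    "pdF d us = pdF d ts - {#e#}" "Lf \<notin># ts \<longrightarrow> Lf \<notin># us" using upgradeF assms(2) by metis
  have "M \<subseteq># pdF d us" using add.prems(1) us(4) by (simp add: insert_subset_eq_iff)
  then obtain ts' where ts': "size ts' = size us" "nvF ts' = nvF us + 2 * size M"
    "brF d us + size M * upgrade_gain x \<le> brF d ts'" "Lf \<notin># us \<longrightarrow> Lf \<notin># ts'"
    using add.IH[of us] add.prems by auto
  have "upgrade_gain x \<le> upgrade_gain e" using add.prems assms(4) by (intro upgrade_gain_mono) auto
  then show ?case using us ts' by (intro exI[of _ ts']) (auto simp: algebra_simps)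
qed

lemma downgradesF:
  assumes "M \<subseteq># pdF d ts" "d > 0" "\<forall>e\<in>#M. 1 \<le> e \<and> e \<le> y"
  shows "\<exists>ts'. size ts' = size ts \<and> nvF ts' + 3 * size M = nvF ts
    \<and> brF d ts - size M * gain y 3 \<le> brF d ts' \<and> (Lf \<notin># ts \<longrightarrow> Lf \<notin># ts')"
  using assms(1,3)
proof (induction M arbitrary: ts)
  case empty
  then show ?case by (intro exI[of _ ts]) simp
next
  case (add e M)
  have "e \<in># pdF d ts" using add.prems(1) by (simp add: insert_subset_eq_iff)
  then obtain us where us: "size us = size ts" "nvF us + 3 = nvF ts" "brF d us = brF d ts - gain e 3"
    "pdF d ts - {#e#} \<subseteq># pdF d us" "Lf \<notin># ts \<longrightarrow> Lf \<notin># us" using downgradeF assms(2) by metis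
  have "M \<subseteq># pdF d us" using add.prems(1) us(4) by (metis insert_subset_eq_iff subset_mset.order_trans)
  then obtain ts' where ts': "size ts' = size us" "nvF ts' + 3 * size M = nvF us"
    "brF d us - size M * gain y 3 \<le> brF d ts'" "Lf \<notin># us \<longrightarrow> Lf \<notin># ts'"
    using add.IH[of us] add.prems by auto
  have "gain e 3 \<le> gain y 3" using add.prems by (intro gain_mono) auto
  then show ?case using us ts' by (intro exI[of _ ts']) (auto simp: algebra_simps)
qed

lemma pdF_pos: "e \<in># pdF d ts \<Longrightarrow> d > 0 \<Longrightarrow> e > 0"
  using pdF_location hdeg_pos by metis

lemma pd_plug_Lf: "3 \<le> hdeg d C \<Longrightarrow> pd (plug C Lf) d = cpd C"
proof (induction C arbitrary: d)
  case (Cons ts C)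
  have "plug (ts # C) Lf \<noteq> B2"
  proof
    assume "plug (ts # C) Lf = B2"
    then have "plug C Lf \<in># {#P2, P2#}" by (metis B2_def mtree.sel plug.simps(2) union_single_eq_member)
    then have P: "plug C Lf = P2" by simp
    show False
    proof (cases C)
      case (Cons cs C')
      have "cs = {#} \<and> plug C' Lf = Lf" using P by (auto simp: Cons P2_def add_mset_eq_single)
      then have "cs = {#}" "C' = []" using plug_eq_LfD[of C' Lf] by auto
      then have "hdeg d (ts # C) = 2" by (simp add: Cons)
      then show False using Cons.prems by simp
    qed (use P in simp)
  qed
  with Cons show ?case by (simp add: pd_N)
qed simp

text \<open>By supermodularity a child of larger degree profits more when the degree of its parent
  grows, so degree \<open>e\<close> is the worst case.\<close>

lemma brF_increase:
  assumes "\<forall>a\<in>#ts. e \<le> dg a" "1 \<le> d" "d \<le> d'" "1 \<le> e"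
  shows "brF d ts + size ts * (gain d' e - gain d e) \<le> brF d' ts"
  using assms(1)
proof (induction ts)
  case (add a ts)
  have "gain d (dg a) + gain d' e \<le> gain d e + gain d' (dg a)"
    using add.prems assms by (intro gain_supermodular) auto
  then have "br a d + (gain d' e - gain d e) \<le> br a d'" using br_diff[of a d' d] by simp
  with add show ?case by (simp add: algebra_simps)
qed simp

lemma filter_pdF_mono:
  assumes "d \<le> d'"
  shows "size (filter_mset (\<lambda>e. x \<le> e) (pdF d ts)) \<le> size (filter_mset (\<lambda>e. x \<le> e) (pdF d' ts))"
proof (induction ts)
  case (add t ts)
  have "size (filter_mset (\<lambda>e. x \<le> e) (pd t d)) \<le> size (filter_mset (\<lambda>e. x \<le> e) (pd t d'))"
    using assms by (cases "t = B2") (auto simp: pd_cong[of t d d'])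
  with add show ?case by simp
qed simp

lemma obtain_submultiset:
  assumes "n \<le> size A" obtains M where "M \<subseteq># A" "size M = n"
proof -
  obtain xs where xs: "A = mset xs" by (metis ex_mset)
  have "mset (take n xs) \<subseteq># mset xs"
    by (metis append_take_drop_id mset_append mset_subset_eq_add_left)
  then show ?thesis using that[of "mset (take n xs)"] assms xs by auto
qed

lemma two_valued_mset:
  assumes "\<forall>a\<in>#M. a = x \<or> a = y" "x \<noteq> y"
  shows "M = replicate_mset (count M x) x + replicate_mset (count M y) y"
  using assms by (intro multiset_eqI) (auto simp: count_eq_zero_iff)

text \<open>Both multisets are the same unrooted tree, with the root moved across one edge.\<close>

lemma reroot:
  "nvF (add_mset (N us) ts) = nvF (add_mset (N ts) us)"
  "brF (size (add_mset (N us) ts)) (add_mset (N us) ts) = brF (size (add_mset (N ts) us)) (add_mset (N ts) us)"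
  by (simp_all add: nv_N br_N gain_commute)

text \<open>Moving the root into a branch can destroy only that branch as a \<open>B2\<close>, and
  the former root is the only vertex that can become a new one.\<close>

lemma reroot_pdF:
  assumes "N us \<noteq> B2"
  shows "pdF (size (add_mset (N us) ts)) (add_mset (N us) ts)
      \<subseteq># pdF (size (add_mset (N ts) us)) (add_mset (N ts) us)"
    "N ts \<noteq> B2 \<Longrightarrow> pdF (size (add_mset (N us) ts)) (add_mset (N us) ts)
      = pdF (size (add_mset (N ts) us)) (add_mset (N ts) us)"
  using assms by (auto simp: pd_N)

lemma N_B2_special: "N (add_mset B2 cs) \<notin> {Lf, P2, B2}"
proof -
  have "N (add_mset B2 cs) \<noteq> B2"
  proof
    assume "N (add_mset B2 cs) = B2"
    then have "B2 \<in># {#P2, P2#}" by (metis B2_def mtree.sel union_single_eq_member)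
    then show False by simp
  qed
  then show ?thesis by (auto simp: P2_def Lf_def add_mset_eq_single B2_def)
qed

lemma dg_pos: "1 \<le> dg t" by (simp add: dg_def)

lemma size_le_nvF: "size ts \<le> nvF ts"
proof (induction ts)
  case (add t ts)
  then show ?case using nv_pos[of t] by simp
qed simp

lemma filter_mset_all: "(\<forall>x\<in>#M. Q x) \<Longrightarrow> filter_mset Q M = M"
  by (induction M) auto

lemma br_mixed:
  assumes "us = replicate_mset k B2 + replicate_mset t P2"
  shows "br (N us) d = gain d (k + t + 1) + k * gain (k + t + 1) 3"
    "nv (N us) = 5 * k + 2 * t + 1"
    "N us \<noteq> B2 \<Longrightarrow> pd (N us) d = replicate_mset k (k + t + 1)"
proof -
  show "br (N us) d = gain d (k + t + 1) + k * gain (k + t + 1) 3"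
    by (simp add: br_N assms)
  show "nv (N us) = 5 * k + 2 * t + 1" by (simp add: nv_N assms)
  have "pdF e (replicate_mset n B2) = replicate_mset n e" "pdF e (replicate_mset n P2) = {#}" for n e
    by (induction n) auto
  then show "pd (N us) d = replicate_mset k (k + t + 1)" if "N us \<noteq> B2"
    using that by (simp add: pd_N assms)
qed

text \<open>Descend to a child of degree at least \<open>D\<close> as long as there is one.\<close>

lemma top_leaf_exists:
  "D \<le> dg t \<Longrightarrow> \<exists>C y. t = plug C y \<and> D \<le> dg y \<and> (\<forall>a\<in>#kids y. dg a < D)"
proof (induction t)
  case (N ts)
  show ?case
  proof (cases "\<forall>a\<in>#ts. dg a < D")
    case True
    then show ?thesis using N.prems by (intro exI[of _ "[]"] exI[of _ "N ts"]) auto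
  next
    case False
    then obtain a where a: "a \<in># ts" "D \<le> dg a" by (auto simp: not_less)
    obtain C y where "a = plug C y" "D \<le> dg y" "\<forall>a\<in>#kids y. dg a < D" using N.IH[OF a] by auto
    moreover obtain r where "ts = add_mset a r" using a(1) by (metis insert_DiffM)
    ultimately show ?thesis by (intro exI[of _ "r # C"] exI[of _ y]) auto
  qed
qed

section \<open>Extremal trees\<close>

text \<open>
  The second assumption excludes useless vertices, which could be removed without loss of gain.
\<close>

locale extremal =
  fixes m :: nat and opt :: real
  assumes best: "\<And>ts. Suc (nvF ts) \<le> m \<Longrightarrow> brF (size ts) ts \<le> opt"
    and lean: "\<And>ts. Suc (nvF ts) < m \<Longrightarrow> 12 \<le> size (pdF (size ts) ts) \<Longrightarrow> brF (size ts) ts < opt"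
begin

section \<open>Optimal trees and first reductions\<close>

abbreviation par :: "mtree multiset \<Rightarrow> nat multiset" where "par ts \<equiv> pdF (size ts) ts"

text \<open>The counterexamples to be refuted. The successor counts the root.\<close>

definition optimal :: "mtree multiset \<Rightarrow> bool" where
  "optimal ts \<longleftrightarrow> Suc (nvF ts) = m \<and> brF (size ts) ts = opt \<and> 12 \<le> size (par ts)"

lemma no_improvement:
  "optimal ts \<Longrightarrow> nvF ts' \<le> nvF ts \<Longrightarrow> brF (size ts) ts < brF (size ts') ts' \<Longrightarrow> False"
  using best[of ts'] by (auto simp: optimal_def)

lemma optimal_equal:
  "optimal ts \<Longrightarrow> nvF ts' = nvF ts \<Longrightarrow> brF (size ts') ts' = brF (size ts) ts \<Longrightarrow> size (par ts) \<le> size (par ts') \<Longrightarrow> optimal ts'"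
  by (auto simp: optimal_def)

lemma optimal_reroot:
  assumes "optimal (add_mset (N us) ts)" "N us \<noteq> B2"
  shows "optimal (add_mset (N ts) us)"
  using optimal_equal[OF assms(1) reroot(1)[symmetric] reroot(2)[symmetric]] reroot_pdF(1)[OF assms(2)] size_mset_mono by blast

text \<open>The root walks down the context edge by edge; \<open>rem\<close> is what used to lie
  above the new root. The excluded shapes of \<open>N us\<close> keep every vertex on the way from
  being a \<open>B2\<close>, those of \<open>N ts\<close> do the same for the vertices turned upside
  down.\<close>

lemma optimal_reroot_context:
  assumes "optimal (add_mset (plug C (N us)) ts)" "N us \<notin> {Lf, P2, B2}"
  shows "\<exists>rem. optimal (add_mset (N rem) us) \<and> (N ts \<notin> {Lf, P2, B2} \<longrightarrow>
    par (add_mset (N rem) us) = par (add_mset (plug C (N us)) ts))"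
  using assms
proof (induction C arbitrary: ts)
  case Nil
  then show ?case using optimal_reroot[of us ts] reroot_pdF(2)[of us ts] by auto
next
  case (Cons cs C)
  let ?ks = "add_mset (plug C (N us)) cs"
  have nb: "N ?ks \<noteq> B2" using plug_eq_B2D[of "cs # C" "N us"] Cons.prems by auto
  have optimal': "optimal (add_mset (N ts) ?ks)" using optimal_reroot[of ?ks ts] nb Cons.prems by simp
  have comm: "add_mset (N ts) ?ks = add_mset (plug C (N us)) (add_mset (N ts) cs)" by (rule add_mset_commute)
  from Cons.IH[of "add_mset (N ts) cs"] optimal' Cons.prems comm obtain rem where
    rem: "optimal (add_mset (N rem) us)" "N (add_mset (N ts) cs) \<notin> {Lf, P2, B2} \<longrightarrow>
    par (add_mset (N rem) us) = par (add_mset (plug C (N us)) (add_mset (N ts) cs))" by auto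
  have "par (add_mset (N rem) us) = par (add_mset (plug (cs # C) (N us)) ts)" if "N ts \<notin> {Lf, P2, B2}"
  proof -
    have "N (add_mset (N ts) cs) \<noteq> B2"
    proof
      assume "N (add_mset (N ts) cs) = B2"
      then have "N ts \<in># {#P2, P2#}" by (metis B2_def mtree.sel union_single_eq_member)
      with that show False by simp
    qed
    moreover have "N (add_mset (N ts) cs) \<noteq> P2" "N (add_mset (N ts) cs) \<noteq> Lf"
      using that by (auto simp: P2_def Lf_def add_mset_eq_single)
    ultimately have "par (add_mset (N rem) us) = par (add_mset (N ts) ?ks)"
      using rem(2) comm by auto
    also have "\<dots> = par (add_mset (N ?ks) ts)"
      using reroot_pdF(2)[OF nb, of ts] that by auto
    finally show ?thesis by simp
  qed
  then show ?case using rem(1) by blast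
qed

text \<open>Contracting a vertex of degree two saves a vertex. Its edges had gain zero and the new
  edge has a nonnegative gain, so nothing is lost, against \<open>lean\<close>.\<close>

lemma no_thin:
  assumes optimal: "optimal (add_mset (plug C (N {#N us#})) ts)" and us: "us \<noteq> {#}" and h: "2 \<le> hdeg (size ts + 1) C"
  shows False
proof -
  let ?d = "size ts + 1" let ?e = "hdeg ?d C"
  let ?old = "add_mset (plug C (N {#N us#})) ts" and ?new = "add_mset (plug C (N us)) ts"
  have nv: "nvF ?old = Suc (nvF ?new)"
    using nv_plug[of C "N us" "N {#N us#}"] by (simp add: nv_N)
  have "br (N us) ?e = br (N {#N us#}) ?e + gain ?e (size us + 1)"
    using h gain_2(1)[of ?e] gain_2(2)[of "size us + 1"] by (simp add: br_N numeral_2_eq_2 del: gain_2)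
  moreover have "0 \<le> gain ?e (size us + 1)"
    using h us by (intro gain_nonneg) (auto simp: Suc_le_eq nonempty_has_size)
  ultimately have br: "brF (size ?old) ?old \<le> brF (size ?new) ?new"
    using br_plug[of C "N us" ?d "N {#N us#}"] by simp
  have ne: "N {#N us#} \<noteq> B2" "N {#N us#} \<noteq> P2" "N {#N us#} \<noteq> Lf"
    using us by (auto simp: B2_def P2_def Lf_def)
  have "size (pd (plug C (N {#N us#})) ?d) = size (cpd C) + size (pd (N us) ?e)"
    using pd_plug[of ?d C "N {#N us#}"] ne size_pd[of "N us" ?e "Suc (Suc 0)"] by (simp add: pd_N[of "{#N us#}"])
  also have "\<dots> \<le> size (pd (plug C (N us)) ?d)"
    using size_mset_mono[OF pd_plug_ge[of C "N us" ?d]] by simp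
  finally have "size (par ?old) \<le> size (par ?new)" by simp
  then show False
    using lean[of ?new] optimal nv br by (auto simp: optimal_def)
qed

text \<open>Every parent of a \<open>B2\<close>-branch can serve as the root.\<close>

lemma optimal_B2_root:
  assumes optimal: "optimal ts" and e: "e \<in># par ts"
  obtains us where "optimal (add_mset B2 us)" "size us + 1 = e"
proof -
  obtain C rest where C: "ts = add_mset (plug C B2) rest" "hdeg (size ts) C = e"
    using pdF_location[OF e] by metis
  show thesis
  proof (cases C rule: rev_cases)
    case Nil
    then show ?thesis using that[of rest] optimal C by simp
  next
    case (snoc C0 cs)
    have "optimal (add_mset (plug C0 (N (add_mset B2 cs))) rest)" using optimal C snoc by simp
    from optimal_reroot_context[OF this N_B2_special] obtain rem where
      "optimal (add_mset (N rem) (add_mset B2 cs))" by auto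
    then show ?thesis using that[of "add_mset (N rem) cs"] C snoc by (simp add: add_mset_commute)
  qed
qed

text \<open>A root of degree two would be contracted by \<open>no_thin\<close> once the root has
  moved to its other neighbour.\<close>

lemma optimal_B2_size:
  assumes optimal: "optimal (add_mset B2 us)"
  shows "2 \<le> size us"
proof (rule ccontr)
  assume "\<not> 2 \<le> size us"
  moreover have "us \<noteq> {#}" using optimal by (auto simp: optimal_def)
  ultimately have "size us = 1" using nonempty_has_size[of us] by linarith
  then obtain v where "us = {#v#}" using size_1_singleton_mset by metis
  moreover obtain vs where "v = N vs" by (cases v)
  ultimately have us: "us = {#N vs#}" by simp
  have "N vs \<noteq> B2" using optimal us by (auto simp: optimal_def)
  moreover have "optimal (add_mset (N vs) {#B2#})" using optimal us by (simp add: add_mset_commute)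
  ultimately have optimal': "optimal (add_mset (N {#B2#}) vs)" by (rule optimal_reroot[rotated])
  have "vs \<noteq> {#}" using optimal us by (auto simp: optimal_def simp flip: Lf_def)
  then have "2 \<le> hdeg (size vs + 1) []" by (simp add: Suc_le_eq nonempty_has_size)
  from no_thin[of "[]" "{#P2, P2#}" vs, OF _ _ this] optimal' show False by (simp add: B2_def)
qed

lemma par_ge_3:
  assumes "optimal ts" "e \<in># par ts" shows "3 \<le> e"
  using assms optimal_B2_root optimal_B2_size by (metis Suc_eq_plus1 Suc_le_mono numeral_3_eq_3 numeral_2_eq_2)

text \<open>
  The leaf grows to a path, one \<open>B\<^sub>2\<close>-branch is upgraded, and another one shrinks to a path, which pays
  for the three vertices.
\<close>

lemma no_leaf:
  assumes optimal: "optimal (add_mset (plug C Lf) ts)" and h: "3 \<le> hdeg (size ts + 1) C"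
  shows False
proof -
  let ?d = "size ts + 1" let ?e = "hdeg ?d C"
  let ?old = "add_mset (plug C Lf) ts" and ?t1 = "add_mset (plug C P2) ts"
  have par1: "pdF ?d ?old \<subseteq># pdF ?d ?t1"
    using pd_plug_Lf[OF h] pd_plug_ge[of C P2 ?d] by simp
  have nv1: "nvF ?t1 = nvF ?old + 1" using nv_plug[of C P2 Lf] by simp
  have br1: "brF ?d ?t1 = brF ?d ?old - gain ?e 1"
    using br_plug[of C P2 ?d Lf] h by simp
  have s: "12 \<le> size (pdF ?d ?old)" using optimal by (simp add: optimal_def)
  then have "pdF ?d ?old \<noteq> {#}" by (metis not_numeral_le_zero size_empty)
  then obtain e2 where e2: "e2 \<in># pdF ?d ?old" by blast
  then have "e2 \<in># pdF ?d ?t1" using par1 by (metis mset_subset_eqD)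
  then obtain t2 where t2: "size t2 = size ?t1" "nvF t2 = nvF ?t1 + 2" "brF ?d t2 = brF ?d ?t1 + upgrade_gain e2"
    "pdF ?d t2 = pdF ?d ?t1 - {#e2#}" using upgradeF[of e2 ?d ?t1] by auto
  have "size (pdF ?d t2) \<ge> 11"
  proof -
    have "12 \<le> size (pdF ?d ?t1)" using s size_mset_mono[OF par1] by linarith
    then show ?thesis unfolding t2(4) by (auto simp: size_Diff_singleton_if simp del: F_simps)
  qed
  then have "pdF ?d t2 \<noteq> {#}" by (metis not_numeral_le_zero size_empty)
  then obtain e1 where e1: "e1 \<in># pdF ?d t2" by blast
  then obtain t3 where t3: "size t3 = size t2" "nvF t3 + 3 = nvF t2" "brF ?d t3 = brF ?d t2 - gain e1 3"
    using downgradeF[of e1 ?d t2] by auto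
  have "gain e1 3 \<le> 12976/100000" using gain_3_less pdF_pos[OF e1] by simp
  moreover have "upgrade_gain 3 \<le> upgrade_gain e2"
    using par_ge_3[OF optimal] e2 by (intro upgrade_gain_mono) auto
  ultimately have "brF ?d ?old < brF ?d t3"
    using leaf_profit[OF h] br1 t2(3) t3(3) by linarith
  then show False
    using no_improvement[OF optimal, of t3] nv1 t2 t3 by simp
qed

lemma small_branch:
  assumes optimal: "optimal ts" and ts: "ts = add_mset (plug C s) rest" and h: "3 \<le> hdeg (size ts) C"
  shows "2 \<le> dg s" "dg s = 2 \<Longrightarrow> s = P2"
proof -
  have "s \<noteq> Lf" using no_leaf[of C rest] optimal ts h by auto
  then show "2 \<le> dg s" using dg_1D[of s] dg_pos[of s] by linarith
  assume "dg s = 2"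
  then have "size (kids s) = 1" by (simp add: dg_def)
  then obtain x where "s = N {#x#}" using size_1_singleton_mset by (metis mtree.collapse)
  then obtain us where us: "s = N {#N us#}" by (metis mtree.exhaust)
  then have "us = {#}" using no_thin[of C us rest] optimal ts h by auto
  then show "s = P2" by (simp add: us P2_def Lf_def)
qed

lemma no_Lf_child:
  assumes "optimal ts" "3 \<le> size ts" shows "Lf \<notin># ts"
proof
  assume "Lf \<in># ts"
  then obtain r where "ts = add_mset (plug [] Lf) r" by (metis insert_DiffM plug.simps(1))
  from small_branch(1)[OF assms(1) this] assms(2) show False by simp
qed

text \<open>
  Otherwise twelve \<open>B\<^sub>2\<close>-branches can be cut down to paths, and five \<open>B\<^sub>3\<close>-branches be added at the root.
\<close>

lemma par_ex_5:
  assumes optimal: "optimal ts" and size: "3 \<le> size ts"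
  shows "\<exists>e\<in>#par ts. 5 \<le> e"
proof (rule ccontr)
  assume *: "\<not> ?thesis"
  let ?d = "size ts"
  obtain M where M: "M \<subseteq># par ts" "size M = 12"
    using optimal obtain_submultiset[of 12 "par ts"] by (auto simp: optimal_def)
  have "\<forall>e\<in>#M. 1 \<le> e \<and> e \<le> 4"
  proof
    fix e assume "e \<in># M"
    then have e: "e \<in># par ts" using M(1) by (metis mset_subset_eqD)
    then show "1 \<le> e \<and> e \<le> 4" using * par_ge_3[OF optimal e] by force
  qed
  \<comment> \<open>Twelve cuts free 36 vertices, one more than five \<open>B3\<close>-branches
    need.\<close>
  then obtain us where us: "size us = ?d" "nvF us + 36 = nvF ts" "brF ?d ts - 12 * gain 4 3 \<le> brF ?d us"
    "Lf \<notin># ts \<longrightarrow> Lf \<notin># us" using downgradesF[OF M(1), of 4] size M(2) by auto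
  let ?new = "us + replicate_mset 5 B3"
  have "brF ?d us \<le> brF (?d + 5) us"
    using us(4) no_Lf_child[OF optimal size] size by (intro brF_mono) auto
  moreover have "gain 8 4 \<le> gain (?d + 5) 4" using size by (intro gain_mono) auto
  ultimately have "brF ?d ts < brF (size ?new) ?new"
    using us numeric_inequalities(2) by simp
  then show False using no_improvement[OF optimal, of ?new] us by simp
qed

text \<open>Cutting a \<open>B2\<close>-branch at a parent of degree 3 down to a path frees three
  vertices; two of them upgrade a \<open>B2\<close>-branch at a parent of degree at least 5, which
  is the better place.\<close>

lemma par_ge_4:
  assumes optimal: "optimal ts" and size: "3 \<le> size ts" and e: "e \<in># par ts"
  shows "4 \<le> e"
proof (rule ccontr)
  assume "\<not> 4 \<le> e"
  then have e3: "3 \<in># par ts" using par_ge_3[OF optimal e] e by (metis Suc_leI eval_nat_numeral(2) le_antisym not_le semiring_norm(26,27))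
  obtain f where f: "f \<in># par ts" "5 \<le> f" using par_ex_5[OF optimal size] by auto
  have pos: "0 < size ts" using size by simp
  obtain us where us: "size us = size ts" "nvF us = nvF ts + 2" "brF (size ts) us = brF (size ts) ts + upgrade_gain f"
    "pdF (size ts) us = par ts - {#f#}" using upgradeF[OF f(1) pos] by metis
  have "3 \<in># pdF (size ts) us" using us(4) e3 f(2) by (simp add: in_diff_count)
  then obtain vs where vs: "size vs = size us" "nvF vs + 3 = nvF us" "brF (size ts) vs = brF (size ts) us - gain 3 3"
    using downgradeF[OF _ pos] by metis
  have "upgrade_gain 5 \<le> upgrade_gain f" using f(2) by (intro upgrade_gain_mono) auto
  then show False using no_improvement[OF optimal, of vs] us vs numeric_inequalities(3) by simp
qed

section \<open>Exchanges against a root of largest degree\<close>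

definition topmost :: "mtree multiset \<Rightarrow> bool" where
  "topmost ts \<longleftrightarrow> optimal ts \<and> B2 \<in># ts \<and> (\<forall>e\<in>#par ts. e \<le> size ts)"

text \<open>The root degree is maximised over all optimal trees with a \<open>B2\<close>-branch at
  the root. As every parent of a \<open>B2\<close>-branch can be made the root of such a tree, the
  maximum bounds all parent degrees.\<close>

lemma topmost_exists:
  assumes "optimal ts" shows "\<exists>us. topmost us"
proof -
  let ?P = "\<lambda>us. optimal us \<and> B2 \<in># us"
  have "par ts \<noteq> {#}" using assms by (auto simp: optimal_def)
  then obtain e where "e \<in># par ts" by blast
  then obtain us where "optimal (add_mset B2 us)" using optimal_B2_root[OF assms] by metis
  then have "?P (add_mset B2 us)" by simp
  moreover have "\<forall>us. ?P us \<longrightarrow> size us < m"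
    using size_le_nvF by (auto simp: optimal_def) (metis le_imp_less_Suc)
  ultimately obtain ws where ws: "?P ws" "\<forall>us. ?P us \<longrightarrow> size us \<le> size ws"
    using ex_has_greatest_nat[of ?P "add_mset B2 us" size m] by (metis less_imp_le_nat)
  have "e \<le> size ws" if e: "e \<in># par ws" for e
  proof -
    obtain vs where "optimal (add_mset B2 vs)" "size vs + 1 = e" using optimal_B2_root[OF _ e] ws(1) by metis
    then show ?thesis using ws(2)[rule_format, of "add_mset B2 vs"] by simp
  qed
  then show ?thesis using ws(1) by (auto simp: topmost_def)
qed

lemma topmostD:
  assumes "topmost ts"
  shows "optimal ts" "B2 \<in># ts" "\<And>e. e \<in># par ts \<Longrightarrow> e \<le> size ts" "5 \<le> size ts" "size ts \<in># par ts"
    "\<And>e. e \<in># par ts \<Longrightarrow> 4 \<le> e"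
proof -
  show optimal: "optimal ts" and B: "B2 \<in># ts" and le: "\<And>e. e \<in># par ts \<Longrightarrow> e \<le> size ts" using assms by (auto simp: topmost_def)
  obtain us where us: "ts = add_mset B2 us" using B by (metis insert_DiffM)
  then have 3: "3 \<le> size ts" using optimal_B2_size[of us] optimal by simp
  show "5 \<le> size ts" using par_ex_5[OF optimal 3] le by force
  show "size ts \<in># par ts" by (simp add: us)
  show "\<And>e. e \<in># par ts \<Longrightarrow> 4 \<le> e" using par_ge_4[OF optimal 3] by blast
qed

text \<open>Otherwise \<open>s\<close> trades places with a \<open>B2\<close>-branch at the root, so
  that the larger degrees meet: a strict improvement.\<close>

lemma swap_low:
  assumes topmost: "topmost ts" and ts: "ts = add_mset (plug C s) rest" and h: "hdeg (size ts) C < size ts"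
  shows "dg s \<le> 3"
proof (rule ccontr)
  assume *: "\<not> dg s \<le> 3"
  let ?D = "size ts" let ?e = "hdeg ?D C"
  have "plug C s \<noteq> B2" using plug_eq_B2D[of C s] * by auto
  then obtain r where r: "rest = add_mset B2 r" using topmostD(2)[OF topmost] ts by (metis insert_noteq_member multi_member_split)
  let ?new = "add_mset s (add_mset (plug C B2) r)"
  have "?e > 0" using hdeg_pos[of ?D C] h by simp
  have "gain ?e (dg s) + gain ?D 3 < gain ?e 3 + gain ?D (dg s)"
    using h * \<open>?e > 0\<close> by (intro gain_supermodular_strict) auto
  then have "brF ?D ts < brF ?D ?new"
    using br_plug[of C B2 ?D s] br_diff[of s ?D ?e] \<open>?e > 0\<close> h by (simp add: ts r)
  moreover have "nvF ?new = nvF ts" using nv_plug[of C B2 s] by (simp add: ts r)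
  ultimately show False using no_improvement[OF topmostD(1)[OF topmost], of ?new] by (simp add: ts r)
qed

text \<open>Iterates \<open>swap_low\<close> downwards: children of degree at most 3 are again of
  smaller degree than the root.\<close>

lemma low_below:
  assumes topmost: "topmost ts" and "ts = add_mset (plug (C1 @ C2) s) rest" "C2 \<noteq> []" "dg (plug C2 s) < size ts"
  shows "dg s \<le> 3"
  using assms(2-)
proof (induction C2 arbitrary: s rule: rev_induct)
  case (snoc zs C3)
  let ?s = "N (add_mset s zs)"
  have lt: "dg ?s < size ts"
  proof (cases "C3 = []")
    case False
    then have "dg ?s \<le> 3" using snoc.IH[of ?s] snoc.prems by simp
    then show ?thesis using topmostD(4)[OF topmost] by linarith
  qed (use snoc.prems in simp)
  have "hdeg (size ts) (C1 @ C3 @ [zs]) < size ts"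
    using lt by (simp add: hdeg_append)
  then show ?case using swap_low[OF topmost, of "C1 @ C3 @ [zs]" s rest] snoc.prems by simp
qed simp

text \<open>By \<open>swap_low\<close> and \<open>small_branch\<close> the two children are paths or
  have degree 3. One of degree 3 would inductively be a \<open>B2\<close> with a parent of degree 3,
  which is too small.\<close>

lemma degree_3_branch:
  assumes topmost: "topmost ts"
  shows "ts = add_mset (plug C s) rest \<Longrightarrow> dg s = 3 \<Longrightarrow> s = B2"
proof (induction "nv s" arbitrary: s C rule: less_induct)
  case less
  note optimal = topmostD(1)[OF topmost]
  have "size (kids s) = 2" using less.prems by (simp add: dg_def)
  then obtain a us where us: "kids s = add_mset a us" "size us = 1"
    by (metis size_eq_Suc_imp_eq_union numeral_2_eq_2 One_nat_def size_add_mset nat.inject)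
  then obtain b where "us = {#b#}" using size_1_singleton_mset by metis
  then have ab: "s = N {#a, b#}" using us by (metis mtree.collapse)
  have P: "a = P2" if ab: "s = N {#a, b#}" for a b
  proof -
    let ?C = "C @ [{#b#}]"
    have ts: "ts = add_mset (plug ?C a) rest" using less.prems ab by simp
    have h: "hdeg (size ts) ?C = 3" by simp
    have "dg a \<le> 3" using swap_low[OF topmost ts] h topmostD(4)[OF topmost] by simp
    moreover have "2 \<le> dg a" "dg a = 2 \<Longrightarrow> a = P2" using small_branch[OF optimal ts] h by auto
    moreover have "dg a \<noteq> 3"
    proof
      assume "dg a = 3"
      moreover have "nv a < nv s" by (simp add: ab nv_N)
      ultimately have "a = B2" using less.hyps ts by blast
      then have "3 \<in># pd (plug ?C a) (size ts)"
        using mset_subset_eqD[OF pd_plug_ge[of ?C B2 "size ts"], of 3] h by simp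
      then have "3 \<in># par ts" by (simp add: ts)
      then show False using topmostD(6)[OF topmost] by force
    qed
    ultimately show ?thesis by linarith
  qed
  have "a = P2" "b = P2" using P[OF ab] P[of b a] ab by (simp_all add: add_mset_commute)
  then show ?case by (simp add: ab B2_def)
qed

lemma low_kids:
  assumes topmost: "topmost ts" and ts: "ts = add_mset (plug C (N us)) rest" and lt: "size us + 1 < size ts" "2 \<le> size us"
  shows "us = replicate_mset (count us B2) B2 + replicate_mset (count us P2) P2"
proof (rule two_valued_mset)
  show "\<forall>a\<in>#us. a = B2 \<or> a = P2"
  proof
    fix a assume "a \<in># us"
    then obtain vs where vs: "us = add_mset a vs" by (metis insert_DiffM)
    let ?C = "C @ [vs]"
    have ts': "ts = add_mset (plug ?C a) rest" using ts vs by simp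
    have h: "hdeg (size ts) ?C = size us + 1" using vs by simp
    have "dg a \<le> 3" using swap_low[OF topmost ts'] h lt by simp
    moreover have "2 \<le> dg a" "dg a = 2 \<Longrightarrow> a = P2"
      using small_branch[OF topmostD(1)[OF topmost] ts'] h lt by auto
    moreover have "dg a = 3 \<Longrightarrow> a = B2" using degree_3_branch[OF topmost ts'] .
    ultimately show "a = B2 \<or> a = P2" by linarith
  qed
qed simp

section \<open>Surgeries on branches made of paths and \<open>B2\<close>-branches\<close>

lemma dismantle:
  assumes optimal: "optimal (add_mset (N us) ws)" and us: "us = replicate_mset k B2 + replicate_mset t P2"
    and x: "x = k + t + 1" and X: "X = size ws + 1" and ws: "\<forall>a\<in>#ws. 3 \<le> dg a"
    and out: "out \<le> size (filter_mset (\<lambda>e. x \<le> e) (pdF X ws))"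
    and a: "7 * a3 + 5 * a2 + 2 * out \<le> 5 * k + 2 * t + 1" "a3 + a2 \<ge> 1"
    and profit: "0 < dismantle_profit x k out a3 a2 X"
  shows False
proof -
  define X' where "X' = X + a3 + a2 - 1"
  have X': "X \<le> X'" "1 \<le> X" "X' = size ws + a3 + a2" using a X by (auto simp: X'_def)
  have "out \<le> size (filter_mset (\<lambda>e. x \<le> e) (pdF X' ws))"
    using out filter_pdF_mono[OF X'(1)] order.trans by blast
  then obtain M where M: "M \<subseteq># filter_mset (\<lambda>e. x \<le> e) (pdF X' ws)" "size M = out"
    by (rule obtain_submultiset)
  have M': "M \<subseteq># pdF X' ws" "\<forall>e\<in>#M. x \<le> e"
  proof -
    show "M \<subseteq># pdF X' ws" using M(1) multiset_filter_subset subset_mset.order_trans by blast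
    show "\<forall>e\<in>#M. x \<le> e" using mset_subset_eqD[OF M(1)] by auto
  qed
  have Xp: "0 < X'" "1 \<le> x" using X' x by auto
  obtain vs where vs: "size vs = size ws" "nvF vs = nvF ws + 2 * out" "brF X' ws + out * upgrade_gain x \<le> brF X' vs"
    using upgradesF[OF M'(1) Xp(1) M'(2) Xp(2)] M(2) by auto
  have inc: "brF X ws + (real X - 1) * (gain X' 3 - gain X 3) \<le> brF X' ws"
    using brF_increase[of ws 3 X X'] ws X X' by simp
  let ?new = "vs + replicate_mset a3 B3 + replicate_mset a2 B2"
  have sz: "size ?new = X'" using vs(1) X' by simp
  have "brF (size ?new) ?new = brF X' vs + a3 * gain X' 4 + a2 * gain X' 3"
    unfolding sz using Xp by simp
  moreover have "brF (size (add_mset (N us) ws)) (add_mset (N us) ws) = gain X x + k * gain x 3 + brF X ws"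
    using br_mixed(1)[OF us, of X] by (simp add: X x)
  moreover have "gain X x + k * gain x 3 < a3 * gain X' 4 + a2 * gain X' 3 + out * upgrade_gain x
      + (real X - 1) * (gain X' 3 - gain X 3)"
    using profit unfolding dismantle_profit_def X'_def by linarith
  ultimately have "brF (size (add_mset (N us) ws)) (add_mset (N us) ws) < brF (size ?new) ?new"
    using vs(3) inc by linarith
  moreover have "nvF ?new \<le> nvF (add_mset (N us) ws)"
    using br_mixed(2)[OF us] vs(2) a(1) by simp
  ultimately show False using no_improvement[OF optimal] by blast
qed

text \<open>Seven of the eleven \<open>B2\<close>-branches are exchanged for five
  \<open>B3\<close>-branches; \<open>b\<close> is the one neighbour whose degree is not
  controlled.\<close>

lemma many_B2:
  assumes optimal: "optimal ts" and ts: "ts = replicate_mset 11 B2 + add_mset b R" and R: "\<forall>a\<in>#R. dg a \<le> 4 \<and> a \<noteq> Lf" and b: "b \<noteq> Lf"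
  shows False
proof -
  define d where "d = size ts"
  have d: "d = size R + 12" "12 \<le> d" by (simp_all add: d_def ts)
  define q where "q = 2 / (2 * (real d * real (d - 2)))"
  have Rdrop: "brF d R - size R * q \<le> brF (d - 2) R"
    using R
  proof (induction R)
    case (add a R)
    have "2 \<le> dg a" using dg_1D[of a] dg_pos[of a] add.prems by fastforce
    then have "gain d (dg a) - gain (d - 2) (dg a) \<le> q"
      using gain_drop_4[of 2 d "dg a"] add.prems d by (simp add: q_def)
    then have "br a d - q \<le> br a (d - 2)" using br_diff[of a d "d - 2"] by simp
    with add show ?case by (simp add: algebra_simps)
  qed simp
  have db: "2 \<le> dg b" using dg_1D[of b] dg_pos[of b] b by linarith
  let ?new = "replicate_mset 5 B3 + replicate_mset 4 B2 + add_mset b R"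
  have sz: "size ?new = d - 2" using d by simp
  have new: "brF (size ?new) ?new = 5 * gain (d - 2) 4 + 4 * gain (d - 2) 3 + br b (d - 2) + brF (d - 2) R"
    unfolding sz using d by simp
  have old: "brF (size ts) ts = 11 * gain d 3 + br b d + brF d R"
    unfolding d_def[symmetric] using d by (simp add: ts)
  have "7 * gain d 3 + 4 * (gain d 3 - gain (d - 2) 3) + size R * q + (br b d - br b (d - 2)) < 5 * gain (d - 2) 4"
    using seven_to_five[OF d(2) db] br_diff[of b d "d - 2"] d(1) by (simp add: q_def)
  then have "brF (size ts) ts < brF (size ?new) ?new"
    unfolding new old using Rdrop by argo
  moreover have "nvF ?new = nvF ts" by (simp add: ts)
  ultimately show False using no_improvement[OF optimal, of ?new] by simp
qed

text \<open>A path has gain zero at either end of the edge, a \<open>B2\<close> has more at the end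
  of larger degree.\<close>

lemma path_vs_B2_swap:
  assumes optimal: "optimal (add_mset (N (add_mset B2 us)) (add_mset P2 ws))" and lt: "size us < size ws"
  shows False
proof -
  let ?old = "add_mset (N (add_mset B2 us)) (add_mset P2 ws)"
  let ?new = "add_mset (N (add_mset P2 us)) (add_mset B2 ws)"
  have "gain (size us + 2) 3 < gain (size ws + 2) 3"
    using lt by (intro gain_strict_mono) auto
  then have "brF (size ?old) ?old < brF (size ?new) ?new" by (simp add: br_N)
  moreover have "nvF ?new = nvF ?old" by (simp add: nv_N)
  ultimately show False using no_improvement[OF optimal, of ?new] by simp
qed

lemma path_move:
  assumes optimal: "optimal (add_mset (N us) ws)" and us: "us = replicate_mset k B2 + replicate_mset t P2"
    and t: "t > 0" and x: "x = k + t + 1" "8 \<le> x" and e: "e \<in># pdF (size ws + 1) ws" "9 \<le> e"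
  shows False
proof -
  let ?X = "size ws + 1"
  define us' where "us' = replicate_mset k B2 + replicate_mset (t - 1) P2"
  obtain vs where vs: "size vs = size ws" "nvF vs = nvF ws + 2" "brF ?X vs = brF ?X ws + upgrade_gain e"
    using upgradeF[OF e(1)] by auto
  let ?old = "add_mset (N us) ws" and ?new = "add_mset (N us') vs"
  have "1 \<le> size ws" using e(1) by (cases ws) auto
  then have "k * (gain x 3 - gain (x - 1) 3) + (gain ?X x - gain ?X (x - 1)) < upgrade_gain 9"
    using x t by (intro path_move_profit) auto
  also have "\<dots> \<le> upgrade_gain e" using e by (intro upgrade_gain_mono) auto
  finally have "brF (size ?old) ?old < brF (size ?new) ?new"
    using br_mixed(1)[OF us, of ?X] br_mixed(1)[OF us'_def, of ?X] x t vs by (simp add: algebra_simps)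
  moreover have "nvF ?new = nvF ?old"
    using br_mixed(2)[OF us] br_mixed(2)[OF us'_def] vs t by simp
  ultimately show False using no_improvement[OF optimal, of ?new] by simp
qed

text \<open>A parent of smaller degree than the root is taken apart unless it is exceptional. The
  hypothesis \<open>big\<close> provides the places for upgrades: at most \<open>k\<close> of the
  eleven lie in the branch itself.\<close>

lemma lower_parent:
  assumes topmost: "topmost ts" and x: "x \<in># par ts" "x < size ts"
    and big: "11 \<le> size (filter_mset (\<lambda>e. x \<le> e) (par ts))"
  shows "x = 4 \<and> (\<exists>ws. optimal (add_mset (N {#B2, P2, P2#}) ws) \<and> par (add_mset (N {#B2, P2, P2#}) ws) = par ts
    \<and> 4 \<le> size ws \<and> (\<forall>a\<in>#ws. 3 \<le> dg a))"
proof -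
  note optimal = topmostD(1)[OF topmost] and D5 = topmostD(4)[OF topmost]
  have x4: "4 \<le> x" using topmostD(6)[OF topmost x(1)] .
  obtain C rest where C: "ts = add_mset (plug C B2) rest" "hdeg (size ts) C = x"
    using pdF_location[OF x(1)] by metis
  then have "C \<noteq> []" using x(2) by auto
  then obtain C0 us0 where C0: "C = C0 @ [us0]" by (metis rev_exhaust)
  define us where "us = add_mset B2 us0"
  have szus: "size us + 1 = x" using C C0 by (simp add: us_def)
  have ts: "ts = add_mset (plug C0 (N us)) rest" using C C0 by (simp add: us_def)
  define k t where "k = count us B2" and "t = count us P2"
  have us: "us = replicate_mset k B2 + replicate_mset t P2"
    unfolding k_def t_def using low_kids[OF topmost ts] szus x x4 by simp
  have xkt: "x = k + t + 1" using szus arg_cong[OF us, of size] by simp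
  have k1: "1 \<le> k" by (simp add: k_def us_def)
  have szr: "4 \<le> size rest" using D5 ts by simp
  have nb: "N us \<notin> {Lf, P2, B2}" using N_B2_special us_def by simp
  obtain ws where ws: "optimal (add_mset (N us) ws)" "par (add_mset (N us) ws) = par ts" "size ts \<le> size ws + 1"
  proof (cases C0 rule: rev_cases)
    case Nil
    then show ?thesis using that[of rest] optimal ts by simp
  next
    case (snoc C1 cs)
    let ?w = "add_mset (N us) cs"
    have ts': "ts = add_mset (plug C1 (N ?w)) rest" using ts snoc by simp
    \<comment> \<open>A vertex of degree \<open>x\<close> at least 4 cannot hang below one of degree
      smaller than that of the topmost root.\<close>
    have "size ts \<le> size cs + 2"
    proof (rule ccontr)
      assume "\<not> ?thesis"
      then have "dg (N us) \<le> 3" using swap_low[OF topmost, of C0 "N us" rest] ts snoc by simp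
      then show False using szus x4 by simp
    qed
    moreover have "N ?w \<noteq> B2"
    proof
      assume "N ?w = B2"
      then have "N us \<in># {#P2, P2#}" by (metis B2_def mtree.sel union_single_eq_member)
      then show False using nb by simp
    qed
    then have "N ?w \<notin> {Lf, P2, B2}" using nb by (auto simp: P2_def Lf_def add_mset_eq_single)
    moreover have "N rest \<notin> {Lf, P2, B2}" using szr by (auto simp: P2_def Lf_def B2_def)
    ultimately obtain rem where "optimal (add_mset (N rem) ?w)" "par (add_mset (N rem) ?w) = par ts"
      using optimal_reroot_context[of C1 ?w rest] optimal ts' by auto
    then show ?thesis
      using that[of "add_mset (N rem) cs"] \<open>size ts \<le> size cs + 2\<close> by (simp add: add_mset_commute)
  qed
  define X where "X = size ws + 1"
  have X: "5 \<le> X" "x < X" using ws(3) D5 x by (auto simp: X_def)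
  have dg3: "\<forall>a\<in>#ws. 3 \<le> dg a"
  proof
    fix a assume "a \<in># ws"
    then obtain vs where vs: "ws = add_mset a vs" by (metis insert_DiffM)
    have "add_mset (N us) ws = add_mset (plug [] a) (add_mset (N us) vs)" by (simp add: vs add_mset_commute)
    note sb = small_branch[OF ws(1) this]
    have "2 \<le> dg a" "dg a = 2 \<Longrightarrow> a = P2" using sb X by (auto simp: X_def)
    moreover have "a \<noteq> P2"
      using path_vs_B2_swap[of us0 vs] ws(1) vs X szus by (auto simp: us_def X_def)
    ultimately show "3 \<le> dg a" by fastforce
  qed
  have pdu: "pd (N us) X = replicate_mset k x" using br_mixed(3)[OF us] nb xkt by simp
  have parX: "par ts = replicate_mset k x + pdF X ws" using ws(2) pdu by (simp add: X_def)
  have outside: "11 - k \<le> size (filter_mset (\<lambda>e. x \<le> e) (pdF X ws))"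
    using big size_filter_mset_lesseq[of "\<lambda>e. x \<le> e" "replicate_mset k x"] by (simp add: parX)
  have "x = 4 \<and> k = 1"
  proof (rule ccontr)
    assume ne: "\<not> (x = 4 \<and> k = 1)"
    \<comment> \<open>Either the vertex itself carries eleven \<open>B2\<close>-branches, or one of
      its paths is better used elsewhere, or the pair is in the finite table.\<close>
    consider "t = 0" "12 \<le> x" | "t > 0" "8 \<le> x" | "t = 0 \<longrightarrow> x \<le> 11" "t > 0 \<longrightarrow> x \<le> 7" by linarith
    then show False
    proof cases
      case 1
      have optimal': "optimal (add_mset (N ws) us)" using optimal_reroot[OF ws(1)] nb by simp
      have "us = replicate_mset 11 B2 + replicate_mset (k - 11) B2"
        using us 1 xkt by (simp add: multiset_eq_iff)
      then have "add_mset (N ws) us = replicate_mset 11 B2 + add_mset (N ws) (replicate_mset (k - 11) B2)" by simp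
      moreover have "\<forall>a\<in>#replicate_mset (k - 11) B2. dg a \<le> 4 \<and> a \<noteq> Lf"
        by (simp split: if_splits)
      moreover have "N ws \<noteq> Lf" using X by (auto simp: X_def Lf_def)
      ultimately show False using many_B2[OF optimal'] by blast
    next
      case 2
      have "size ts \<in># pdF X ws" using topmostD(5)[OF topmost] x parX by (auto split: if_splits)
      then show False using path_move[OF ws(1) us 2(1) xkt 2(2), of "size ts"] x 2 by (simp add: X_def)
    next
      case 3
      obtain out a3 a2 where o: "7 * a3 + 5 * a2 + 2 * out \<le> 5 * k + 2 * t + 1" "out + k \<le> 11" "a3 + a2 \<ge> 1"
        "0 < dismantle_profit x k out a3 a2 X"
        using dismantle_exists[of x k t X] x4 xkt k1 X 3 ne by auto
      have "out \<le> size (filter_mset (\<lambda>e. x \<le> e) (pdF X ws))" using outside o(2) by linarith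
      then show False using dismantle[OF ws(1) us xkt X_def dg3 _ o(1,3,4)] by blast
    qed
  qed
  then have "us = {#B2, P2, P2#}" "x = 4" using us xkt by (auto simp: numeral_2_eq_2)
  then show ?thesis using ws dg3 D5 by auto
qed

text \<open>A second \<open>B2\<close>-branch at a parent of degree 4 could trade places with one of
  the two paths at no cost. The resulting vertex, with two \<open>B2\<close>-branches and one path,
  can be taken apart.\<close>

lemma single_4:
  assumes optimal: "optimal (add_mset (N {#B2, P2, P2#}) ws)" and sz: "4 \<le> size ws" and dg3: "\<forall>a\<in>#ws. 3 \<le> dg a"
  shows "4 \<notin># pdF (size ws + 1) ws"
proof
  assume "4 \<in># pdF (size ws + 1) ws"
  then obtain C r where C: "ws = add_mset (plug C B2) r" "hdeg (size ws + 1) C = 4"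
    using pdF_location by metis
  let ?X = "size ws + 1"
  have Cne: "C \<noteq> []" using C sz by auto
  define us where "us = replicate_mset 2 B2 + replicate_mset 1 P2"
  let ?ws = "add_mset (plug C P2) r"
  have us: "us = {#B2, B2, P2#}" by (simp add: us_def numeral_2_eq_2)
  have ne: "N {#B2, P2, P2#} \<noteq> B2" "N us \<noteq> B2" by (auto simp: B2_def us)
  have sw: "size ?ws = size ws" using C by simp
  have four: "gain (Suc (Suc (Suc (Suc 0)))) 3 = gain 4 3" by (simp add: numeral_eq_Suc)
  have optimal': "optimal (add_mset (N us) ?ws)"
  proof (rule optimal_equal[OF optimal])
    show "nvF (add_mset (N us) ?ws) = nvF (add_mset (N {#B2, P2, P2#}) ws)"
      using nv_plug[of C P2 B2] C by (simp add: nv_N us)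
    show "brF (size (add_mset (N us) ?ws)) (add_mset (N us) ?ws)
        = brF (size (add_mset (N {#B2, P2, P2#}) ws)) (add_mset (N {#B2, P2, P2#}) ws)"
      using br_plug[of C P2 ?X B2] C four by (simp add: br_N us)
    have "size (cpd C) \<le> size (pd (plug C P2) ?X)"
      using size_mset_mono[OF pd_plug_ge[of C P2 ?X]] by simp
    moreover have "size (pd (plug C B2) ?X) = size (cpd C) + 1"
      using pd_plug[of ?X C B2] by simp
    ultimately show "size (par (add_mset (N {#B2, P2, P2#}) ws)) \<le> size (par (add_mset (N us) ?ws))"
      using C(1) ne by (simp add: pd_N us)
  qed
  have dg3': "\<forall>a\<in>#?ws. 3 \<le> dg a"
    using dg3 C(1) dg_plug[OF Cne, of P2 B2] by auto
  obtain out a3 a2 where o: "7 * a3 + 5 * a2 + 2 * out \<le> 5 * 2 + 2 * 1 + 1" "out + 2 \<le> 11" "a3 + a2 \<ge> 1"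
    "0 < dismantle_profit 4 2 out a3 a2 ?X"
  proof -
    have "\<exists>out a3 a2. 7 * a3 + 5 * a2 + 2 * out \<le> 5 * 2 + 2 * 1 + 1 \<and> out + 2 \<le> 11 \<and> a3 + a2 \<ge> 1 \<and>
      0 < dismantle_profit 4 2 out a3 a2 ?X"
      by (rule dismantle_exists) (use sz in simp_all)
    then show thesis using that by blast
  qed
  have "4 \<le> e" if "e \<in># pdF ?X ?ws" for e
    by (rule par_ge_4[OF optimal']) (use that sz sw in auto)
  then have "filter_mset (\<lambda>e. 4 \<le> e) (pdF ?X ?ws) = pdF ?X ?ws" by (intro filter_mset_all) blast
  moreover have "size (pd (N us) ?X) = 2"
    using br_mixed(3)[OF us_def ne(2), of ?X] by simp
  then have "size (par (add_mset (N us) ?ws)) = 2 + size (pdF ?X ?ws)"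
    using sw by simp
  ultimately have "out \<le> size (filter_mset (\<lambda>e. 4 \<le> e) (pdF ?X ?ws))"
    using optimal' o(2) by (simp add: optimal_def)
  then show False
    using dismantle[OF optimal' us_def _ _ dg3' _ o(1,3,4)] sw by simp
qed

text \<open>\<open>lower_parent\<close> applies to the least parent degree, which is 4 and occurs
  once if it is below the root degree. Without it eleven are left, enough to apply the lemma again
  to the next value, which would also have to be 4.\<close>

lemma par_values:
  assumes topmost: "topmost ts"
  shows "\<And>e. e \<in># par ts \<Longrightarrow> e = size ts \<or> e = 4" "11 \<le> count (par ts) (size ts)"
proof -
  let ?D = "size ts"
  have least: "\<exists>x. Q x \<and> (\<forall>y. Q y \<longrightarrow> x \<le> y)" if "Q y" for Q and y :: nat
    using that by (metis LeastI_ex Least_le)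
  have D12: "12 \<le> size (par ts)" using topmostD(1)[OF topmost] by (simp add: optimal_def)
  have main: "(\<forall>e\<in>#par ts. e = ?D \<or> e = 4) \<and> count (par ts) 4 \<le> 1"
  proof (cases "\<exists>x. x \<in># par ts \<and> x < ?D")
    case False
    then have "\<forall>e\<in>#par ts. e = ?D" using topmostD(3)[OF topmost] by (meson le_neq_implies_less)
    moreover have "4 \<notin># par ts" using calculation topmostD(4)[OF topmost] by force
    ultimately show ?thesis by (simp add: not_in_iff)
  next
    case True
    then obtain x where x: "x \<in># par ts" "x < ?D" "\<forall>y. y \<in># par ts \<and> y < ?D \<longrightarrow> x \<le> y"
      using least[of "\<lambda>x. x \<in># par ts \<and> x < ?D"] by blast
    have "\<forall>e\<in>#par ts. x \<le> e" using x by (meson less_imp_le_nat linorder_not_less order.trans)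
    then have "filter_mset (\<lambda>e. x \<le> e) (par ts) = par ts" by (rule filter_mset_all)
    then obtain ws where x4: "x = 4" and ws: "optimal (add_mset (N {#B2, P2, P2#}) ws)"
      "par (add_mset (N {#B2, P2, P2#}) ws) = par ts" "4 \<le> size ws" "\<forall>a\<in>#ws. 3 \<le> dg a"
      using lower_parent[OF topmost x(1,2)] D12 by auto
    have us: "{#B2, P2, P2#} = replicate_mset 1 B2 + replicate_mset 2 P2" by (simp add: numeral_2_eq_2)
    have "N {#B2, P2, P2#} \<noteq> B2" by (auto simp: B2_def)
    then have "par ts = {#4#} + pdF (size ws + 1) ws"
      using br_mixed(3)[OF us, of "size ws + 1"] ws(2) by (simp add: numeral_eq_Suc)
    then have c4: "count (par ts) 4 = 1"
      using single_4[OF ws(1,3,4)] by (simp add: not_in_iff)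
    have "e = ?D \<or> e = 4" if e: "e \<in># par ts" for e
    proof (rule ccontr)
      assume ne: "\<not> ?thesis"
      then have "e < ?D" using topmostD(3)[OF topmost e] by simp
      then obtain y where y: "y \<in># par ts" "y < ?D" "y \<noteq> 4" "\<forall>z. z \<in># par ts \<and> z < ?D \<and> z \<noteq> 4 \<longrightarrow> y \<le> z"
        using least[of "\<lambda>x. x \<in># par ts \<and> x < ?D \<and> x \<noteq> 4" e] e ne by blast
      have "\<forall>z\<in>#par ts - {#4#}. y \<le> z"
      proof
        fix z assume z: "z \<in># par ts - {#4#}"
        then have zp: "z \<in># par ts" by (rule in_diffD)
        have "z \<noteq> 4" using z c4 by (auto simp: in_diff_count)
        then show "y \<le> z" using y zp by (meson less_imp_le_nat linorder_not_less order.trans)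
      qed
      then have eq: "filter_mset (\<lambda>z. y \<le> z) (par ts - {#4#}) = par ts - {#4#}" by (rule filter_mset_all)
      have "11 \<le> size (par ts - {#4#})" using D12 by (auto simp: size_Diff_singleton_if)
      also have "\<dots> \<le> size (filter_mset (\<lambda>z. y \<le> z) (par ts))"
        by (subst eq[symmetric]) (intro size_mset_mono multiset_filter_mono diff_subset_eq_self)
      finally show False using lower_parent[OF topmost y(1,2)] y(3) by auto
    qed
    then show ?thesis using c4 by simp
  qed
  then show "\<And>e. e \<in># par ts \<Longrightarrow> e = size ts \<or> e = 4" by blast
  have "par ts = replicate_mset (count (par ts) ?D) ?D + replicate_mset (count (par ts) 4) 4"
    using main topmostD(4)[OF topmost] by (intro two_valued_mset) auto
  from arg_cong[OF this, of size] show "11 \<le> count (par ts) ?D" using main D12 by simp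
qed

section \<open>Neutral exchanges and tie-breaking\<close>

text \<open>
  Lexicographic: first many \<open>B\<^sub>2\<close>-branches at the root, then few children of large degree.
\<close>

definition score :: "mtree multiset \<Rightarrow> nat" where
  "score ts = count ts B2 * (m + 1) + (m - size (filter_mset (\<lambda>a. size ts \<le> dg a) ts))"

definition champion :: "mtree multiset \<Rightarrow> bool" where
  "champion ts \<longleftrightarrow> topmost ts \<and> (\<forall>us. topmost us \<longrightarrow> score us \<le> score ts)"

lemma champion_exists:
  assumes "optimal ts" shows "\<exists>us. champion us"
proof -
  obtain us where us: "topmost us" using topmost_exists[OF assms] by blast
  have "score vs < m * (m + 1) + m + 1" if "topmost vs" for vs
  proof -
    have "count vs B2 \<le> size vs" by (rule count_le_size)
    also have "\<dots> \<le> nvF vs" by (rule size_le_nvF)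
    also have "\<dots> \<le> m" using topmostD(1)[OF that] by (simp add: optimal_def)
    finally have "count vs B2 * (m + 1) \<le> m * (m + 1)" by (rule mult_le_mono1)
    then show ?thesis unfolding score_def by linarith
  qed
  then show ?thesis
    using ex_has_greatest_nat[of topmost us score "m * (m + 1) + m + 1"] us unfolding champion_def by blast
qed

lemma champion_count:
  assumes "champion ts" "topmost us" shows "count us B2 \<le> count ts B2"
proof (rule ccontr)
  assume "\<not> ?thesis"
  then have "(count ts B2 + 1) * (m + 1) \<le> count us B2 * (m + 1)" by (intro mult_le_mono1) simp
  then have "score ts < score us" unfolding score_def by (simp add: algebra_simps)
  then show False using assms by (auto simp: champion_def)
qed

text \<open>The case in which collecting \<open>B2\<close>-branches at the root is stuck, because
  all root branches except \<open>c\<close> are \<open>B2\<close> already. With the root moved to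
  \<open>c\<close>, the old root becomes a branch consisting of \<open>B2\<close>-branches only,
  which can be taken apart or reduced.\<close>

lemma pure_neighbour:
  assumes topmost: "topmost ts" and ts: "ts = add_mset c (replicate_mset (size ts - 1) B2)" and c: "c = N ws" "size ts \<le> size ws + 1"
    and far: "\<And>b. b \<in># ws \<Longrightarrow> dg b < size ts \<Longrightarrow> b \<noteq> B2 \<Longrightarrow> size ts \<notin># pd b (size ts)"
  shows False
proof -
  note optimal = topmostD(1)[OF topmost]
  define D where "D = size ts"
  have D5: "5 \<le> D" using topmostD(4)[OF topmost] by (simp add: D_def)
  have ts: "ts = add_mset c (replicate_mset (D - 1) B2)" using ts by (simp add: D_def)
  show False
  proof (cases "12 \<le> D")
    case True
    have "replicate_mset (D - 1) B2 = replicate_mset 11 B2 + replicate_mset (D - 12) B2"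
      using True by (simp add: multiset_eq_iff)
    then have "ts = replicate_mset 11 B2 + add_mset c (replicate_mset (D - 12) B2)" using ts by simp
    moreover have "\<forall>a\<in>#replicate_mset (D - 12) B2. dg a \<le> 4 \<and> a \<noteq> Lf" by (simp split: if_splits)
    moreover have "c \<noteq> Lf" using c D5 by (auto simp: Lf_def D_def)
    ultimately show False using many_B2[OF optimal] by blast
  next
    case False
    define us where "us = replicate_mset (D - 1) B2 + replicate_mset 0 P2"
    have us': "us = replicate_mset (D - 1) B2" by (simp add: us_def)
    define X where "X = size ws + 1"
    have X: "D \<le> X" using c by (simp add: D_def X_def)
    have cB: "c \<noteq> B2" using c D5 by (auto simp: B2_def D_def)
    have "D - 1 = Suc (D - 2)" using D5 by simp
    then have us2: "us = add_mset B2 (replicate_mset (D - 2) B2)" using us' by simp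
    have nus: "N us \<noteq> B2" using N_B2_special us2 by auto
    have optimal': "optimal (add_mset (N us) ws)" using optimal_reroot[of ws us] optimal ts c cB us' by simp
    have par': "par (add_mset (N us) ws) = par ts"
      using reroot_pdF(2)[of ws us] cB nus ts c us' by simp
    have pdu: "pd (N us) X = replicate_mset (D - 1) D" using br_mixed(3)[OF us_def nus, of X] D5 by simp
    have parX: "par ts = replicate_mset (D - 1) D + pdF X ws" using par' pdu by (simp add: X_def)
    \<comment> \<open>At least eleven parents have degree \<open>D\<close>, counted with
      multiplicity, and \<open>D - 1\<close> of these entries come from the branch
      \<open>N us\<close>.\<close>
    have cnt: "12 - D \<le> count (pdF X ws) D"
    proof -
      have "11 \<le> count (par ts) D" using par_values(2)[OF topmost] by (simp only: D_def)
      then show ?thesis unfolding parX using D5 by simp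
    qed
    have bru: "br (N us) X = gain X D + (real D - 1) * gain D 3"
      using br_mixed(1)[OF us_def, of X] D5 by (simp add: of_nat_diff)
    show False
    proof (cases "\<forall>a\<in>#ws. 3 \<le> dg a")
      case True
      obtain out a3 a2 where o: "7 * a3 + 5 * a2 + 2 * out \<le> 5 * (D - 1) + 2 * 0 + 1" "out + (D - 1) \<le> 11" "a3 + a2 \<ge> 1"
        "0 < dismantle_profit D (D - 1) out a3 a2 X"
      proof -
        have "\<exists>out a3 a2. 7 * a3 + 5 * a2 + 2 * out \<le> 5 * (D - 1) + 2 * 0 + 1 \<and> out + (D - 1) \<le> 11 \<and> a3 + a2 \<ge> 1 \<and>
          0 < dismantle_profit D (D - 1) out a3 a2 X"
          by (rule dismantle_exists) (use D5 X False in simp_all)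
        then show thesis using that by blast
      qed
      have "replicate_mset (count (pdF X ws) D) D \<subseteq># filter_mset (\<lambda>e. D \<le> e) (pdF X ws)"
        by (subst count_le_replicate_mset_subset_eq[symmetric]) simp
      from size_mset_mono[OF this] have "out \<le> size (filter_mset (\<lambda>e. D \<le> e) (pdF X ws))"
        using cnt o(2) by simp
      then show False using dismantle[OF optimal' us_def _ X_def True _ o(1,3,4)] D5 by simp
    next
      case ex: False
      then obtain a where a: "a \<in># ws" "\<not> 3 \<le> dg a" by blast
      obtain ws1 where ws1: "ws = add_mset a ws1" using a(1) by (metis insert_DiffM)
      have "add_mset (N us) ws = add_mset (plug [] a) (add_mset (N us) ws1)" by (simp add: ws1 add_mset_commute)
      note sb = small_branch[OF optimal' this]
      have "2 \<le> dg a" "dg a = 2 \<Longrightarrow> a = P2" using sb X D5 by (auto simp: X_def)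
      then have "a = P2" using a(2) by linarith
      then have ws2: "ws = add_mset P2 ws1" using ws1 by simp
      have XD: "X = D"
      proof (rule ccontr)
        assume "X \<noteq> D"
        then have "size (replicate_mset (D - 2) B2) < size ws1" using X ws2 D5 by (simp add: X_def)
        then show False using path_vs_B2_swap optimal' us2 ws2 by metis
      qed
      show False
      proof (cases "7 \<le> D")
        case True
        \<comment> \<open>A \<open>B2\<close> of the branch and the path at its neighbour, with 5 +
          2 vertices, merge into a \<open>B3\<close> at the neighbour.\<close>
        define us3 where "us3 = replicate_mset (D - 2) B2 + replicate_mset 0 P2"
        let ?new = "add_mset (N us3) (add_mset B3 ws1)"
        have "(real D - 2) * (gain D 3 - gain (D - 1) 3) + (gain D D - gain D (D - 1)) < upgrade_gain D"
        proof -
          consider "D = 7" | "D = 8" | "9 \<le> D" using True by linarith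
          then show ?thesis
          proof cases
            case 3
            have "real (D - 2) * (gain D 3 - gain (D - 1) 3) + (gain D D - gain D (D - 1)) < upgrade_gain 9"
              using 3 by (intro path_move_profit) auto
            also have "\<dots> \<le> upgrade_gain D" using 3 by (intro upgrade_gain_mono) auto
            finally show ?thesis using 3 by (simp add: of_nat_diff)
          qed (use numeric_inequalities(6,7) in simp_all)
        qed
        moreover have "br (N us3) D = gain D (D - 1) + (real D - 2) * gain (D - 1) 3"
          using br_mixed(1)[OF us3_def, of D] D5 by (simp add: of_nat_diff Suc_diff_Suc numeral_2_eq_2)
        ultimately have "brF (size (add_mset (N us) ws)) (add_mset (N us) ws) < brF (size ?new) ?new"
          using bru XD ws2 D5 by (simp add: X_def upgrade_gain_def algebra_simps)
        moreover have "nvF ?new = nvF (add_mset (N us) ws)"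
          using br_mixed(2)[OF us_def] br_mixed(2)[OF us3_def] ws2 D5 by simp
        ultimately show False using no_improvement[OF optimal', of ?new] by simp
      next
        case small: False
        have szw: "size ws1 = D - 2" using XD ws2 by (simp add: X_def)
        \<comment> \<open>By \<open>far\<close> each branch of small degree contributes at most one
          entry \<open>D\<close>. The \<open>D - 2\<close> branches cannot supply the
          \<open>12 - D\<close> entries of \<open>cnt\<close> when \<open>D\<close> is at most
          6.\<close>
        have "\<exists>b\<in>#ws1. D \<le> dg b"
        proof (rule ccontr)
          assume *: "\<not> ?thesis"
          have "count (pd b D) D \<le> 1" if "b \<in># ws1" for b
          proof (cases "b = B2")
            case False
            then have "D \<notin># pd b D" using far[of b] that * ws2 by (auto simp: D_def)
            then show ?thesis by (simp add: not_in_iff)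
          qed simp
          then have "count (pdF D ws1) D \<le> size ws1"
          proof (induction ws1)
            case (add b bs)
            then have "count (pd b D) D \<le> 1" "count (pdF D bs) D \<le> size bs" by auto
            then show ?case by simp
          qed simp
          then show False using cnt XD ws2 szw small D5 by simp
        qed
        then obtain b where b: "b \<in># ws1" "D \<le> dg b" by blast
        then obtain ws3 where ws3: "ws1 = add_mset b ws3" by (metis insert_DiffM)
        have nl: "Lf \<notin># ws" using no_Lf_child[OF optimal'] XD D5 by (simp add: X_def)
        have inc: "brF D ws1 + (gain d' D - gain D D) \<le> brF d' ws1" if "D \<le> d'" for d'
        proof -
          have "gain D (dg b) + gain d' D \<le> gain D D + gain d' (dg b)"
            using that b(2) D5 by (intro gain_supermodular) auto
          moreover have "brF D ws3 \<le> brF d' ws3" using that D5 nl ws2 ws3 by (intro brF_mono) auto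
          ultimately show ?thesis using br_diff[of b d' D] by (simp add: ws3)
        qed
        consider "D = 5" | "D = 6" using small D5 by linarith
        then show False
        proof cases
          case 1
          \<comment> \<open>The branch has 21 vertices, enough for three \<open>B3\<close>; the path
            stays.\<close>
          let ?new = "ws + replicate_mset 3 B3"
          have "brF (size ?new) ?new = brF 7 ws1 + 3 * gain 7 4"
            using szw 1 ws2 by simp
          moreover have "brF (size (add_mset (N us) ws)) (add_mset (N us) ws) = gain 5 5 + 4 * gain 5 3 + brF 5 ws1"
            using bru XD 1 ws2 szw by simp
          ultimately have "brF (size (add_mset (N us) ws)) (add_mset (N us) ws) < brF (size ?new) ?new"
            using inc[of 7] numeric_inequalities(4) 1 by simp
          moreover have "nvF ?new \<le> nvF (add_mset (N us) ws)" using br_mixed(2)[OF us_def] 1 by simp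
          ultimately show False using no_improvement[OF optimal'] by blast
        next
          case 2
          \<comment> \<open>The 26 vertices of the branch and the two of the path make four
            \<open>B3\<close>.\<close>
          let ?new = "ws1 + replicate_mset 4 B3"
          have "brF (size ?new) ?new = brF 8 ws1 + 4 * gain 8 4"
            using szw 2 by simp
          moreover have "brF (size (add_mset (N us) ws)) (add_mset (N us) ws) = gain 6 6 + 5 * gain 6 3 + brF 6 ws1"
            using bru XD 2 ws2 szw by simp
          ultimately have "brF (size (add_mset (N us) ws)) (add_mset (N us) ws) < brF (size ?new) ?new"
            using inc[of 8] numeric_inequalities(5) 2 by simp
          moreover have "nvF ?new \<le> nvF (add_mset (N us) ws)" using br_mixed(2)[OF us_def] 2 ws2 by simp
          ultimately show False using no_improvement[OF optimal'] by blast
        qed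
      qed
    qed
  qed
qed

text \<open>A \<open>B2\<close> at another vertex of degree \<open>size ts\<close> could trade
  places, at no cost, with any root branch that is not a \<open>B2\<close>, raising the score. So
  all the other root branches are \<open>B2\<close>, and \<open>pure_neighbour\<close>
  applies.\<close>

lemma champion_no_outer:
  assumes ch: "champion ts" and ts: "ts = add_mset (plug C B2) rest" and C: "C \<noteq> []" "hdeg (size ts) C = size ts"
  shows False
proof -
  have topmost: "topmost ts" using ch by (simp add: champion_def)
  note optimal = topmostD(1)[OF topmost]
  define D where "D = size ts"
  have D5: "5 \<le> D" using topmostD(4)[OF topmost] by (simp add: D_def)
  have hD: "hdeg D C = D" using C by (simp add: D_def)
  have plug_ne: "plug C B2 \<noteq> B2"
  proof
    assume "plug C B2 = B2"
    then have "B2 \<in># {#P2, P2#} \<or> plug (tl C) B2 \<in># {#P2, P2#}"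
      using C(1) by (cases C) (auto simp: B2_def add_mset_eq_single dest!: arg_cong[of _ _ "\<lambda>M. plug (tl C) B2 \<in># M"])
    then show False using plug_eq_P2D[of "tl C" B2] by auto
  qed
  have "a = B2" if a: "a \<in># rest" for a
  proof (rule ccontr)
    assume ne: "a \<noteq> B2"
    obtain r where r: "rest = add_mset a r" using a by (metis insert_DiffM)
    let ?new = "add_mset B2 (add_mset (plug C a) r)"
    have sz: "size ?new = D" by (simp add: D_def ts r)
    have par: "par ?new = par ts"
      unfolding sz D_def[symmetric] using pd_plug[of D C B2] pd_plug[of D C a] hD D5 by (simp add: ts r)
    have br: "brF (size ?new) ?new = brF (size ts) ts"
      unfolding sz D_def[symmetric] using br_plug[of C a D B2] hD D5 by (simp add: ts r)
    have "nvF ?new = nvF ts" using nv_plug[of C a B2] by (simp add: ts r)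
    then have "optimal ?new" by (rule optimal_equal[OF optimal _ br]) (simp only: par)
    then have "topmost ?new" using topmost par sz by (simp add: topmost_def D_def)
    then have "count ?new B2 \<le> count ts B2" by (rule champion_count[OF ch])
    then show False using plug_ne ne by (simp add: ts r split: if_splits)
  qed
  then have rest: "rest = replicate_mset (size rest) B2"
    by (metis set_mset_subset_singletonD subsetI singletonI set_mset_subset_singletonD)
  obtain C0 ys where C0: "C = C0 @ [ys]" using C(1) by (metis rev_exhaust)
  let ?y = "N (add_mset B2 ys)"
  have dgy: "dg ?y = D" using hD C0 by simp
  obtain ws where ws: "plug C B2 = N ws" by (cases "plug C B2")
  have cy: "plug C B2 = plug C0 ?y" using C0 by simp
  have "D \<le> size ws + 1"
  proof (rule ccontr)
    assume *: "\<not> ?thesis"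
    then have lt: "dg (plug C0 ?y) < D" using ws cy by (metis dg_N not_le)
    then have "C0 \<noteq> []" using dgy by (metis less_irrefl plug.simps(1))
    then have "dg ?y \<le> 3" using low_below[OF topmost, of "[]" C0 ?y rest] ts cy lt by (simp add: D_def)
    then show False using dgy D5 by simp
  qed
  moreover have "D \<notin># pd b D" if b: "b \<in># ws" "dg b < D" "b \<noteq> B2" for b
  proof
    assume "D \<in># pd b D"
    then obtain C' where C': "b = plug C' B2" "hdeg D C' = D" using pd_location by blast
    then have "C' \<noteq> []" using b(3) by auto
    then obtain C1 zs where C1: "C' = C1 @ [zs]" by (metis rev_exhaust)
    let ?z = "N (add_mset B2 zs)"
    have dgz: "dg ?z = D" using C'(2) C1 by simp
    have bz: "b = plug C1 ?z" using C'(1) C1 by simp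
    then have "C1 \<noteq> []" using dgz b(2) by (metis less_irrefl plug.simps(1))
    moreover obtain ws' where "ws = add_mset b ws'" using b(1) by (metis insert_DiffM)
    then have "ts = add_mset (plug ([ws'] @ C1) ?z) rest" using ts ws bz by simp
    ultimately have "dg ?z \<le> 3" using low_below[OF topmost, of "[ws']" C1 ?z rest] bz b(2) by (simp add: D_def)
    then show False using dgz D5 by simp
  qed
  moreover have "ts = add_mset (plug C B2) (replicate_mset (size ts - 1) B2)" using ts rest by simp
  ultimately show False using pure_neighbour[OF topmost _ ws] by (simp add: D_def)
qed

theorem no_optimal: "\<not> optimal ts"
proof
  assume "optimal ts"
  then obtain ts where ch: "champion ts" using champion_exists by blast
  have topmost: "topmost ts" using ch by (simp add: champion_def)
  note optimal = topmostD(1)[OF topmost]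
  define D where "D = size ts"
  have D5: "5 \<le> D" using topmostD(4)[OF topmost] by (simp add: D_def)
  have outer: "D \<notin># pd t D" if t: "t \<in># ts" "t \<noteq> B2" for t
  proof
    assume "D \<in># pd t D"
    then obtain C where C: "t = plug C B2" "hdeg D C = D" using pd_location by blast
    then have "C \<noteq> []" using t by auto
    moreover obtain r where "ts = add_mset t r" using t(1) by (metis insert_DiffM)
    ultimately show False using champion_no_outer[OF ch, of C r] C by (simp add: D_def)
  qed
  have "count (pdF D us) D = count us B2" if "us \<subseteq># ts" for us
    using that
  proof (induction us)
    case (add t us)
    have "t \<in># ts" using add.prems by (metis mset_subset_eqD union_single_eq_member)
    moreover have "us \<subseteq># ts" using add.prems by (metis mset_subset_eq_add_right subset_mset.order_trans add_mset_add_single union_commute)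
    ultimately show ?case using add.IH outer[of t] by (cases "t = B2") (simp_all add: not_in_iff)
  qed simp
  then have B11: "11 \<le> count ts B2" using par_values(2)[OF topmost] by (simp add: D_def)
  \<comment> \<open>A root branch of degree between 5 and \<open>D - 1\<close> carries paths only,
    as its degree is not among the \<open>par_values\<close>. One of these paths would do better by
    upgrading a \<open>B2\<close> at the root.\<close>
  have small: "dg a \<le> 4" if a: "a \<in># ts" "dg a < D" for a
  proof (rule ccontr)
    assume a5: "\<not> dg a \<le> 4"
    obtain us where us: "a = N us" by (cases a)
    obtain r where r: "ts = add_mset a r" using a(1) by (metis insert_DiffM)
    have szus: "4 \<le> size us" using a5 us by simp
    have mix: "us = replicate_mset (count us B2) B2 + replicate_mset (count us P2) P2"
      using low_kids[OF topmost, of "[]" us r] r us a(2) szus by (simp add: D_def)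
    have "B2 \<notin># us"
    proof
      assume "B2 \<in># us"
      then obtain vs where vs: "us = add_mset B2 vs" by (metis insert_DiffM)
      have "size us + 1 \<in># pd a D"
        using mset_subset_eqD[OF pd_plug_ge[of "[vs]" B2 D], of "size us + 1"] by (simp add: us vs)
      then have "size us + 1 \<in># par ts" by (simp add: r D_def)
      then show False using par_values(1)[OF topmost, of "size us + 1"] a(2) us szus by (simp add: D_def)
    qed
    then have "us = replicate_mset 0 B2 + replicate_mset (count us P2) P2" using mix by (simp add: not_in_iff)
    moreover define t where "t = count us P2"
    ultimately have ust: "us = replicate_mset 0 B2 + replicate_mset t P2" by simp
    then have t4: "4 \<le> t" using szus by (metis add_0 size_replicate_mset size_union)
    have "a \<noteq> B2" using a5 by auto
    then obtain q where q: "r = add_mset B2 q" using topmostD(2)[OF topmost] r by (metis insert_noteq_member multi_member_split)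
    define us' where "us' = replicate_mset 0 B2 + replicate_mset (t - 1) P2"
    let ?new = "add_mset (N us') (add_mset B3 q)"
    have "11 \<le> D" using B11 count_le_size[of ts B2] by (simp add: D_def)
    then have "gain D (t + 1) - gain D t < upgrade_gain D"
      using t4 by (intro numeric_inequalities(8)) auto
    then have "brF (size ts) ts < brF (size ?new) ?new"
      using br_mixed(1)[OF ust, of D] br_mixed(1)[OF us'_def, of D] t4 D5
      by (simp add: D_def r q us upgrade_gain_def)
    moreover have "nvF ?new = nvF ts"
      using br_mixed(2)[OF ust] br_mixed(2)[OF us'_def] t4 by (simp add: r q us)
    ultimately show False using no_improvement[OF optimal, of ?new] by simp
  qed
  \<comment> \<open>If two root branches have degree at least \<open>D\<close>, the second is
    exchanged with a child of a lowest such vertex \<open>y\<close> in the first. This is a strict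
    gain if \<open>y\<close> has degree above \<open>D\<close>; otherwise it is neutral and the root
    has one large child less.\<close>
  have two: False if b: "ts = add_mset b1 (add_mset b2 r)" "D \<le> dg b1" "D \<le> dg b2" for b1 b2 r
  proof -
    obtain C0 y where y: "b1 = plug C0 y" "D \<le> dg y" "\<forall>a\<in>#kids y. dg a < D"
      using top_leaf_exists[OF b(2)] by blast
    have "kids y \<noteq> {#}" using y(2) D5 by (auto simp: dg_def)
    then obtain a ys where ay: "kids y = add_mset a ys" by (metis multiset_cases)
    then have yN: "y = N (add_mset a ys)" by (metis mtree.collapse)
    let ?C = "C0 @ [ys]"
    have b1: "b1 = plug ?C a" using y(1) yN by simp
    have h: "hdeg D ?C = dg y" by (simp add: yN)
    have aD: "dg a < D" using y(3) ay by simp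
    let ?new = "add_mset a (add_mset (plug ?C b2) r)"
    have sz: "size ?new = D" by (simp add: D_def b(1))
    have nv: "nvF ?new = nvF ts" using nv_plug[of ?C b2 a] by (simp add: b(1) b1)
    have br: "brF (size ?new) ?new = brF (size ts) ts
      + (gain D (dg a) - gain (dg y) (dg a) + gain (dg y) (dg b2) - gain D (dg b2))"
      unfolding sz D_def[symmetric]
      using br_plug[of ?C b2 D a] h br_diff[of a D "dg y"] br_diff[of b2 "dg y" D] by (simp add: b(1) b1)
    show False
    proof (cases "D < dg y")
      case True
      have "gain D (dg b2) + gain (dg y) (dg a) < gain D (dg a) + gain (dg y) (dg b2)"
        using True aD b(3) D5 dg_pos[of a] by (intro gain_supermodular_strict) auto
      then show False using no_improvement[OF optimal, of ?new] nv br by simp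
    next
      case False
      then have yD: "dg y = D" using y(2) by simp
      have par: "par ?new = par ts"
        unfolding sz D_def[symmetric] using pd_plug[of D ?C b2] pd_plug[of D ?C a] h yD D5 by (simp add: b(1) b1)
      have "brF (size ?new) ?new = brF (size ts) ts" using br yD by simp
      then have "optimal ?new" by (rule optimal_equal[OF optimal nv]) (simp only: par)
      moreover have "b1 \<noteq> B2" "b2 \<noteq> B2" using b D5 by auto
      then have "B2 \<in># r" using topmostD(2)[OF topmost] b(1) by auto
      ultimately have "topmost ?new" using topmost par sz by (simp add: topmost_def D_def)
      then have le: "score ?new \<le> score ts" using ch by (simp add: champion_def)
      have "count ts B2 \<le> count ?new B2"
        using \<open>b1 \<noteq> B2\<close> \<open>b2 \<noteq> B2\<close> by (simp add: b(1))
      moreover have "size (filter_mset (\<lambda>a. D \<le> dg a) ts) = size (filter_mset (\<lambda>a. D \<le> dg a) ?new) + 1"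
        using b aD dg_plug[of ?C b2 a] b1 by simp
      moreover have "size (filter_mset (\<lambda>a. D \<le> dg a) ts) \<le> m"
      proof -
        have "size (filter_mset (\<lambda>a. D \<le> dg a) ts) \<le> size ts" by (rule size_filter_mset_lesseq)
        then show ?thesis using size_le_nvF[of ts] optimal unfolding optimal_def by linarith
      qed
      ultimately show False
        using le sz mult_le_mono1[of "count ts B2" "count ?new B2" "m + 1"] unfolding score_def D_def[symmetric] sz by linarith
    qed
  qed
  have "replicate_mset 11 B2 \<subseteq># ts" using B11 by (subst count_le_replicate_mset_subset_eq[symmetric])
  then obtain R where R: "ts = replicate_mset 11 B2 + R" by (metis subset_mset.add_diff_inverse)
  have nl: "Lf \<notin># ts" using no_Lf_child[OF optimal] D5 by (simp add: D_def)
  have "R \<noteq> {#}"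
  proof
    assume "R = {#}"
    then have "size (par ts) = 11" using R by simp
    then show False using optimal by (simp add: optimal_def)
  qed
  obtain b Q where b: "R = add_mset b Q" and Q: "\<forall>a\<in>#Q. dg a < D"
  proof (cases "\<exists>b\<in>#R. D \<le> dg b")
    case True
    then obtain b where b: "b \<in># R" "D \<le> dg b" by blast
    then obtain Q where Q: "R = add_mset b Q" by (metis insert_DiffM)
    have "dg a < D" if aQ: "a \<in># Q" for a
    proof (rule ccontr)
      assume "\<not> dg a < D"
      moreover obtain r where "Q = add_mset a r" using aQ by (metis insert_DiffM)
      ultimately show False using two[of b a "replicate_mset 11 B2 + r"] R Q b(2) by simp
    qed
    then show ?thesis using that Q by blast
  next
    case False
    obtain b Q where bQ: "R = add_mset b Q" using \<open>R \<noteq> {#}\<close> by (metis multiset_cases)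
    then have "\<forall>a\<in>#Q. dg a < D" using False by (auto simp: not_le)
    then show ?thesis using that bQ by blast
  qed
  have "\<forall>a\<in>#Q. dg a \<le> 4 \<and> a \<noteq> Lf" using small Q nl R b by auto
  then show False using many_B2[OF optimal, of b Q] R b nl by auto
qed

end

section \<open>Padding, and the choice of a tree of least order\<close>

lemma pad_branch: "2 \<le> d \<or> t \<noteq> Lf \<Longrightarrow> 1 \<le> d \<Longrightarrow> \<exists>t'. nv t' = nv t + 1 \<and> br t d \<le> br t' d"
proof (induction t arbitrary: d)
  case (N ts)
  show ?case
  proof (cases "ts = {#}")
    case True
    then have "2 \<le> d" using N.prems by (simp add: Lf_def)
    \<comment> \<open>At a vertex of degree at least two a pendant edge has gain at most zero, the
      lengthened path exactly zero. A lone edge has positive gain; this is the case that the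
      assumption leaves out.\<close>
    then have "gain d 1 \<le> 0" using gain_supermodular[of 2 d 1 2] gain_2(2)[of 1] by simp
    then show ?thesis using True N.prems by (intro exI[of _ P2]) (simp add: Lf_def[symmetric])
  next
    case False
    then obtain a r where a: "ts = add_mset a r" by (metis multiset_cases)
    then obtain a' where "nv a' = nv a + 1" "br a (size ts + 1) \<le> br a' (size ts + 1)"
      using N.IH[of a "size ts + 1"] by auto
    then show ?thesis using a by (intro exI[of _ "N (add_mset a' r)"]) (simp add: nv_N br_N)
  qed
qed

lemma pad:
  assumes "2 \<le> nvF ts"
  shows "\<exists>us. nvF us = nvF ts + 1 \<and> brF (size ts) ts \<le> brF (size us) us"
proof -
  have "ts \<noteq> {#}" using assms by auto
  then obtain a r where a: "ts = add_mset a r" by (metis multiset_cases)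
  have "2 \<le> size ts \<or> a \<noteq> Lf" using assms a by (cases r) auto
  then obtain a' where "nv a' = nv a + 1" "br a (size ts) \<le> br a' (size ts)"
    using pad_branch[of "size ts" a] a by auto
  then show ?thesis using a by (intro exI[of _ "add_mset a' r"]) simp
qed

lemma pad_to:
  assumes "2 \<le> nvF ts" "nvF ts \<le> n"
  shows "\<exists>us. nvF us = n \<and> brF (size ts) ts \<le> brF (size us) us"
  using assms(2)
proof (induction n rule: dec_induct)
  case (step n)
  then obtain us where us: "nvF us = n" "brF (size ts) ts \<le> brF (size us) us" by blast
  then obtain vs where "nvF vs = n + 1" "brF (size us) us \<le> brF (size vs) vs"
    using pad[of us] assms step by auto
  then show ?case using us(2) by (intro exI[of _ vs]) auto
qed auto

text \<open>\<open>B2\<close>-branches are disjoint and have five vertices each.\<close>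

lemma nv_ge_pd: "5 * size (pd t d) \<le> nv t"
proof (induction t arbitrary: d)
  case (N ts)
  have "5 * size (pdF e us) \<le> nvF us" if "us \<subseteq># ts" for us e
    using that
  proof (induction us)
    case (add t us)
    have "t \<in># ts" using add.prems by (metis mset_subset_eqD union_single_eq_member)
    moreover have "us \<subseteq># ts" using add.prems by (metis mset_subset_eq_add_right subset_mset.order_trans add_mset_add_single union_commute)
    ultimately show ?case using add.IH N.IH[of t e] by simp
  qed simp
  from this[of ts "size ts + 1"] show ?case
    by (cases "N ts = B2") (simp_all add: pd_N nv_N)
qed

lemma nvF_ge_pdF: "5 * size (pdF d ts) \<le> nvF ts"
proof (induction ts)
  case (add t ts)
  then show ?case using nv_ge_pd[of t d] by simp
qed simp

text \<open>Padding extends optimality to smaller orders. Among the trees with the optimal gain and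
  twelve \<open>B2\<close>-branches one of least order is then chosen, which makes the locale
  \<open>extremal\<close> available.\<close>

theorem mtree_B2_bound:
  assumes opt: "\<And>us. nvF us = nvF ts \<Longrightarrow> brF (size us) us \<le> brF (size ts) ts"
  shows "size (pdF (size ts) ts) \<le> 11"
proof (rule ccontr)
  assume "\<not> ?thesis"
  then have 12: "12 \<le> size (pdF (size ts) ts)" by simp
  let ?opt = "brF (size ts) ts"
  have big: "60 \<le> nvF ts" using nvF_ge_pdF[of "size ts" ts] 12 by linarith
  have opt2: "brF (size us) us \<le> ?opt" if "2 \<le> nvF us" "nvF us \<le> nvF ts" for us
    using pad_to[OF that] opt order.trans by metis
  have best: "brF (size us) us \<le> ?opt" if "nvF us \<le> nvF ts" for us
  proof (cases "2 \<le> nvF us")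
    case False
    \<comment> \<open>A single edge cannot be padded and has gain sqrt (1/2). Eight
      \<open>B3\<close>-branches at one root, 56 vertices, beat it.\<close>
    have "8 * gain 8 4 \<le> ?opt" using opt2[of "replicate_mset 8 B3"] big by simp
    moreover have "1/10 \<le> gain 8 4"
      by (rule order.trans[OF _ gain_ge[of "56/100"]]) (simp_all add: power2_eq_square)
    moreover have "brF (size us) us \<le> 8/10"
    proof (cases us)
      case (add t vs)
      have "vs = {#}"
      proof (rule ccontr)
        assume "vs \<noteq> {#}"
        then obtain v q where "vs = add_mset v q" by (metis multiset_cases)
        then show False using False nv_pos[of t] nv_pos[of v] add by simp
      qed
      moreover have "t = Lf"
      proof (rule ccontr)
        assume "t \<noteq> Lf"
        then obtain k v where "t = N (add_mset v k)" by (metis Lf_def multiset_cases mtree.exhaust)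
        then show False using False nv_pos[of v] add by (simp add: nv_N)
      qed
      ultimately have "brF (size us) us = sqrt (1/2)" using add by (simp add: gain_def abc_f_def)
      then show ?thesis using sqrt_half_bounds by simp
    qed simp
    ultimately show ?thesis by linarith
  qed (use opt2 that in simp)
  define Q where "Q m \<longleftrightarrow> (\<exists>us. Suc (nvF us) = m \<and> brF (size us) us = ?opt \<and> 12 \<le> size (pdF (size us) us))" for m
  define m where "m = (LEAST m. Q m)"
  have "Q (Suc (nvF ts))" using 12 by (auto simp: Q_def)
  then have Qm: "Q m" and m: "m \<le> Suc (nvF ts)"
    unfolding m_def by (rule LeastI, rule Least_le)
  interpret extremal m ?opt
  proof
    fix us assume us: "Suc (nvF us) < m" "12 \<le> size (pdF (size us) us)"
    then have "\<not> Q (Suc (nvF us))" unfolding m_def by (metis not_less_Least)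
    then have "brF (size us) us \<noteq> ?opt" using us(2) unfolding Q_def by blast
    moreover have "brF (size us) us \<le> ?opt" using best[of us] us m by simp
    ultimately show "brF (size us) us < ?opt" by simp
  qed (use best m in auto)
  show False using Qm no_optimal by (auto simp: Q_def optimal_def)
qed

section \<open>Graphs and labelled trees\<close>

text \<open>Trees as what arises from one vertex by attaching leaves; this supplies the induction
  that leads to labelled trees.\<close>

inductive grown :: "'a \<Rightarrow> 'a set \<Rightarrow> 'a set set \<Rightarrow> bool" for r where
  base: "grown r {r} {}"
| leaf: "grown r V E \<Longrightarrow> p \<in> V \<Longrightarrow> l \<notin> V \<Longrightarrow> grown r (insert l V) (insert {p, l} E)"

lemma adjacent_sym: "adjacent E u v \<longleftrightarrow> adjacent E v u"
  by (simp add: adjacent_def insert_commute)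

lemma gpath_mono:
  assumes "gpath E p" "\<And>u v. adjacent E u v \<Longrightarrow> u \<in> set p \<Longrightarrow> v \<in> set p \<Longrightarrow> adjacent E' u v"
  shows "gpath E' p"
  using assms unfolding gpath_def by (auto intro: successively_mono[rotated] elim!: successively_mono)

text \<open>Keeps a vertex with a single neighbour off every cycle.\<close>

lemma gcycle_neighbours:
  assumes "gcycle E c" "x \<in> set c"
  obtains a b where "a \<noteq> b" "adjacent E x a" "adjacent E x b"
proof -
  have c: "distinct c" "successively (adjacent E) c" "3 \<le> length c" "adjacent E (last c) (hd c)"
    using assms by (auto simp: gcycle_def gpath_def)
  obtain xs ys where xy: "c = xs @ x # ys" using assms(2) by (metis split_list)
  show ?thesis
  proof (cases xs rule: rev_cases)
    case Nil
    then have "2 \<le> length ys" using c(3) xy by simp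
    then obtain y ys' where ys: "ys = y # ys'" by (cases ys) auto
    then have ne: "ys' \<noteq> []" using \<open>2 \<le> length ys\<close> by auto
    show ?thesis
    proof (rule that[of y "last ys'"])
      show "y \<noteq> last ys'" using c(1) xy ys ne by auto
      show "adjacent E x y" "adjacent E x (last ys')" using c xy ys ne Nil by (auto simp: adjacent_sym)
    qed
  next
    case (snoc xs' z)
    show ?thesis
    proof (cases ys)
      case Nil
      then have "xs' \<noteq> []" using c(3) xy snoc by auto
      show ?thesis
      proof (rule that[of z "hd xs'"])
        show "z \<noteq> hd xs'" using c(1) xy snoc \<open>xs' \<noteq> []\<close> by auto
        show "adjacent E x z" "adjacent E x (hd xs')"
          using c xy snoc Nil \<open>xs' \<noteq> []\<close> by (auto simp: successively_append_iff adjacent_sym)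
      qed
    next
      case (Cons y ys')
      show ?thesis
      proof (rule that[of z y])
        show "z \<noteq> y" using c(1) xy snoc Cons by auto
        show "adjacent E x z" "adjacent E x y"
          using c(2) xy snoc Cons by (auto simp: successively_append_iff adjacent_sym)
      qed
    qed
  qed
qed

text \<open>Keeps a leaf off every path between two other vertices, so that its removal preserves
  connectedness.\<close>

lemma gpath_inner_neighbours:
  assumes "gpath E p" "x \<in> set p" "x \<noteq> hd p" "x \<noteq> last p"
  obtains a b where "a \<noteq> b" "adjacent E x a" "adjacent E x b"
proof -
  have p: "distinct p" "successively (adjacent E) p" using assms by (auto simp: gpath_def)
  obtain xs ys where xy: "p = xs @ x # ys" using assms(2) by (metis split_list)
  have "xs \<noteq> []" "ys \<noteq> []" using assms xy by auto
  then obtain xs' z y ys' where "xs = xs' @ [z]" "ys = y # ys'" by (metis list.exhaust rev_exhaust)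
  then show ?thesis using that[of z y] p xy by (auto simp: successively_append_iff adjacent_sym)
qed

lemma tree_graph_leaf:
  assumes "tree_graph V E" "p \<in> V" "l \<notin> V"
  shows "tree_graph (insert l V) (insert {p, l} E)"
proof -
  let ?E = "insert {p, l} E"
  have sg: "simple_graph V E" and cg: "connected_graph V E" and ac: "\<nexists>c. gcycle E c"
    using assms by (auto simp: tree_graph_def)
  have EV: "e \<subseteq> V" if "e \<in> E" for e using sg that by (auto simp: simple_graph_def)
  have pl: "p \<noteq> l" using assms by auto
  have adj_l: "a = p" if "adjacent ?E l a" for a
    using that EV assms(3) by (auto simp: adjacent_def doubleton_eq_iff)
  have mono: "gpath ?E q" if "gpath E q" for q
    using that by (rule gpath_mono) (auto simp: adjacent_def)
  have inV: "set q \<subseteq> V" if "gpath E q" "hd q \<in> V" for q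
    using that
  proof (induction q)
    case (Cons x q)
    show ?case
    proof (cases q)
      case (Cons y q')
      then have "adjacent E x y" "gpath E q" using Cons.prems by (auto simp: gpath_def)
      then show ?thesis using Cons.IH Cons.prems EV[of "{x, y}"] Cons by (auto simp: adjacent_def)
    qed (use Cons.prems in auto)
  qed (simp add: gpath_def)
  have "simple_graph (insert l V) ?E"
    using sg assms pl by (auto simp: simple_graph_def)
  moreover have "connected_graph (insert l V) ?E"
    unfolding connected_graph_def
  proof (intro conjI ballI)
    fix u v assume uv: "u \<in> insert l V" "v \<in> insert l V"
    have P: "\<exists>q. gpath E q \<and> hd q = u \<and> last q = v" if "u \<in> V" "v \<in> V" for u v
      using cg that by (auto simp: connected_graph_def)
    consider "u \<in> V" "v \<in> V" | "u = l" "v = l" | "u \<in> V" "v = l" | "u = l" "v \<in> V" using uv by auto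
    then show "\<exists>q. gpath ?E q \<and> hd q = u \<and> last q = v"
    proof cases
      case 1
      then show ?thesis using P mono by blast
    next
      case 2
      then show ?thesis by (intro exI[of _ "[l]"]) (simp add: gpath_def)
    next
      case 3
      then obtain q where q: "gpath E q" "hd q = u" "last q = p" using P assms(2) by blast
      have "l \<notin> set q" using inV[OF q(1)] q(2) 3 assms(3) by auto
      then have "gpath ?E (q @ [l])"
        using mono[OF q(1)] q by (auto simp: gpath_def successively_append_iff adjacent_def)
      then show ?thesis using 3 q by (intro exI[of _ "q @ [l]"]) (auto simp: gpath_def)
    next
      case 4
      then obtain q where q: "gpath E q" "hd q = p" "last q = v" using P assms(2) by blast
      have "l \<notin> set q" using inV[OF q(1)] q(2) assms by auto
      then have "gpath ?E (l # q)"
        using mono[OF q(1)] q by (cases q) (auto simp: gpath_def adjacent_def insert_commute)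
      then show ?thesis using 4 q by (intro exI[of _ "l # q"]) (auto simp: gpath_def)
    qed
  qed simp
  moreover have "\<not> gcycle ?E c" for c
  proof
    assume c: "gcycle ?E c"
    show False
    proof (cases "l \<in> set c")
      case True
      then show False using gcycle_neighbours[OF c True] adj_l by metis
    next
      case False
      have "adjacent E u v" if "adjacent ?E u v" "u \<in> set c" "v \<in> set c" for u v
        using that False by (auto simp: adjacent_def doubleton_eq_iff)
      moreover have "last c \<in> set c" "hd c \<in> set c" using c by (auto simp: gcycle_def gpath_def)
      ultimately have "gcycle E c" using c gpath_mono[of ?E c E] by (auto simp: gcycle_def)
      then show False using ac by blast
    qed
  qed
  ultimately show ?thesis by (auto simp: tree_graph_def)
qed

lemma tree_graph_single: "tree_graph {r} {}"
proof -
  have "\<not> gcycle {} c" for c :: "'a list"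
    using gcycle_neighbours[of "{}" c "hd c"] by (force simp: gcycle_def gpath_def adjacent_def)
  then show ?thesis
    by (auto simp: tree_graph_def simple_graph_def connected_graph_def gpath_def intro!: exI[of _ "[r]"])
qed

lemma grown_tree_graph: "grown r V E \<Longrightarrow> tree_graph V E \<and> r \<in> V"
  by (induction rule: grown.induct) (auto intro: tree_graph_single tree_graph_leaf)

text \<open>The end of a longest path from \<open>r\<close>: a second neighbour would either extend
  the path or close a cycle.\<close>

lemma tree_graph_has_leaf:
  assumes T: "tree_graph V E" and r: "r \<in> V" and V: "V \<noteq> {r}"
  obtains p l where "p \<in> V" "l \<in> V" "p \<noteq> l" "l \<noteq> r" "{p, l} \<in> E" "\<And>a. adjacent E l a \<Longrightarrow> a = p"
proof -
  have sg: "finite V" "\<And>e. e \<in> E \<Longrightarrow> e \<subseteq> V \<and> card e = 2" and cg: "connected_graph V E" and ac: "\<nexists>c. gcycle E c"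
    using T by (auto simp: tree_graph_def simple_graph_def)
  have adjV: "v \<in> V \<and> u \<in> V \<and> u \<noteq> v" if "adjacent E u v" for u v
    using sg(2)[of "{u, v}"] that by (auto simp: adjacent_def)
  let ?P = "\<lambda>q. gpath E q \<and> hd q = r \<and> set q \<subseteq> V"
  have "?P [r]" using r by (simp add: gpath_def)
  moreover have "\<forall>q. ?P q \<longrightarrow> length q < card V + 1"
    using sg(1) by (auto simp: gpath_def) (metis card_mono distinct_card le_imp_less_Suc)
  ultimately obtain q where q: "?P q" and mx: "\<And>q'. ?P q' \<Longrightarrow> length q' \<le> length q"
    using ex_has_greatest_nat[of ?P "[r]" length "card V + 1"] by auto
  obtain v where v: "v \<in> V" "v \<noteq> r" using V r by blast
  obtain s where s: "gpath E s" "hd s = r" "last s = v" using cg r v by (auto simp: connected_graph_def)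
  then obtain x s' where s': "s = r # x # s'" using v
    by (metis gpath_def hd_Cons_tl last_ConsL list.exhaust_sel)
  then have "adjacent E r x" "x \<noteq> r" using s by (auto simp: gpath_def)
  then have "?P [r, x]" using adjV by (auto simp: gpath_def)
  then have "2 \<le> length q" using mx[of "[r, x]"] by simp
  then obtain q0 p l where qpl: "q = q0 @ [p, l]"
    by (metis append_butlast_last_id append.assoc append_Cons append_Nil length_0_conv length_append_singleton le_numeral_extra(3) not_numeral_le_zero numeral_2_eq_2 not_less_eq_eq)
  have qd: "distinct q" "successively (adjacent E) q" using q by (auto simp: gpath_def)
  have adj: "adjacent E p l" using qd(2) qpl by (auto simp: successively_append_iff)
  have lr: "l \<noteq> r" using q qd(1) qpl by (cases q0) auto
  have "a = p" if a: "adjacent E l a" for a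
  proof (rule ccontr)
    assume ap: "a \<noteq> p"
    show False
    proof (cases "a \<in> set q")
      case False
      have "?P (q @ [a])" using q False a adjV[OF a] qpl by (auto simp: gpath_def successively_append_iff hd_append)
      then show False using mx[of "q @ [a]"] by simp
    next
      case True
      then have "a \<in> set q0" using qpl ap adjV[OF a] by auto
      then obtain xs ys where "q0 = xs @ a # ys" by (metis split_list)
      then have "gcycle E (a # ys @ [p, l])"
        using qd qpl a by (auto simp: gcycle_def gpath_def successively_append_iff)
      then show False using ac by blast
    qed
  qed
  then show ?thesis using that[of p l] adj adjV[OF adj] lr by (auto simp: adjacent_def)
qed

lemma tree_graph_grown:
  assumes "tree_graph V E" "r \<in> V"
  shows "grown r V E"
  using assms
proof (induction "card V" arbitrary: V E rule: less_induct)
  case less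
  have sg: "finite V" "\<And>e. e \<in> E \<Longrightarrow> e \<subseteq> V \<and> card e = 2" and cg: "connected_graph V E" and ac: "\<nexists>c. gcycle E c"
    using less.prems by (auto simp: tree_graph_def simple_graph_def)
  show ?case
  proof (cases "V = {r}")
    case True
    have "E = {}"
    proof (rule ccontr)
      assume "E \<noteq> {}"
      then obtain e where "e \<subseteq> {r}" "card e = 2" using sg(2) True by blast
      then show False using card_mono[of "{r}" e] by simp
    qed
    then show ?thesis using True grown.base by simp
  next
    case False
    then obtain p l where pl: "p \<in> V" "l \<in> V" "p \<noteq> l" "l \<noteq> r" "{p, l} \<in> E" "\<And>a. adjacent E l a \<Longrightarrow> a = p"
      using tree_graph_has_leaf[OF less.prems] by metis
    let ?V = "V - {l}" and ?E = "E - {{p, l}}"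
    have only: "e = {p, l}" if e: "e \<in> E" "l \<in> e" for e
    proof -
      obtain a b where ab: "e = {a, b}" using sg(2)[OF e(1)] by (metis card_2_iff)
      then consider "l = a" | "l = b" using e(2) by auto
      then show ?thesis
      proof cases
        case 1
        then have "adjacent E l b" using ab e(1) by (simp add: adjacent_def)
        then show ?thesis using pl(6) ab 1 by auto
      next
        case 2
        then have "adjacent E l a" using ab e(1) by (simp add: adjacent_def insert_commute)
        then show ?thesis using pl(6) ab 2 by auto
      qed
    qed
    have keep: "adjacent ?E u v" if "adjacent E u v" "u \<noteq> l" "v \<noteq> l" for u v
      using that by (auto simp: adjacent_def doubleton_eq_iff)
    have "simple_graph ?V ?E" using sg only by (auto simp: simple_graph_def)
    moreover have "connected_graph ?V ?E"
      unfolding connected_graph_def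
    proof (intro conjI ballI)
      show "?V \<noteq> {}" using pl by auto
      fix u v assume uv: "u \<in> ?V" "v \<in> ?V"
      then obtain q where q: "gpath E q" "hd q = u" "last q = v" using cg by (auto simp: connected_graph_def)
      have "l \<notin> set q"
      proof
        assume "l \<in> set q"
        then obtain a b where "a \<noteq> b" "adjacent E l a" "adjacent E l b"
          using gpath_inner_neighbours[OF q(1), of l] uv q by auto
        then show False using pl(6) by metis
      qed
      then have "gpath ?E q" by (intro gpath_mono[OF q(1)]) (metis keep)
      then show "\<exists>q. gpath ?E q \<and> hd q = u \<and> last q = v" using q by blast
    qed
    moreover have "\<not> gcycle ?E c" for c
    proof
      assume c: "gcycle ?E c"
      then have "gpath E c" using gpath_mono[of ?E c E] by (auto simp: gcycle_def adjacent_def)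
      then have "gcycle E c" using c by (auto simp: gcycle_def adjacent_def)
      then show False using ac by blast
    qed
    ultimately have "tree_graph ?V ?E" by (auto simp: tree_graph_def)
    moreover have "card ?V < card V" using sg(1) pl(2) by (rule card_Diff1_less)
    ultimately have "grown r ?V ?E" using less.hyps less.prems pl(4) by blast
    then have "grown r (insert l ?V) (insert {p, l} ?E)" using pl by (intro grown.leaf) auto
    then show ?thesis using pl by (simp add: insert_absorb)
  qed
qed

section \<open>Labelled rooted trees\<close>

datatype 'a ltree = L (lab: 'a) (sub: "'a ltree list")

primrec verts :: "'a ltree \<Rightarrow> 'a list" where
  "verts (L x ts) = x # concat (map verts ts)"

text \<open>The pairs carry the label of each child next to its recursive value, which keeps the
  recursion primitive; \<open>parent_child_L\<close> is the readable equation.\<close>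

primrec parent_child :: "'a ltree \<Rightarrow> ('a \<times> 'a) set" where
  "parent_child (L x ts) = (\<Union>(y, R) \<in> set (map (\<lambda>t. (lab t, parent_child t)) ts). insert (x, y) R)"

primrec shape :: "'a ltree \<Rightarrow> mtree" where
  "shape (L x ts) = N (mset (map shape ts))"

primrec subs :: "'a ltree \<Rightarrow> 'a ltree list" where
  "subs (L x ts) = L x ts # concat (map subs ts)"

definition ltree_edges :: "'a ltree \<Rightarrow> 'a set set" where
  "ltree_edges t = (\<lambda>(v, w). {v, w}) ` parent_child t"

lemma parent_child_L [simp]: "parent_child (L x ts) = (\<Union>t\<in>set ts. insert (x, lab t) (parent_child t))"
  by auto

declare parent_child.simps [simp del]

lemma lab_verts [simp]: "lab t \<in> set (verts t)"
  by (cases t) simp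

lemma parent_child_verts: "(v, w) \<in> parent_child t \<Longrightarrow> v \<in> set (verts t) \<and> w \<in> set (verts t)"
  by (induction t) fastforce

lemma finite_parent_child [simp]: "finite (parent_child t)"
  by (rule finite_subset[of _ "set (verts t) \<times> set (verts t)"]) (auto dest: parent_child_verts)

lemma distinct_sub:
  assumes "distinct (verts (L x ts))"
  shows "\<And>t. t \<in> set ts \<Longrightarrow> distinct (verts t)" "\<And>t. t \<in> set ts \<Longrightarrow> x \<notin> set (verts t)"
    "\<And>s t y. s \<in> set ts \<Longrightarrow> t \<in> set ts \<Longrightarrow> y \<in> set (verts s) \<Longrightarrow> y \<in> set (verts t) \<Longrightarrow> s = t"
    "distinct (map lab ts)"
proof -
  have d: "distinct (concat (map verts ts))" "x \<notin> set (concat (map verts ts))" using assms by auto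
  show "distinct (verts t)" if "t \<in> set ts" for t using d(1) that by (auto simp: distinct_concat_iff)
  show "x \<notin> set (verts t)" if "t \<in> set ts" for t using d(2) that by auto
  show *: "s = t" if "s \<in> set ts" "t \<in> set ts" "y \<in> set (verts s)" "y \<in> set (verts t)" for s t y
  proof (rule ccontr)
    assume "s \<noteq> t"
    show False
      using d(1) that \<open>s \<noteq> t\<close>
    proof (induction ts)
      case (Cons a ts)
      then show ?case by auto
    qed simp
  qed
  show "distinct (map lab ts)"
    using d(1)
  proof (induction ts)
    case (Cons a ts)
    have "lab a \<notin> lab ` set ts"
    proof
      assume "lab a \<in> lab ` set ts"
      then obtain b where "b \<in> set ts" "lab a = lab b" by auto
      then have "lab a \<in> set (concat (map verts ts))" by (auto simp: intro!: bexI[of _ b])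
      then show False using Cons.prems lab_verts[of a] by (simp, blast)
    qed
    then show ?case using Cons by auto
  qed simp
qed

lemma parent_child_target: "distinct (verts t) \<Longrightarrow> (v, w) \<in> parent_child t \<Longrightarrow> w \<noteq> lab t"
proof (cases t)
  case (L x ts)
  assume "distinct (verts t)" "(v, w) \<in> parent_child t"
  then obtain s where "s \<in> set ts" "w \<in> set (verts s)" using parent_child_verts unfolding L by fastforce
  then show ?thesis using distinct_sub(2)[of x ts] \<open>distinct (verts t)\<close> unfolding L by auto
qed

lemma parent_child_insert_verts: "(v, w) \<in> insert (x, lab s) (parent_child s) \<Longrightarrow> w \<in> set (verts s)"
  using parent_child_verts[of v w s] by (cases "(v, w) = (x, lab s)") auto

lemma parent_child_unique_parent:
  "distinct (verts t) \<Longrightarrow> (v, w) \<in> parent_child t \<Longrightarrow> (v', w) \<in> parent_child t \<Longrightarrow> v = v'"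
proof (induction t)
  case (L x ts)
  obtain s where s: "s \<in> set ts" "(v, w) \<in> insert (x, lab s) (parent_child s)" using L.prems by auto
  obtain s' where s': "s' \<in> set ts" "(v', w) \<in> insert (x, lab s') (parent_child s')" using L.prems by auto
  have "w \<in> set (verts s)" "w \<in> set (verts s')"
    using parent_child_insert_verts[OF s(2)] parent_child_insert_verts[OF s'(2)] by simp_all
  then have eq: "s = s'" using distinct_sub(3)[OF L.prems(1)] s s' by blast
  have d: "distinct (verts s)" using distinct_sub(1)[OF L.prems(1)] s by blast
  show ?case
    using s s' eq parent_child_target[OF d] L.IH[OF s(1) d] by auto
qed

lemma parent_child_asym: "distinct (verts t) \<Longrightarrow> (v, w) \<in> parent_child t \<Longrightarrow> (w, v) \<notin> parent_child t"
proof (induction t)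
  case (L x ts)
  show ?case
  proof
    assume wv: "(w, v) \<in> parent_child (L x ts)"
    have "v \<noteq> x" "w \<noteq> x" using parent_child_target[OF L.prems(1)] wv L.prems(2) by auto
    then obtain s s' where s: "s \<in> set ts" "(v, w) \<in> parent_child s" "s' \<in> set ts" "(w, v) \<in> parent_child s'"
      using L.prems(2) wv by auto
    then have "s = s'" using distinct_sub(3)[OF L.prems(1)] parent_child_verts by metis
    then show False using L.IH[OF s(1)] distinct_sub(1)[OF L.prems(1) s(1)] s by auto
  qed
qed

lemma parent_child_irrefl: "distinct (verts t) \<Longrightarrow> (v, v) \<notin> parent_child t"
  using parent_child_asym by fast

lemma parent_exists: "w \<in> set (verts t) \<Longrightarrow> w \<noteq> lab t \<Longrightarrow> \<exists>v. (v, w) \<in> parent_child t"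
proof (induction t)
  case (L x ts)
  then obtain s where s: "s \<in> set ts" "w \<in> set (verts s)" by auto
  then show ?case using L.IH[OF s] by (cases "w = lab s") auto
qed

lemma self_subs [simp]: "t \<in> set (subs t)" by (cases t) simp

lemma subs_verts: "u \<in> set (subs t) \<Longrightarrow> set (verts u) \<subseteq> set (verts t)"
  by (induction t) fastforce

lemma verts_subs: "set (verts t) = lab ` set (subs t)"
  by (induction t) (auto simp: image_iff)

lemma subs_trans: "u \<in> set (subs s) \<Longrightarrow> s \<in> set (sub t) \<Longrightarrow> u \<in> set (subs t)"
  by (cases t) auto

lemma subs_sub: "u \<in> set (subs t) \<Longrightarrow> c \<in> set (sub u) \<Longrightarrow> c \<in> set (subs t)"
proof (induction t)
  case (L x ts)
  show ?case
  proof (cases "u = L x ts")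
    case True
    then have "c \<in> set ts" using L.prems(2) by simp
    then show ?thesis by (auto intro: bexI[of _ c])
  next
    case False
    then obtain s where s: "s \<in> set ts" "u \<in> set (subs s)" using L.prems by auto
    then show ?thesis using L.IH[OF s] L.prems(2) by auto
  qed
qed

lemma subs_distinct: "distinct (verts t) \<Longrightarrow> u \<in> set (subs t) \<Longrightarrow> distinct (verts u)"
proof (induction t)
  case (L x ts)
  then show ?case using distinct_sub(1)[OF L.prems(1)] by auto
qed

lemma parent_child_children:
  "distinct (verts t) \<Longrightarrow> u \<in> set (subs t) \<Longrightarrow> {w. (lab u, w) \<in> parent_child t} = lab ` set (sub u)"
proof (induction t)
  case (L x ts)
  note d = distinct_sub[OF L.prems(1)]
  show ?case
  proof (cases "u = L x ts")
    case True
    have "(x, w) \<notin> parent_child s" if "s \<in> set ts" for w s using d(2)[OF that] parent_child_verts[of x w s] by blast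
    then show ?thesis using True by auto
  next
    case False
    then obtain s where s: "s \<in> set ts" "u \<in> set (subs s)" using L.prems by auto
    have us: "lab u \<in> set (verts s)" using subs_verts[OF s(2)] lab_verts by blast
    then have ux: "lab u \<noteq> x" using d(2)[OF s(1)] by auto
    have "(lab u, w) \<in> parent_child (L x ts) \<longleftrightarrow> (lab u, w) \<in> parent_child s" for w
    proof
      assume "(lab u, w) \<in> parent_child (L x ts)"
      then obtain s' where "s' \<in> set ts" "(lab u, w) \<in> parent_child s'" using ux by auto
      moreover from this have "s' = s" using d(3)[OF _ s(1) _ us] parent_child_verts by metis
      ultimately show "(lab u, w) \<in> parent_child s" by simp
    qed (use s in auto)
    then show ?thesis using L.IH[OF s(1) d(1)[OF s(1)] s(2)] by simp
  qed
qed

lemma card_children: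
  assumes "distinct (verts t)" "u \<in> set (subs t)"
  shows "card {w. (lab u, w) \<in> parent_child t} = length (sub u)"
proof -
  obtain x ts where u: "u = L x ts" by (cases u)
  have "distinct (map lab (sub u))"
    using distinct_sub(4)[of x ts] subs_distinct[OF assms] u by simp
  then have "inj_on lab (set (sub u))" "distinct (sub u)" by (simp_all add: distinct_map)
  then show ?thesis unfolding parent_child_children[OF assms] by (simp add: card_image distinct_card)
qed

lemma vdegree_ltree_edges:
  assumes d: "distinct (verts t)" and u: "u \<in> set (subs t)"
  shows "vdegree (ltree_edges t) (lab u) = length (sub u) + (if lab u = lab t then 0 else 1)"
proof -
  let ?v = "lab u"
  let ?A = "(\<lambda>w. {?v, w}) ` {w. (?v, w) \<in> parent_child t}" and ?B = "(\<lambda>p. {p, ?v}) ` {p. (p, ?v) \<in> parent_child t}"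
  have eq: "{e \<in> ltree_edges t. ?v \<in> e} = ?A \<union> ?B" by (auto simp: ltree_edges_def)
  have fin: "finite {w. (?v, w) \<in> parent_child t}" "finite {p. (p, ?v) \<in> parent_child t}"
    by (rule finite_subset[of _ "set (verts t)"]; auto dest: parent_child_verts)+
  have "?A \<inter> ?B = {}" using parent_child_asym[OF d] parent_child_irrefl[OF d] by (auto simp: doubleton_eq_iff)
  then have "vdegree (ltree_edges t) ?v = card ?A + card ?B"
    unfolding vdegree_def eq using fin by (intro card_Un_disjoint) auto
  moreover have "card ?A = length (sub u)"
    by (subst card_image) (auto simp: inj_on_def doubleton_eq_iff card_children[OF d u])
  moreover have "card ?B = (if ?v = lab t then 0 else 1)"
  proof (cases "?v = lab t")
    case True
    then have "{p. (p, ?v) \<in> parent_child t} = {}" using parent_child_target[OF d] by auto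
    then show ?thesis using True by simp
  next
    case False
    have "?v \<in> set (verts t)" using u verts_subs[of t] by blast
    then obtain p where "(p, ?v) \<in> parent_child t" using parent_exists False by metis
    then have "{p. (p, ?v) \<in> parent_child t} = {p}" using parent_child_unique_parent[OF d] by auto
    then show ?thesis using False by simp
  qed
  ultimately show ?thesis by simp
qed

lemma length_verts: "length (verts t) = nv (shape t)"
proof (induction t)
  case (L x ts)
  then have "length (concat (map verts ts)) = nvF (mset (map shape ts))"
    by (induction ts) auto
  then show ?case by (simp add: nv_N)
qed

lemma dg_shape: "dg (shape t) = length (sub t) + 1"
  by (cases t) simp

text \<open>The degree function is left free at the root of \<open>t\<close>, since only the root of
  the whole tree lacks a parent edge. This is what lets the induction pass to subtrees.\<close>

lemma gain_sum:
  fixes \<delta> :: "'a \<Rightarrow> nat"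
  shows "distinct (verts t) \<Longrightarrow> (\<And>s u. s \<in> set (sub t) \<Longrightarrow> u \<in> set (subs s) \<Longrightarrow> \<delta> (lab u) = length (sub u) + 1) \<Longrightarrow>
    (\<Sum>(v, w)\<in>parent_child t. gain (\<delta> v) (\<delta> w)) = brF (\<delta> (lab t)) (kids (shape t))"
proof (induction t)
  case (L x ts)
  note d = distinct_sub[OF L.prems(1)]
  let ?g = "\<lambda>(v, w). gain (\<delta> v) (\<delta> w)"
  have one: "sum ?g (insert (x, lab s) (parent_child s)) = br (shape s) (\<delta> x)" if s: "s \<in> set ts" for s
  proof -
    have "(x, lab s) \<notin> parent_child s" using d(2)[OF s] parent_child_verts[of x "lab s" s] by blast
    then have "sum ?g (insert (x, lab s) (parent_child s)) = gain (\<delta> x) (\<delta> (lab s)) + sum ?g (parent_child s)" by simp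
    also have "sum ?g (parent_child s) = brF (\<delta> (lab s)) (kids (shape s))"
      by (rule L.IH[OF s d(1)[OF s]]) (metis L.prems(2) s subs_trans ltree.sel(2))
    also have "\<delta> (lab s) = dg (shape s)" using L.prems(2)[of s s] s dg_shape[of s] by simp
    finally show ?thesis by (cases "shape s") (simp add: br_N)
  qed
  have "sum ?g (\<Union>s\<in>set us. insert (x, lab s) (parent_child s)) = brF (\<delta> x) (mset (map shape us))"
    if "distinct (concat (map verts us))" "set us \<subseteq> set ts" for us
    using that
  proof (induction us)
    case (Cons s us)
    have "insert (x, lab s) (parent_child s) \<inter> (\<Union>s\<in>set us. insert (x, lab s) (parent_child s)) = {}"
    proof (rule ccontr)
      assume "\<not> ?thesis"
      then obtain z where z: "z \<in> insert (x, lab s) (parent_child s)" "z \<in> (\<Union>s\<in>set us. insert (x, lab s) (parent_child s))" by blast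
      obtain v w where vw: "z = (v, w)" by (cases z)
      from z(2) obtain s' where "s' \<in> set us" "z \<in> insert (x, lab s') (parent_child s')" by (rule UN_E)
      then have "w \<in> set (verts s)" "w \<in> set (concat (map verts us))"
        using parent_child_insert_verts[of v w x s] parent_child_insert_verts[of v w x s'] z(1) vw by auto
      then show False using Cons.prems(1) by (simp, blast)
    qed
    then have "sum ?g (\<Union>s\<in>set (s # us). insert (x, lab s) (parent_child s))
      = sum ?g (insert (x, lab s) (parent_child s)) + sum ?g (\<Union>s\<in>set us. insert (x, lab s) (parent_child s))"
      by (simp only: list.set UN_insert) (rule sum.union_disjoint, auto)
    then show ?case using Cons one[of s] by simp
  qed simp
  from this[of ts] show ?case using L.prems(1) by simp
qed

lemma ABC_index_ltree_edges:
  assumes d: "distinct (verts t)"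
  shows "ABC_index (ltree_edges t) = (nv (shape t) - 1) * sqrt (1/2) - brF (size (kids (shape t))) (kids (shape t))"
proof -
  let ?\<delta> = "vdegree (ltree_edges t)"
  have inj: "inj_on (\<lambda>(v, w). {v, w}) (parent_child t)"
    using parent_child_asym[OF d] by (auto simp: inj_on_def doubleton_eq_iff)
  have "ABC_index (ltree_edges t) = (\<Sum>(v, w)\<in>parent_child t. abc_weight (ltree_edges t) {v, w})"
    unfolding ABC_index_def using inj by (subst ltree_edges_def) (simp add: sum.reindex case_prod_unfold)
  also have "\<dots> = (\<Sum>(v, w)\<in>parent_child t. sqrt (1/2) - gain (?\<delta> v) (?\<delta> w))"
  proof (intro sum.cong refl, clarify)
    fix v w assume "(v, w) \<in> parent_child t"
    then have "v \<noteq> w" using parent_child_irrefl[OF d] by blast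
    then show "abc_weight (ltree_edges t) {v, w} = sqrt (1/2) - gain (?\<delta> v) (?\<delta> w)"
      by (simp add: abc_weight_edge gain_def)
  qed
  also have "\<dots> = card (parent_child t) * sqrt (1/2) - (\<Sum>(v, w)\<in>parent_child t. gain (?\<delta> v) (?\<delta> w))"
    by (simp add: case_prod_unfold sum_subtractf)
  also have "(\<Sum>(v, w)\<in>parent_child t. gain (?\<delta> v) (?\<delta> w)) = brF (?\<delta> (lab t)) (kids (shape t))"
  proof (rule gain_sum[OF d])
    fix s u assume s: "s \<in> set (sub t)" and u: "u \<in> set (subs s)"
    have "lab t \<notin> set (verts s)" using distinct_sub(2)[of "lab t" "sub t"] d s by simp
    then have "lab u \<noteq> lab t" using subs_verts[OF u] lab_verts by (metis subsetD)
    then show "?\<delta> (lab u) = length (sub u) + 1"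
      using vdegree_ltree_edges[OF d subs_trans[OF u s]] by simp
  qed
  also have "?\<delta> (lab t) = size (kids (shape t))"
    using vdegree_ltree_edges[OF d self_subs] dg_shape[of t] by (simp add: dg_def)
  also have "card (parent_child t) = nv (shape t) - 1"
  proof -
    have "snd ` parent_child t = set (verts t) - {lab t}"
    proof (intro set_eqI iffI)
      fix w assume "w \<in> snd ` parent_child t"
      then obtain v where vw: "(v, w) \<in> parent_child t" by (metis imageE prod.collapse)
      show "w \<in> set (verts t) - {lab t}" using parent_child_target[OF d vw] parent_child_verts[OF vw] by simp
    next
      fix w assume "w \<in> set (verts t) - {lab t}"
      then obtain v where "(v, w) \<in> parent_child t" using parent_exists[of w t] by auto
      then show "w \<in> snd ` parent_child t" by (metis image_eqI snd_conv)
    qed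
    moreover have "inj_on snd (parent_child t)"
      by (rule inj_onI) (metis parent_child_unique_parent[OF d] prod.collapse)
    ultimately have "card (parent_child t) = card (set (verts t) - {lab t})" by (metis card_image)
    then show ?thesis using d length_verts[of t] by (simp add: distinct_card)
  qed
  finally show ?thesis by simp
qed

section \<open>Passage between graph trees and labelled trees\<close>

lemma ltree_insert_leaf:
  "p \<in> set (verts t) \<Longrightarrow> \<exists>t'. lab t' = lab t \<and> mset (verts t') = add_mset l (mset (verts t)) \<and> parent_child t' = insert (p, l) (parent_child t)"
proof (induction t)
  case (L x ts)
  show ?case
  proof (cases "p = x")
    case True
    then show ?thesis by (intro exI[of _ "L x (L l [] # ts)"]) auto
  next
    case False
    then obtain s where s: "s \<in> set ts" "p \<in> set (verts s)" using L.prems by auto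
    from L.IH[OF this] obtain s' where s': "lab s' = lab s" "mset (verts s') = add_mset l (mset (verts s))"
      "parent_child s' = insert (p, l) (parent_child s)" by auto
    obtain as bs where "ts = as @ s # bs" using s(1) by (metis split_list)
    then show ?thesis using s' by (intro exI[of _ "L x (as @ s' # bs)"]) auto
  qed
qed

lemma grown_ltree:
  "grown r V E \<Longrightarrow> \<exists>t. lab t = r \<and> distinct (verts t) \<and> set (verts t) = V \<and> ltree_edges t = E"
proof (induction rule: grown.induct)
  case base
  show ?case by (intro exI[of _ "L r []"]) (simp add: ltree_edges_def)
next
  case (leaf V E p l)
  then obtain t where t: "lab t = r" "distinct (verts t)" "set (verts t) = V" "ltree_edges t = E" by auto
  then obtain t' where t': "lab t' = lab t" "mset (verts t') = add_mset l (mset (verts t))" "parent_child t' = insert (p, l) (parent_child t)"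
    using ltree_insert_leaf[of p t l] leaf by auto
  have "mset (verts t') = mset (l # verts t)" using t'(2) by simp
  then have "distinct (verts t')" "set (verts t') = insert l V"
    using t leaf mset_eq_imp_distinct_iff[of "verts t'" "l # verts t"] mset_eq_setD[of "verts t'" "l # verts t"] by auto
  then show ?case using t t' by (intro exI[of _ t']) (auto simp: ltree_edges_def)
qed

text \<open>The assumption \<open>IH\<close> is attachment of single subtrees, so that the lemma
  serves both within the induction for \<open>grown_attach\<close> and afterwards at the
  root.\<close>

lemma grown_attach_list:
  assumes IH: "\<And>s V E x. s \<in> set us \<Longrightarrow> grown r V E \<Longrightarrow> x \<in> V \<Longrightarrow> distinct (verts s) \<Longrightarrow> set (verts s) \<inter> V = {} \<Longrightarrow>
      grown r (V \<union> set (verts s)) (insert {x, lab s} (E \<union> ltree_edges s))"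
    and "grown r V E" "y \<in> V" "distinct (concat (map verts us))" "set (concat (map verts us)) \<inter> V = {}"
  shows "grown r (V \<union> set (concat (map verts us))) (E \<union> (\<Union>s\<in>set us. insert {y, lab s} (ltree_edges s)))"
  using assms
proof (induction us rule: rev_induct)
  case (snoc s us)
  let ?V = "V \<union> set (concat (map verts us))"
  let ?E = "E \<union> (\<Union>s\<in>set us. insert {y, lab s} (ltree_edges s))"
  have "grown r ?V ?E" using snoc.prems by (intro snoc.IH) auto
  then have "grown r (?V \<union> set (verts s)) (insert {y, lab s} (?E \<union> ltree_edges s))"
    using snoc.prems(3-5) by (intro snoc.prems(1)) auto
  moreover have "?V \<union> set (verts s) = V \<union> set (concat (map verts (us @ [s])))" by auto
  moreover have "insert {y, lab s} (?E \<union> ltree_edges s) = E \<union> (\<Union>s\<in>set (us @ [s]). insert {y, lab s} (ltree_edges s))" by auto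
  ultimately show ?case by simp
qed simp

lemma ltree_edges_L: "ltree_edges (L x ts) = (\<Union>s\<in>set ts. insert {x, lab s} (ltree_edges s))"
  by (auto simp: ltree_edges_def)

lemma grown_attach:
  "grown r V E \<Longrightarrow> x \<in> V \<Longrightarrow> distinct (verts t) \<Longrightarrow> set (verts t) \<inter> V = {} \<Longrightarrow>
    grown r (V \<union> set (verts t)) (insert {x, lab t} (E \<union> ltree_edges t))"
proof (induction t arbitrary: V E x)
  case (L y ts)
  have "grown r (insert y V) (insert {x, y} E)" using L.prems by (intro grown.leaf) auto
  then have "grown r (insert y V \<union> set (concat (map verts ts)))
      (insert {x, y} E \<union> (\<Union>s\<in>set ts. insert {y, lab s} (ltree_edges s)))"
    using L.prems by (intro grown_attach_list L.IH) auto
  moreover have "insert y V \<union> set (concat (map verts ts)) = V \<union> set (verts (L y ts))" by auto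
  ultimately show ?case by (simp add: ltree_edges_L)
qed

lemma ltree_tree_graph:
  assumes "distinct (verts t)" shows "tree_graph (set (verts t)) (ltree_edges t)"
proof -
  obtain x ts where t: "t = L x ts" by (cases t)
  have "grown x ({x} \<union> set (concat (map verts ts))) ({} \<union> (\<Union>s\<in>set ts. insert {x, lab s} (ltree_edges s)))"
    using assms t by (intro grown_attach_list grown_attach grown.base) auto
  then show ?thesis using grown_tree_graph t by (fastforce simp: ltree_edges_L)
qed

lemma verts_map: "verts (map_ltree f t) = map f (verts t)"
  by (induction t) (auto simp: map_concat comp_def cong: map_cong)

lemma shape_map: "shape (map_ltree f t) = shape t"
  by (induction t) (auto simp: comp_def cong: map_cong)

text \<open>Consecutive numbering keeps sibling subtrees disjoint.\<close>

lemma ltree_of_mtree: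
  "\<exists>t. shape t = T \<and> distinct (verts t) \<and> set (verts t) = {k ..< k + nv T}"
proof (induction T arbitrary: k)
  case (N M)
  obtain ms where ms: "M = mset ms" by (metis ex_mset)
  have "\<exists>ts. map shape ts = us \<and> distinct (concat (map verts ts)) \<and> set (concat (map verts ts)) = {j ..< j + nvF (mset us)}"
    if "set us \<subseteq> set ms" for us j
    using that
  proof (induction us arbitrary: j)
    case (Cons u us)
    obtain t where t: "shape t = u" "distinct (verts t)" "set (verts t) = {j ..< j + nv u}"
      using N.IH[of u j] Cons.prems ms by auto
    obtain ts where ts: "map shape ts = us" "distinct (concat (map verts ts))"
      "set (concat (map verts ts)) = {j + nv u ..< j + nv u + nvF (mset us)}"
      using Cons.IH[of "j + nv u"] Cons.prems by auto
    show ?case using t ts by (intro exI[of _ "t # ts"]) (auto simp del: set_concat)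
  qed simp
  from this[of ms "Suc k"] obtain ts where "map shape ts = ms" "distinct (concat (map verts ts))"
    "set (concat (map verts ts)) = {Suc k ..< Suc k + nvF M}" using ms by auto
  then show ?case using ms by (intro exI[of _ "L k ts"]) (auto simp: nv_N simp del: set_concat)
qed

lemma realize_mtree:
  assumes "finite V" "card V = nv T"
  obtains t where "shape t = T" "distinct (verts t)" "set (verts t) = V"
proof -
  obtain t0 where t0: "shape t0 = T" "distinct (verts t0)" "set (verts t0) = {0 ..< nv T}"
    using ltree_of_mtree[of T 0] by auto
  obtain f where f: "bij_betw f {0 ..< nv T} V"
    using ex_bij_betw_nat_finite[OF assms(1)] assms(2) by auto
  show thesis
  proof (rule that[of "map_ltree f t0"])
    show "distinct (verts (map_ltree f t0))"
      using t0 f by (simp add: verts_map distinct_map bij_betw_def)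
    show "set (verts (map_ltree f t0)) = V" using t0 f by (simp add: verts_map bij_betw_def)
  qed (simp add: shape_map t0)
qed

section \<open>Children and branches of the graph, read off the labelled tree\<close>

lemma children_ltree_edges:
  assumes d: "distinct (verts t)"
  shows "children (ltree_edges t) (lab t) v = {w. (v, w) \<in> parent_child t}"
proof -
  have down: "successively (\<lambda>a b. (a, b) \<in> parent_child t) p" if "gpath (ltree_edges t) p" "hd p = lab t" for p
  proof -
    \<comment> \<open>\<open>q\<close> is the part of the path already traversed. A step upwards
      would lead back to its last vertex, against distinctness.\<close>
    have "successively (\<lambda>a b. (a, b) \<in> parent_child t) p" if "distinct (q @ p)" "successively (adjacent (ltree_edges t)) p"
      "p \<noteq> []" "(q = [] \<and> hd p = lab t) \<or> (q \<noteq> [] \<and> (last q, hd p) \<in> parent_child t)" for q p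
      using that
    proof (induction p arbitrary: q)
      case (Cons a p)
      show ?case
      proof (cases p)
        case (Cons b p')
        have "adjacent (ltree_edges t) a b" using Cons.prems(2) Cons by simp
        then consider "(a, b) \<in> parent_child t" | "(b, a) \<in> parent_child t" by (auto simp: adjacent_def ltree_edges_def doubleton_eq_iff)
        then have ab: "(a, b) \<in> parent_child t"
        proof cases
          case 2
          then have "a \<noteq> lab t" using parent_child_target[OF d] by auto
          then have "q \<noteq> []" "(last q, a) \<in> parent_child t" using Cons.prems(4) by auto
          then have "b = last q" using parent_child_unique_parent[OF d 2] by blast
          then have "b \<in> set q" using \<open>q \<noteq> []\<close> by simp
          then show ?thesis using Cons.prems(1) Cons by auto
        qed
        then show ?thesis using Cons.IH[of "q @ [a]"] Cons.prems Cons by auto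
      qed simp
    qed simp
    from this[of "[]" p] show ?thesis using that by (auto simp: gpath_def)
  qed
  show ?thesis
  proof (intro set_eqI iffI)
    fix w assume "w \<in> children (ltree_edges t) (lab t) v"
    then obtain p where "gpath (ltree_edges t) (p @ [v, w])" "hd (p @ [v, w]) = lab t" by (auto simp: children_def)
    from down[OF this] show "w \<in> {w. (v, w) \<in> parent_child t}" by (simp add: successively_append_iff)
  next
    fix w assume "w \<in> {w. (v, w) \<in> parent_child t}"
    then have vw: "(v, w) \<in> parent_child t" by simp
    have "connected_graph (set (verts t)) (ltree_edges t)" using ltree_tree_graph[OF d] by (simp add: tree_graph_def)
    then obtain p where p: "gpath (ltree_edges t) p" "hd p = lab t" "last p = w"
      using parent_child_verts[OF vw] lab_verts[of t] unfolding connected_graph_def by blast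
    have wne: "w \<noteq> lab t" using parent_child_target[OF d vw] .
    obtain q where q: "p = q @ [w]" using p by (metis append_butlast_last_id gpath_def)
    then have "q \<noteq> []" using p wne by auto
    then obtain q' v' where q': "q = q' @ [v']" by (metis rev_exhaust)
    have "(v', w) \<in> parent_child t" using down[OF p(1,2)] q q' by (simp add: successively_append_iff)
    then have "v' = v" using parent_child_unique_parent[OF d vw] by blast
    then show "w \<in> children (ltree_edges t) (lab t) v" using p q q' unfolding children_def by auto
  qed
qed

lemma pd_shape: "length (filter (\<lambda>u. shape u = B2) (subs t)) = size (pd (shape t) d)"
proof (induction t arbitrary: d)
  case (L x ts)
  have "length (filter (\<lambda>u. shape u = B2) (concat (map subs us))) = size (pdF e (mset (map shape us)))"
    if "set us \<subseteq> set ts" for us e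
    using that
  proof (induction us)
    case (Cons u us)
    then show ?case using L.IH[of u e] by simp
  qed simp
  from this[of ts "length ts + 1"] show ?case by (simp add: pd_N)
qed

lemma B_branch_shape:
  assumes d: "distinct (verts t)" and u: "u \<in> set (subs t)" and B: "B_branch_root (ltree_edges t) (lab t) 2 (lab u)"
  shows "shape u = B2"
proof -
  have ch: "children (ltree_edges t) (lab t) (lab s) = lab ` set (sub s)" if "s \<in> set (subs t)" for s
    using children_ltree_edges[OF d] parent_child_children[OF d that] by simp
  have len: "card (children (ltree_edges t) (lab t) (lab s)) = length (sub s)" if "s \<in> set (subs t)" for s
    using children_ltree_edges[OF d] card_children[OF d that] by simp
  have P: "shape c = P2" if c: "c \<in> set (sub u)" for c
  proof -
    have cs: "c \<in> set (subs t)" using subs_sub[OF u c] .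
    obtain l where l: "children (ltree_edges t) (lab t) (lab c) = {l}" "vdegree (ltree_edges t) l = 1"
      using B ch[OF u] c by (auto simp: B_branch_root_def)
    then have "length (sub c) = 1" using len[OF cs] by simp
    then obtain e where e: "sub c = [e]" by (metis length_0_conv length_Suc_conv One_nat_def)
    have es: "e \<in> set (subs t)" using subs_sub[OF cs, of e] e by simp
    have le: "l = lab e" using ch[OF cs] l e by auto
    have "(lab c, lab e) \<in> parent_child t" using parent_child_children[OF d cs] e by auto
    then have "lab e \<noteq> lab t" using parent_child_target[OF d] by blast
    then have "sub e = []" using vdegree_ltree_edges[OF d es] l(2) le by simp
    then have "shape e = Lf" by (cases e) (simp add: Lf_def)
    then show ?thesis using e by (cases c) (simp add: P2_def)
  qed
  have "length (sub u) = 2" using len[OF u] B by (simp add: B_branch_root_def)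
  then obtain a b where "sub u = [a, b]" by (metis One_nat_def Suc_1 length_0_conv length_Suc_conv)
  then show ?thesis using P by (cases u) (simp add: B2_def)
qed

theorem theorem4p8:
  fixes V :: "'a set" and E :: "'a set set" and r :: 'a
  assumes "minimal_ABC_tree V E"
    and "card V \<ge> 10"
    and "r \<in> V"
  shows "card (B_branches V E r 2) \<le> 11"
proof -
  have T: "tree_graph V E" and min: "\<And>V' E'. tree_graph (V' :: 'a set) E' \<Longrightarrow> card V' = card V \<Longrightarrow> ABC_index E \<le> ABC_index E'"
    using assms(1) unfolding minimal_ABC_tree_def by blast+
  obtain t where t: "lab t = r" "distinct (verts t)" "set (verts t) = V" "ltree_edges t = E"
    using grown_ltree[OF tree_graph_grown[OF T assms(3)]] by auto
  obtain ts where ts: "shape t = N ts" by (cases "shape t")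
  have fin: "finite V" using t(3) by auto
  have card: "card V = nv (shape t)" using distinct_card[OF t(2)] t(3) length_verts[of t] by simp
  have "brF (size us) us \<le> brF (size ts) ts" if us: "nvF us = nvF ts" for us
  proof -
    have "card V = nv (N us)" using card ts us by (simp add: nv_N)
    then obtain s :: "'a ltree" where s: "shape s = N us" "distinct (verts s)" "set (verts s) = V"
      using realize_mtree[OF fin] by metis
    have "ABC_index E \<le> ABC_index (ltree_edges s)"
      using min[OF ltree_tree_graph[OF s(2)]] s(3) by simp
    then show ?thesis
      using ABC_index_ltree_edges[OF s(2)] ABC_index_ltree_edges[OF t(2)] s(1) ts t(4) us by (simp add: nv_N)
  qed
  then have bound: "size (pdF (size ts) ts) \<le> 11" by (rule mtree_B2_bound)
  let ?R = "{v \<in> V. B_branch_root E r 2 v}"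
  have "?R \<subseteq> lab ` set (filter (\<lambda>u. shape u = B2) (subs t))"
  proof
    fix v assume v: "v \<in> ?R"
    then obtain u where u: "u \<in> set (subs t)" "v = lab u" using t(3) verts_subs[of t] by auto
    then have "shape u = B2" using B_branch_shape[OF t(2) u(1)] v t by simp
    then show "v \<in> lab ` set (filter (\<lambda>u. shape u = B2) (subs t))" using u by auto
  qed
  then have "card ?R \<le> card (lab ` set (filter (\<lambda>u. shape u = B2) (subs t)))" by (intro card_mono) auto
  also have "\<dots> \<le> card (set (filter (\<lambda>u. shape u = B2) (subs t)))" by (rule card_image_le) simp
  also have "\<dots> \<le> length (filter (\<lambda>u. shape u = B2) (subs t))" by (rule card_length)
  also have "\<dots> = size (pd (shape t) 1)" by (rule pd_shape)
  \<comment> \<open>The whole tree is not a \<open>B2\<close>, which has only five vertices, so the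
    root of the tree is not counted.\<close>
  also have "\<dots> = size (pdF (size ts + 1) ts)"
  proof -
    have "N ts \<noteq> B2" using assms(2) card ts nv_special(3) by auto
    then show ?thesis by (simp add: ts pd_N)
  qed
  also have "\<dots> = size (pdF (size ts) ts)" by (rule size_pdF)
  finally have "card ?R \<le> 11" using bound by simp
  moreover have "B_branches V E r 2 = rooted_subtree E r ` ?R" by (auto simp: B_branches_def)
  then have "card (B_branches V E r 2) \<le> card ?R" using fin by (simp add: card_image_le)
  ultimately show ?thesis by simp
qed

end
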